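(* Let $T$ be a complete first-order theory, let $\pi(x)$ be a partial type over $\emptyset$ in a tuple of variables $x$ of length $\lambda$, and let ${\mathfrak C}\prec{\mathfrak C}'$ be models of $T$ which are both $\aleph_0$-saturated and strongly $\aleph_0$-homogeneous. Put $X=\pi({\mathfrak C})$ and let $r\colon S_X({\mathfrak C}')\to S_X({\mathfrak C})$ be the restriction map. Let $F'$ be a closed, $\operatorname{Aut}({\mathfrak C}')$-invariant equivalence relation on $S_X({\mathfrak C}')$ and $F$ a closed, $\operatorname{Aut}({\mathfrak C})$-invariant equivalence relation on $S_X({\mathfrak C})$, and suppose that $F'$ and $F$ are compatible, i.e. $\{(r(a),r(b)) : (a,b)\in F'\}=F$. Then the Ellis group of the flow $(\operatorname{Aut}({\mathfrak C}'),S_X({\mathfrak C}')/F')$ is topologically isomorphic to the Ellis group of the flow $(\operatorname{Aut}({\mathfrak C}),S_X({\mathfrak C})/F)$, where both Ellis groups carry the $\tau$-topology.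
   Context: A model $M$ is $\kappa$-saturated if every complete type over a subset of $M$ of size $<\kappa$ is realized in $M$, and strongly $\kappa$-homogeneous if every partial elementary map between subsets of $M$ of size $<\kappa$ extends to an automorphism of $M$. For a model ${\mathfrak C}$, $S_X({\mathfrak C})$ is the (Stone) space of complete types over ${\mathfrak C}$ in the variables $x$ containing $\pi$; $\operatorname{Aut}({\mathfrak C})$ (with the pointwise convergence topology) acts on it by $\sigma(p)=\{\varphi(x,\sigma(a)):\varphi(x,a)\in p\}$, giving a flow. A $G$-flow is a topological group $G$ acting continuously on a compact Hausdorff space $Y$; for a closed $G$-invariant equivalence relation $\sim$ on $Y$, $Y/\!\sim$ is again a $G$-flow. The Ellis semigroup $E(Y)$ is the closure in $Y^Y$ (product topology) of $\{y\mapsto gy: g\in G\}$; it is a compact semigroup under composition. If $\mathcal{M}$ is a minimal left ideal of $E(Y)$ and $u\in\mathcal{M}$ is an idempotent, then $u\mathcal{M}$ is a group, the Ellis group. The $\tau$-topology on $u\mathcal{M}$: for $a\in E(Y)$ and $B\subseteq E(Y)$ let $a\circ B$ be the set of limits of convergent nets $(g_ib_i)$ with $g_i\in G$, $b_i\in B$ and $g_i\to a$ (identifying $g$ with $y\mapsto gy$); the closure operator $\operatorname{cl}_\tau(B)=u\mathcal{M}\cap(u\circ B)$ for $B\subseteq u\mathcal{M}$ defines the $\tau$-topology. The Ellis group with the $\tau$-topology is, up to topological isomorphism, independent of the choice of $\mathcal{M}$ and $u$. *)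

theory Defs
  imports "HOL-Analysis.Analysis" "HOL-Algebra.Bij"
begin

unbundle cardinal_syntax

section \<open>First-order logic\<close>

text \<open>
  Symbols come as sets rather than whole types, so that a language may lack function symbols or
  relation symbols.
\<close>

record ('f, 'p) lang =
  fsyms :: "'f set"
  psyms :: "'p set"
  farity :: "'f \<Rightarrow> nat"
  parity :: "'p \<Rightarrow> nat"

text \<open>
  There are two kinds of variables: \<open>BVar n\<close> is available for quantification, whereas an atom
  \<open>Atom v\<close> is never quantified and plays the role of a free variable or of a parameter, depending
  on \<open>'v\<close>. With \<open>'v = 'i + 'a\<close>, the atom \<open>Inl i\<close> is the variable \<open>x\<^sub>i\<close> of the tuple \<open>x\<close> and \<open>Inr a\<close>
  is the parameter \<open>a\<close>.
\<close>

datatype (dead 'f, tatoms: 'v) tm =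
    BVar nat
  | Atom 'v
  | Fn 'f "('f, 'v) tm list"
  for map: trename

datatype (dead 'f, dead 'p, atoms: 'v) fm =
    Eq "('f, 'v) tm" "('f, 'v) tm"
  | Rel 'p "('f, 'v) tm list"
  | Neg "('f, 'p, 'v) fm"
  | Conj "('f, 'p, 'v) fm" "('f, 'p, 'v) fm"
  | Ex nat "('f, 'p, 'v) fm"
  for map: rename

fun wf_tm :: "('f, 'p) lang \<Rightarrow> ('f, 'v) tm \<Rightarrow> bool" where
  "wf_tm L (BVar n) \<longleftrightarrow> True"
| "wf_tm L (Atom v) \<longleftrightarrow> True"
| "wf_tm L (Fn f ts) \<longleftrightarrow> f \<in> fsyms L \<and> length ts = farity L f \<and> (\<forall>t\<in>set ts. wf_tm L t)"

fun wf_fm :: "('f, 'p) lang \<Rightarrow> ('f, 'p, 'v) fm \<Rightarrow> bool" where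
  "wf_fm L (Eq s t) \<longleftrightarrow> wf_tm L s \<and> wf_tm L t"
| "wf_fm L (Rel P ts) \<longleftrightarrow> P \<in> psyms L \<and> length ts = parity L P \<and> (\<forall>t\<in>set ts. wf_tm L t)"
| "wf_fm L (Neg \<phi>) \<longleftrightarrow> wf_fm L \<phi>"
| "wf_fm L (Conj \<phi> \<psi>) \<longleftrightarrow> wf_fm L \<phi> \<and> wf_fm L \<psi>"
| "wf_fm L (Ex n \<phi>) \<longleftrightarrow> wf_fm L \<phi>"

fun bvars_tm :: "('f, 'v) tm \<Rightarrow> nat set" where
  "bvars_tm (BVar n) = {n}"
| "bvars_tm (Atom v) = {}"
| "bvars_tm (Fn f ts) = (\<Union>t\<in>set ts. bvars_tm t)"

text \<open>The indices \<open>n\<close> such that \<open>BVar n\<close> occurs outside the scope of a quantifier \<open>Ex n\<close>.\<close>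

fun unbound :: "('f, 'p, 'v) fm \<Rightarrow> nat set" where
  "unbound (Eq s t) = bvars_tm s \<union> bvars_tm t"
| "unbound (Rel P ts) = (\<Union>t\<in>set ts. bvars_tm t)"
| "unbound (Neg \<phi>) = unbound \<phi>"
| "unbound (Conj \<phi> \<psi>) = unbound \<phi> \<union> unbound \<psi>"
| "unbound (Ex n \<phi>) = unbound \<phi> - {n}"

text \<open>
  \<open>fmls L V\<close> is the set of \<open>L\<close>-formulas whose free variables and parameters all belong to \<open>V\<close>; in
  particular \<open>fmls L {}\<close> is the set of \<open>L\<close>-sentences.
\<close>

definition fmls :: "('f, 'p) lang \<Rightarrow> 'v set \<Rightarrow> ('f, 'p, 'v) fm set" where
  "fmls L V = {\<phi>. wf_fm L \<phi> \<and> unbound \<phi> = {} \<and> atoms \<phi> \<subseteq> V}"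

record ('f, 'p, 'a) struct =
  univ :: "'a set"
  fint :: "'f \<Rightarrow> 'a list \<Rightarrow> 'a"
  pint :: "'p \<Rightarrow> 'a list \<Rightarrow> bool"

definition tuples :: "('f, 'p, 'a) struct \<Rightarrow> nat \<Rightarrow> 'a list set" where
  "tuples M n = {xs. length xs = n \<and> set xs \<subseteq> univ M}"

definition is_struct :: "('f, 'p) lang \<Rightarrow> ('f, 'p, 'a) struct \<Rightarrow> bool" where
  "is_struct L M \<longleftrightarrow> univ M \<noteq> {} \<and>
     (\<forall>f\<in>fsyms L. \<forall>xs\<in>tuples M (farity L f). fint M f xs \<in> univ M)"

fun teval :: "('f, 'p, 'a) struct \<Rightarrow> ('v \<Rightarrow> 'a) \<Rightarrow> (nat \<Rightarrow> 'a) \<Rightarrow> ('f, 'v) tm \<Rightarrow> 'a" where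
  "teval M v e (BVar n) = e n"
| "teval M v e (Atom x) = v x"
| "teval M v e (Fn f ts) = fint M f (map (teval M v e) ts)"

fun sat :: "('f, 'p, 'a) struct \<Rightarrow> ('v \<Rightarrow> 'a) \<Rightarrow> (nat \<Rightarrow> 'a) \<Rightarrow> ('f, 'p, 'v) fm \<Rightarrow> bool" where
  "sat M v e (Eq s t) \<longleftrightarrow> teval M v e s = teval M v e t"
| "sat M v e (Rel P ts) \<longleftrightarrow> pint M P (map (teval M v e) ts)"
| "sat M v e (Neg \<phi>) \<longleftrightarrow> \<not> sat M v e \<phi>"
| "sat M v e (Conj \<phi> \<psi>) \<longleftrightarrow> sat M v e \<phi> \<and> sat M v e \<psi>"
| "sat M v e (Ex n \<phi>) \<longleftrightarrow> (\<exists>d\<in>univ M. sat M v (e(n := d)) \<phi>)"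

text \<open>
  Truth of a member of \<open>fmls L V\<close> under the assignment \<open>v\<close> of its atoms. The environment for the
  quantifiable variables is irrelevant, since none of them occurs unbound.
\<close>

definition holds :: "('f, 'p, 'a) struct \<Rightarrow> ('v \<Rightarrow> 'a) \<Rightarrow> ('f, 'p, 'v) fm \<Rightarrow> bool" where
  "holds M v \<phi> \<longleftrightarrow> sat M v (\<lambda>_. undefined) \<phi>"

definition is_model ::
  "('f, 'p) lang \<Rightarrow> ('f, 'p, unit) fm set \<Rightarrow> ('f, 'p, 'a) struct \<Rightarrow> bool" where
  "is_model L T M \<longleftrightarrow> is_struct L M \<and> (\<forall>\<phi>\<in>T. holds M (\<lambda>_. undefined) \<phi>)"

text \<open>
  Semantic consequence. By the downward Loewenheim--Skolem theorem it suffices to consider models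
  whose universe is a set of formulas: there are at least \<open>|L| + \<aleph>\<^sub>0\<close> many formulas.
\<close>

definition entails ::
  "('f, 'p) lang \<Rightarrow> ('f, 'p, unit) fm set \<Rightarrow> ('f, 'p, unit) fm \<Rightarrow> bool" where
  "entails L T \<phi> \<longleftrightarrow>
     (\<forall>N :: ('f, 'p, ('f, 'p, unit) fm) struct. is_model L T N \<longrightarrow> holds N (\<lambda>_. undefined) \<phi>)"

definition complete_theory :: "('f, 'p) lang \<Rightarrow> ('f, 'p, unit) fm set \<Rightarrow> bool" where
  "complete_theory L T \<longleftrightarrow> T \<subseteq> fmls L {} \<and>
     (\<exists>N :: ('f, 'p, ('f, 'p, unit) fm) struct. is_model L T N) \<and>
     (\<forall>\<phi>\<in>fmls L {}. entails L T \<phi> \<or> entails L T (Neg \<phi>))"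

definition elementary_substruct ::
  "('f, 'p) lang \<Rightarrow> ('f, 'p, 'a) struct \<Rightarrow> ('f, 'p, 'a) struct \<Rightarrow> bool" where
  "elementary_substruct L M N \<longleftrightarrow> univ M \<subseteq> univ N \<and>
     (\<forall>f\<in>fsyms L. \<forall>xs\<in>tuples M (farity L f). fint M f xs = fint N f xs) \<and>
     (\<forall>P\<in>psyms L. \<forall>xs\<in>tuples M (parity L P). pint M P xs \<longleftrightarrow> pint N P xs) \<and>
     (\<forall>\<phi>\<in>fmls L (univ M). holds M (\<lambda>a. a) \<phi> \<longleftrightarrow> holds N (\<lambda>a. a) \<phi>)"

definition Aut :: "('f, 'p) lang \<Rightarrow> ('f, 'p, 'a) struct \<Rightarrow> ('a \<Rightarrow> 'a) set" where
  "Aut L M = {\<sigma> \<in> Bij (univ M).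
     (\<forall>f\<in>fsyms L. \<forall>xs\<in>tuples M (farity L f). \<sigma> (fint M f xs) = fint M f (map \<sigma> xs)) \<and>
     (\<forall>P\<in>psyms L. \<forall>xs\<in>tuples M (parity L P). pint M P (map \<sigma> xs) \<longleftrightarrow> pint M P xs)}"

section \<open>Types, saturation and homogeneity\<close>

text \<open>Types in the tuple of variables \<open>(x\<^sub>i)\<close>, \<open>i \<in> I\<close>, over a set \<open>A\<close> of parameters from \<open>M\<close>.\<close>

definition partial_type ::
  "('f, 'p) lang \<Rightarrow> ('f, 'p, 'a) struct \<Rightarrow> 'i set \<Rightarrow> 'a set \<Rightarrow> ('f, 'p, 'i + 'a) fm set \<Rightarrow> bool" where
  "partial_type L M I A p \<longleftrightarrow> p \<subseteq> fmls L (I <+> A) \<and>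
     (\<forall>q. finite q \<and> q \<subseteq> p \<longrightarrow>
        (\<exists>c\<in>I \<rightarrow> univ M. \<forall>\<phi>\<in>q. holds M (case_sum c (\<lambda>a. a)) \<phi>))"

definition complete_type ::
  "('f, 'p) lang \<Rightarrow> ('f, 'p, 'a) struct \<Rightarrow> 'i set \<Rightarrow> 'a set \<Rightarrow> ('f, 'p, 'i + 'a) fm set \<Rightarrow> bool" where
  "complete_type L M I A p \<longleftrightarrow> partial_type L M I A p \<and>
     (\<forall>\<phi>\<in>fmls L (I <+> A). \<phi> \<in> p \<or> Neg \<phi> \<in> p)"

definition realized ::
  "('f, 'p, 'a) struct \<Rightarrow> 'i set \<Rightarrow> ('f, 'p, 'i + 'a) fm set \<Rightarrow> bool" where
  "realized M I p \<longleftrightarrow> (\<exists>c\<in>I \<rightarrow> univ M. \<forall>\<phi>\<in>p. holds M (case_sum c (\<lambda>a. a)) \<phi>)"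

text \<open>As usual, the types in the definition of saturation are types in finitely many variables.\<close>

definition saturated :: "'k rel \<Rightarrow> ('f, 'p) lang \<Rightarrow> ('f, 'p, 'a) struct \<Rightarrow> bool" where
  "saturated \<kappa> L M \<longleftrightarrow>
     (\<forall>(n::nat) A p. A \<subseteq> univ M \<and> |A| <o \<kappa> \<and> complete_type L M {..<n} A p
        \<longrightarrow> realized M {..<n} p)"

definition partial_elementary_map ::
  "('f, 'p) lang \<Rightarrow> ('f, 'p, 'a) struct \<Rightarrow> 'a set \<Rightarrow> ('a \<Rightarrow> 'a) \<Rightarrow> bool" where
  "partial_elementary_map L M A f \<longleftrightarrow> A \<subseteq> univ M \<and> f ` A \<subseteq> univ M \<and>
     (\<forall>\<phi>\<in>fmls L A. holds M (\<lambda>a. a) \<phi> \<longleftrightarrow> holds M f \<phi>)"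

definition strongly_homogeneous :: "'k rel \<Rightarrow> ('f, 'p) lang \<Rightarrow> ('f, 'p, 'a) struct \<Rightarrow> bool" where
  "strongly_homogeneous \<kappa> L M \<longleftrightarrow>
     (\<forall>A f. |A| <o \<kappa> \<and> partial_elementary_map L M A f \<longrightarrow> (\<exists>\<sigma>\<in>Aut L M. \<forall>a\<in>A. \<sigma> a = f a))"

section \<open>The type space as a flow\<close>

definition type_space ::
  "('f, 'p) lang \<Rightarrow> 'i set \<Rightarrow> ('f, 'p, 'i + 'a) fm set \<Rightarrow> ('f, 'p, 'a) struct
     \<Rightarrow> ('f, 'p, 'i + 'a) fm set set" where
  "type_space L I \<pi> M = {p. complete_type L M I (univ M) p \<and> \<pi> \<subseteq> p}"

definition stone_topology ::
  "('f, 'p) lang \<Rightarrow> 'i set \<Rightarrow> ('f, 'p, 'i + 'a) fm set \<Rightarrow> ('f, 'p, 'a) struct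
     \<Rightarrow> ('f, 'p, 'i + 'a) fm set topology" where
  "stone_topology L I \<pi> M = topology_generated_by
     ((\<lambda>\<phi>. {p \<in> type_space L I \<pi> M. \<phi> \<in> p}) ` fmls L (I <+> univ M))"

lemma topspace_stone_topology: "topspace (stone_topology L I \<pi> M) = type_space L I \<pi> M"
proof -
  let ?\<phi> = "Ex 0 (Eq (BVar 0) (BVar 0)) :: ('a, 'b, 'c + 'd) fm"
  have "?\<phi> \<in> fmls L (I <+> univ M)" and "Neg ?\<phi> \<in> fmls L (I <+> univ M)"
    by (auto simp: fmls_def)
  then have "\<exists>\<phi>\<in>fmls L (I <+> univ M). \<phi> \<in> p" if "p \<in> type_space L I \<pi> M" for p
    using that unfolding type_space_def complete_type_def by blast
  then show ?thesis
    unfolding stone_topology_def topology_generated_by_topspace by auto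
qed

definition type_act :: "('a \<Rightarrow> 'a) \<Rightarrow> ('f, 'p, 'i + 'a) fm set \<Rightarrow> ('f, 'p, 'i + 'a) fm set" where
  "type_act \<sigma> p = rename (map_sum (\<lambda>i. i) \<sigma>) ` p"

definition type_restrict ::
  "('f, 'p) lang \<Rightarrow> 'i set \<Rightarrow> ('f, 'p, 'a) struct \<Rightarrow> ('f, 'p, 'i + 'a) fm set
     \<Rightarrow> ('f, 'p, 'i + 'a) fm set" where
  "type_restrict L I M p = p \<inter> fmls L (I <+> univ M)"

definition closed_invariant_equiv ::
  "('f, 'p) lang \<Rightarrow> 'i set \<Rightarrow> ('f, 'p, 'i + 'a) fm set \<Rightarrow> ('f, 'p, 'a) struct
     \<Rightarrow> ('f, 'p, 'i + 'a) fm set rel \<Rightarrow> bool" where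
  "closed_invariant_equiv L I \<pi> M F \<longleftrightarrow>
     equiv (type_space L I \<pi> M) F \<and>
     closedin (prod_topology (stone_topology L I \<pi> M) (stone_topology L I \<pi> M)) F \<and>
     (\<forall>\<sigma>\<in>Aut L M. \<forall>(p, q)\<in>F. (type_act \<sigma> p, type_act \<sigma> q) \<in> F)"

definition quotient_topology :: "'y topology \<Rightarrow> 'y rel \<Rightarrow> 'y set topology" where
  "quotient_topology Y R = topology (\<lambda>U. U \<subseteq> topspace Y // R \<and>
     openin Y {y \<in> topspace Y. R `` {y} \<in> U})"

lemma openin_quotient_topology:
  "openin (quotient_topology Y R) U \<longleftrightarrow>
     U \<subseteq> topspace Y // R \<and> openin Y {y \<in> topspace Y. R `` {y} \<in> U}"
proof -
  have "istopology (\<lambda>U. U \<subseteq> topspace Y // R \<and> openin Y {y \<in> topspace Y. R `` {y} \<in> U})"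
    unfolding istopology_def
  proof (intro conjI allI impI)
    fix S T
    assume S: "S \<subseteq> topspace Y // R \<and> openin Y {y \<in> topspace Y. R `` {y} \<in> S}"
      and T: "T \<subseteq> topspace Y // R \<and> openin Y {y \<in> topspace Y. R `` {y} \<in> T}"
    show "S \<inter> T \<subseteq> topspace Y // R" using S by blast
    have "{y \<in> topspace Y. R `` {y} \<in> S \<inter> T} =
        {y \<in> topspace Y. R `` {y} \<in> S} \<inter> {y \<in> topspace Y. R `` {y} \<in> T}"
      by blast
    then show "openin Y {y \<in> topspace Y. R `` {y} \<in> S \<inter> T}"
      using S T by (simp only: openin_Int)
  next
    fix K
    assume K: "\<forall>S\<in>K. S \<subseteq> topspace Y // R \<and> openin Y {y \<in> topspace Y. R `` {y} \<in> S}"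
    show "\<Union>K \<subseteq> topspace Y // R" using K by blast
    have "{y \<in> topspace Y. R `` {y} \<in> \<Union>K} =
        (\<Union>S\<in>K. {y \<in> topspace Y. R `` {y} \<in> S})"
      by blast
    then show "openin Y {y \<in> topspace Y. R `` {y} \<in> \<Union>K}"
      using K by auto
  qed
  then show ?thesis
    by (simp add: quotient_topology_def)
qed

lemma topspace_quotient_topology: "topspace (quotient_topology Y R) = topspace Y // R"
proof
  show "topspace (quotient_topology Y R) \<subseteq> topspace Y // R"
    by (metis openin_quotient_topology openin_topspace)
  have "{y \<in> topspace Y. R `` {y} \<in> topspace Y // R} = topspace Y"
    by (auto intro: quotientI)
  then have "openin (quotient_topology Y R) (topspace Y // R)"
    by (simp add: openin_quotient_topology)
  then show "topspace Y // R \<subseteq> topspace (quotient_topology Y R)"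
    by (rule openin_subset)
qed

text \<open>
  The data of a flow. The topology of the acting group is not recorded: the Ellis group and its
  \<open>\<tau>\<close>-topology only depend on the maps by which the group elements act.
\<close>

record ('g, 'y) flow =
  flow_group :: "'g set"
  flow_space :: "'y topology"
  flow_act :: "'g \<Rightarrow> 'y \<Rightarrow> 'y"

text \<open>An automorphism maps the class of \<open>p\<close> to the class of \<open>\<sigma>(p)\<close>, which is the image of the former.\<close>

definition type_flow ::
  "('f, 'p) lang \<Rightarrow> 'i set \<Rightarrow> ('f, 'p, 'i + 'a) fm set \<Rightarrow> ('f, 'p, 'a) struct
     \<Rightarrow> ('f, 'p, 'i + 'a) fm set rel \<Rightarrow> ('a \<Rightarrow> 'a, ('f, 'p, 'i + 'a) fm set set) flow" where
  "type_flow L I \<pi> M F =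
     \<lparr>flow_group = Aut L M,
      flow_space = quotient_topology (stone_topology L I \<pi> M) F,
      flow_act = (\<lambda>\<sigma> c. type_act \<sigma> ` c)\<rparr>"

section \<open>The Ellis group with the \<open>\<tau>\<close>-topology\<close>

definition flow_carrier :: "('g, 'y) flow \<Rightarrow> 'y set" where
  "flow_carrier \<Phi> = topspace (flow_space \<Phi>)"

definition self_maps :: "('g, 'y) flow \<Rightarrow> ('y \<Rightarrow> 'y) topology" where
  "self_maps \<Phi> = product_topology (\<lambda>_. flow_space \<Phi>) (flow_carrier \<Phi>)"

definition flow_maps :: "('g, 'y) flow \<Rightarrow> ('y \<Rightarrow> 'y) set" where
  "flow_maps \<Phi> = (\<lambda>g. restrict (flow_act \<Phi> g) (flow_carrier \<Phi>)) ` flow_group \<Phi>"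

definition ellis_semigroup :: "('g, 'y) flow \<Rightarrow> ('y \<Rightarrow> 'y) set" where
  "ellis_semigroup \<Phi> = self_maps \<Phi> closure_of flow_maps \<Phi>"

definition ellis_mult :: "('g, 'y) flow \<Rightarrow> ('y \<Rightarrow> 'y) \<Rightarrow> ('y \<Rightarrow> 'y) \<Rightarrow> ('y \<Rightarrow> 'y)" where
  "ellis_mult \<Phi> = compose (flow_carrier \<Phi>)"

definition left_ideal :: "('g, 'y) flow \<Rightarrow> ('y \<Rightarrow> 'y) set \<Rightarrow> bool" where
  "left_ideal \<Phi> \<M> \<longleftrightarrow> \<M> \<noteq> {} \<and> \<M> \<subseteq> ellis_semigroup \<Phi> \<and>
     (\<forall>a\<in>ellis_semigroup \<Phi>. \<forall>m\<in>\<M>. ellis_mult \<Phi> a m \<in> \<M>)"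

definition minimal_left_ideal :: "('g, 'y) flow \<Rightarrow> ('y \<Rightarrow> 'y) set \<Rightarrow> bool" where
  "minimal_left_ideal \<Phi> \<M> \<longleftrightarrow> left_ideal \<Phi> \<M> \<and> (\<forall>\<N>. left_ideal \<Phi> \<N> \<and> \<N> \<subseteq> \<M> \<longrightarrow> \<N> = \<M>)"

definition ellis_group :: "('g, 'y) flow \<Rightarrow> ('y \<Rightarrow> 'y) set \<Rightarrow> ('y \<Rightarrow> 'y) \<Rightarrow> ('y \<Rightarrow> 'y) monoid" where
  "ellis_group \<Phi> \<M> u = \<lparr>carrier = ellis_mult \<Phi> u ` \<M>, mult = ellis_mult \<Phi>, one = u\<rparr>"

text \<open>
  The set \<open>a \<circ> B\<close> of limits of convergent nets \<open>(g\<^sub>i b\<^sub>i)\<close> with \<open>g\<^sub>i \<rightarrow> a\<close>. Convergence of nets is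
  expressed by filters; replacing the index filter of a net by its image under \<open>i \<mapsto> (g\<^sub>i, b\<^sub>i)\<close>, one
  may take the pairs \<open>(g, b)\<close> themselves as indices.
\<close>

definition ellis_circ ::
  "('g, 'y) flow \<Rightarrow> ('y \<Rightarrow> 'y) \<Rightarrow> ('y \<Rightarrow> 'y) set \<Rightarrow> ('y \<Rightarrow> 'y) set" where
  "ellis_circ \<Phi> a B = {c. \<exists>\<F> :: (('y \<Rightarrow> 'y) \<times> ('y \<Rightarrow> 'y)) filter.
     \<F> \<noteq> bot \<and> (\<forall>\<^sub>F (g, b) in \<F>. g \<in> flow_maps \<Phi> \<and> b \<in> B) \<and>
     limitin (self_maps \<Phi>) (\<lambda>(g, b). g) a \<F> \<and>
     limitin (self_maps \<Phi>) (\<lambda>(g, b). ellis_mult \<Phi> g b) c \<F>}"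

definition tau_closure ::
  "('g, 'y) flow \<Rightarrow> ('y \<Rightarrow> 'y) set \<Rightarrow> ('y \<Rightarrow> 'y) \<Rightarrow> ('y \<Rightarrow> 'y) set \<Rightarrow> ('y \<Rightarrow> 'y) set" where
  "tau_closure \<Phi> \<M> u B = carrier (ellis_group \<Phi> \<M> u) \<inter> ellis_circ \<Phi> u B"

definition tau_topology ::
  "('g, 'y) flow \<Rightarrow> ('y \<Rightarrow> 'y) set \<Rightarrow> ('y \<Rightarrow> 'y) \<Rightarrow> ('y \<Rightarrow> 'y) topology" where
  "tau_topology \<Phi> \<M> u = topology (\<lambda>U. U \<subseteq> carrier (ellis_group \<Phi> \<M> u) \<and>
     tau_closure \<Phi> \<M> u (carrier (ellis_group \<Phi> \<M> u) - U) = carrier (ellis_group \<Phi> \<M> u) - U)"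

lemma ellis_circ_mono: "A \<subseteq> B \<Longrightarrow> ellis_circ \<Phi> a A \<subseteq> ellis_circ \<Phi> a B"
  unfolding ellis_circ_def
  by (rule Collect_mono, intro impI, elim exE conjE, rule exI, intro conjI, assumption,
      erule eventually_mono, auto)

lemma ellis_circ_empty: "ellis_circ \<Phi> a {} = {}"
  by (auto simp: ellis_circ_def case_prod_unfold trivial_limit_def)

lemma ellis_circ_Un: "ellis_circ \<Phi> a (A \<union> B) = ellis_circ \<Phi> a A \<union> ellis_circ \<Phi> a B"
proof
  show "ellis_circ \<Phi> a A \<union> ellis_circ \<Phi> a B \<subseteq> ellis_circ \<Phi> a (A \<union> B)"
    by (simp add: ellis_circ_mono)
  show "ellis_circ \<Phi> a (A \<union> B) \<subseteq> ellis_circ \<Phi> a A \<union> ellis_circ \<Phi> a B"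
  proof
    fix c assume "c \<in> ellis_circ \<Phi> a (A \<union> B)"
    then obtain \<F> where ne: "\<F> \<noteq> bot"
      and ev: "\<forall>\<^sub>F (g, b) in \<F>. g \<in> flow_maps \<Phi> \<and> b \<in> A \<union> B"
      and la: "limitin (self_maps \<Phi>) (\<lambda>(g, b). g) a \<F>"
      and lc: "limitin (self_maps \<Phi>) (\<lambda>(g, b). ellis_mult \<Phi> g b) c \<F>"
      unfolding ellis_circ_def by blast
    have sub: "c \<in> ellis_circ \<Phi> a D"
      if "inf \<F> (principal {x. snd x \<in> D}) \<noteq> bot" for D
      unfolding ellis_circ_def mem_Collect_eq
    proof (intro exI conjI)
      let ?G = "inf \<F> (principal {x. snd x \<in> D})"
      show "?G \<noteq> bot" by fact
      show "\<forall>\<^sub>F (g, b) in ?G. g \<in> flow_maps \<Phi> \<and> b \<in> D"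
        unfolding eventually_inf_principal using ev by (auto elim: eventually_mono)
      show "limitin (self_maps \<Phi>) (\<lambda>(g, b). g) a ?G"
        using la by (auto simp: limitin_def intro: filter_leD[OF inf_le1])
      show "limitin (self_maps \<Phi>) (\<lambda>(g, b). ellis_mult \<Phi> g b) c ?G"
        using lc by (auto simp: limitin_def intro: filter_leD[OF inf_le1])
    qed
    show "c \<in> ellis_circ \<Phi> a A \<union> ellis_circ \<Phi> a B"
    proof (rule ccontr)
      assume "c \<notin> ellis_circ \<Phi> a A \<union> ellis_circ \<Phi> a B"
      then have "inf \<F> (principal {x. snd x \<in> A}) = bot" "inf \<F> (principal {x. snd x \<in> B}) = bot"
        using sub by blast+
      then have "\<forall>\<^sub>F x in \<F>. snd x \<notin> A" "\<forall>\<^sub>F x in \<F>. snd x \<notin> B"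
        by (simp_all add: trivial_limit_def eventually_inf_principal)
      with ev have "\<forall>\<^sub>F x in \<F>. False"
        by eventually_elim auto
      with ne show False
        by (simp add: trivial_limit_def)
    qed
  qed
qed

lemma ellis_circ_mult:
  assumes a: "a \<in> ellis_semigroup \<Phi>" and b: "b \<in> ellis_semigroup \<Phi>" "b \<in> B"
  shows "ellis_mult \<Phi> a b \<in> ellis_circ \<Phi> a B"
proof -
  let ?X = "self_maps \<Phi>" and ?Y = "flow_carrier \<Phi>"
  define \<N> where "\<N> = inf (nhdsin ?X a) (principal (flow_maps \<Phi>))"
  define \<F> where "\<F> = filtermap (\<lambda>g. (g, b)) \<N>"
  have top: "topspace ?X = ?Y \<rightarrow>\<^sub>E ?Y"
    by (simp add: self_maps_def flow_carrier_def)
  have aX: "a \<in> topspace ?X" and bX: "b \<in> topspace ?X"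
    using a b by (auto simp: ellis_semigroup_def in_closure_of)
  have N: "\<N> \<noteq> bot"
  proof
    assume "\<N> = bot"
    then have "\<forall>\<^sub>F g in nhdsin ?X a. g \<notin> flow_maps \<Phi>"
      by (simp add: \<N>_def trivial_limit_def eventually_inf_principal)
    then obtain S where "openin ?X S" "a \<in> S" "\<forall>g\<in>S. g \<notin> flow_maps \<Phi>"
      using aX by (auto simp: eventually_nhdsin)
    then show False
      using a by (auto simp: ellis_semigroup_def in_closure_of)
  qed
  have lim: "limitin ?X (\<lambda>g. g) a \<N>"
    unfolding limitin_def \<N>_def
    using aX by (auto simp: eventually_inf_principal eventually_nhdsin)
  have evX: "\<forall>\<^sub>F g in \<N>. g \<in> topspace ?X"
    using lim aX by (simp add: limitin_def)
  have lim': "limitin ?X (\<lambda>g. ellis_mult \<Phi> g b) (ellis_mult \<Phi> a b) \<N>"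
    unfolding self_maps_def limitin_componentwise
  proof (intro conjI ballI)
    show "ellis_mult \<Phi> a b \<in> extensional ?Y"
      by (simp add: ellis_mult_def)
    show "\<forall>\<^sub>F g in \<N>. ellis_mult \<Phi> g b \<in> topspace (product_topology (\<lambda>_. flow_space \<Phi>) ?Y)"
      using evX
    proof eventually_elim
      case (elim g)
      then have "ellis_mult \<Phi> g b \<in> ?Y \<rightarrow>\<^sub>E ?Y"
        using bX unfolding top ellis_mult_def by (auto simp: compose_def)
      then show ?case
        by (simp add: flow_carrier_def)
    qed
  next
    fix y assume y: "y \<in> ?Y"
    then have "b y \<in> ?Y"
      using bX top by auto
    then have "limitin (flow_space \<Phi>) (\<lambda>g. g (b y)) (a (b y)) \<N>"
      using lim unfolding self_maps_def limitin_componentwise by blast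
    then show "limitin (flow_space \<Phi>) (\<lambda>g. ellis_mult \<Phi> g b y) (ellis_mult \<Phi> a b y) \<N>"
      using y by (simp add: ellis_mult_def compose_def)
  qed
  show ?thesis
    unfolding ellis_circ_def mem_Collect_eq
  proof (intro exI conjI)
    show "\<F> \<noteq> bot"
      using N by (simp add: \<F>_def filtermap_bot_iff)
    show "\<forall>\<^sub>F (g, b) in \<F>. g \<in> flow_maps \<Phi> \<and> b \<in> B"
      using b by (simp add: \<F>_def \<N>_def eventually_filtermap eventually_inf_principal)
    show "limitin ?X (\<lambda>(g, b). g) a \<F>"
      using lim by (simp add: \<F>_def limitin_def eventually_filtermap)
    show "limitin ?X (\<lambda>(g, b). ellis_mult \<Phi> g b) (ellis_mult \<Phi> a b) \<F>"
      using lim' by (simp add: \<F>_def limitin_def eventually_filtermap)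
  qed
qed

lemma tau_closure_extensive:
  assumes M: "left_ideal \<Phi> \<M>" and u: "u \<in> \<M>" "ellis_mult \<Phi> u u = u"
    and B: "B \<subseteq> carrier (ellis_group \<Phi> \<M> u)"
  shows "B \<subseteq> tau_closure \<Phi> \<M> u B"
proof
  fix b assume b: "b \<in> B"
  with B obtain m where m: "m \<in> \<M>" "b = ellis_mult \<Phi> u m"
    by (auto simp: ellis_group_def)
  have E: "u \<in> ellis_semigroup \<Phi>" "m \<in> ellis_semigroup \<Phi>" "b \<in> ellis_semigroup \<Phi>"
    using M u m unfolding left_ideal_def by blast+
  then have "m \<in> flow_carrier \<Phi> \<rightarrow> flow_carrier \<Phi>"
    using closure_of_subset_topspace[of "self_maps \<Phi>" "flow_maps \<Phi>"]
    by (auto simp: ellis_semigroup_def self_maps_def flow_carrier_def)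
  then have "ellis_mult \<Phi> u b = ellis_mult \<Phi> (ellis_mult \<Phi> u u) m"
    unfolding m ellis_mult_def by (rule compose_assoc)
  then have "ellis_mult \<Phi> u b = b"
    using u m by simp
  then show "b \<in> tau_closure \<Phi> \<M> u B"
    using ellis_circ_mult[OF E(1,3) b] B b by (auto simp: tau_closure_def)
qed

lemma openin_tau_topology:
  assumes "left_ideal \<Phi> \<M>" "u \<in> \<M>" "ellis_mult \<Phi> u u = u"
  shows "openin (tau_topology \<Phi> \<M> u) U \<longleftrightarrow> U \<subseteq> carrier (ellis_group \<Phi> \<M> u) \<and>
     tau_closure \<Phi> \<M> u (carrier (ellis_group \<Phi> \<M> u) - U) = carrier (ellis_group \<Phi> \<M> u) - U"
proof -
  let ?G = "carrier (ellis_group \<Phi> \<M> u)" and ?cl = "tau_closure \<Phi> \<M> u"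
  have ext: "B \<subseteq> ?cl B" if "B \<subseteq> ?G" for B
    using tau_closure_extensive[OF assms that] .
  have mono: "?cl A \<subseteq> ?cl B" if "A \<subseteq> B" for A B
    using ellis_circ_mono[OF that, of \<Phi> u] by (auto simp: tau_closure_def)
  have "istopology (\<lambda>U. U \<subseteq> ?G \<and> ?cl (?G - U) = ?G - U)"
    unfolding istopology_def
  proof (intro conjI allI impI)
    fix S T assume S: "S \<subseteq> ?G \<and> ?cl (?G - S) = ?G - S" and T: "T \<subseteq> ?G \<and> ?cl (?G - T) = ?G - T"
    show "S \<inter> T \<subseteq> ?G" using S by blast
    have "?cl (?G - S \<inter> T) = ?cl (?G - S) \<union> ?cl (?G - T)"
      unfolding tau_closure_def Diff_Int ellis_circ_Un by blast
    then show "?cl (?G - S \<inter> T) = ?G - S \<inter> T"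
      using S T by (simp add: Diff_Int)
  next
    fix K assume K: "\<forall>S\<in>K. S \<subseteq> ?G \<and> ?cl (?G - S) = ?G - S"
    show "\<Union>K \<subseteq> ?G" using K by blast
    have "?cl (?G - \<Union>K) \<subseteq> ?G - S" if "S \<in> K" for S
      using mono[of "?G - \<Union>K" "?G - S"] K that by blast
    moreover have "?cl (?G - \<Union>K) \<subseteq> ?G"
      by (simp add: tau_closure_def)
    ultimately have "?cl (?G - \<Union>K) \<subseteq> ?G - \<Union>K"
      by blast
    then show "?cl (?G - \<Union>K) = ?G - \<Union>K"
      using ext[of "?G - \<Union>K"] by blast
  qed
  then show ?thesis
    by (simp add: tau_topology_def)
qed

lemma topspace_tau_topology:
  assumes "left_ideal \<Phi> \<M>" "u \<in> \<M>" "ellis_mult \<Phi> u u = u"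
  shows "topspace (tau_topology \<Phi> \<M> u) = carrier (ellis_group \<Phi> \<M> u)"
proof
  show "topspace (tau_topology \<Phi> \<M> u) \<subseteq> carrier (ellis_group \<Phi> \<M> u)"
    by (metis assms openin_tau_topology openin_topspace)
  have "openin (tau_topology \<Phi> \<M> u) (carrier (ellis_group \<Phi> \<M> u))"
    using assms by (simp add: openin_tau_topology) (simp add: tau_closure_def ellis_circ_empty)
  then show "carrier (ellis_group \<Phi> \<M> u) \<subseteq> topspace (tau_topology \<Phi> \<M> u)"
    by (rule openin_subset)
qed

end

theory Submission
  imports Defs
begin

text \<open>
  Everything happens in the lattices of closed invariant subsets of the powers of the flows.
  Saturation and homogeneity yield automorphisms of \<open>C'\<close> that move any finite set into \<open>C\<close> while
  fixing the part that already lies in \<open>C\<close>, and make automorphisms of \<open>C\<close> and of \<open>C'\<close>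
  interchangeable on finite subsets of \<open>C\<close>. Hence restriction induces, for every index set \<open>A\<close>, an
  order isomorphism from the closed invariant subsets of \<open>S\<^sub>X(C')\<^sup>A\<close> onto those of \<open>S\<^sub>X(C)\<^sup>A\<close>, and
  compatibility of \<open>F'\<close> and \<open>F\<close> lets it descend to the quotients.

  The Ellis group with its \<open>\<tau>\<close>-topology can be read off from these lattices. A minimal left ideal
  \<open>M\<close> is a minimal closed invariant set of tuples; the minimal closed invariant subsets of \<open>M \<times> M\<close>
  are the graphs of the right multiplications by the elements of \<open>u M\<close>, the product of the group is
  the composition of these graphs, and \<open>c\<close> lies in the \<open>\<tau>\<close>-closure of \<open>B\<close> iff every closed invariant
  set that contains the graphs of all \<open>b \<in> B\<close> contains the graph of \<open>c\<close>.
\<close>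

section \<open>Tuples and pairs of tuples\<close>

lemma compose_mem_PiE: "x \<in> A \<rightarrow>\<^sub>E B \<Longrightarrow> g \<in> B \<rightarrow> C \<Longrightarrow> compose A g x \<in> A \<rightarrow>\<^sub>E C"
  by (auto simp: compose_def)

lemma compose_mem_PiE_right: "w \<in> B \<rightarrow>\<^sub>E C \<Longrightarrow> s \<in> A \<rightarrow> B \<Longrightarrow> compose A w s \<in> A \<rightarrow>\<^sub>E C"
  by (auto simp: compose_def)

lemma compose_image_PiE:
  assumes "g ` B = C"
  shows "compose A g ` (A \<rightarrow>\<^sub>E B) = A \<rightarrow>\<^sub>E C"
proof
  show "compose A g ` (A \<rightarrow>\<^sub>E B) \<subseteq> A \<rightarrow>\<^sub>E C"
    using assms by (auto simp: compose_def)
  show "A \<rightarrow>\<^sub>E C \<subseteq> compose A g ` (A \<rightarrow>\<^sub>E B)"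
  proof
    fix y assume y: "y \<in> A \<rightarrow>\<^sub>E C"
    define x where "x = (\<lambda>i\<in>A. inv_into B g (y i))"
    have x: "x i \<in> B" "g (x i) = y i" if "i \<in> A" for i
      using inv_into_into[of "y i" g B] f_inv_into_f[of "y i" g B] assms PiE_mem[OF y that] that
      by (simp_all add: x_def)
    then have "compose A g x = y"
      using y by (intro extensionalityI[of _ A]) (simp_all add: compose_eq PiE_def)
    moreover have "x \<in> A \<rightarrow>\<^sub>E B"
      using x(1) by (simp add: x_def)
    ultimately show "y \<in> compose A g ` (A \<rightarrow>\<^sub>E B)"
      by blast
  qed
qed

definition pairing :: "'j set \<Rightarrow> ('j \<Rightarrow> 'y) \<Rightarrow> ('j \<Rightarrow> 'y) \<Rightarrow> 'j + 'j \<Rightarrow> 'y" where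
  "pairing A x y = restrict (case_sum x y) (A <+> A)"

definition pairings :: "'j set \<Rightarrow> ('j \<Rightarrow> 'y) set \<Rightarrow> ('j \<Rightarrow> 'y) set \<Rightarrow> ('j + 'j \<Rightarrow> 'y) set" where
  "pairings A X Z = (\<Union>x\<in>X. pairing A x ` Z)"

lemma pairing_mem_pairings: "x \<in> X \<Longrightarrow> z \<in> Z \<Longrightarrow> pairing A x z \<in> pairings A X Z"
  by (auto simp: pairings_def)

lemma pairing_apply [simp]:
  "i \<in> A \<Longrightarrow> pairing A x y (Inl i) = x i" "i \<in> A \<Longrightarrow> pairing A x y (Inr i) = y i"
  by (auto simp: pairing_def)

lemma compose_pairing: "compose (A <+> A) g (pairing A x y) = pairing A (compose A g x) (compose A g y)"
  by (auto simp: pairing_def compose_def fun_eq_iff split: sum.splits)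

lemma pairing_mem_PiE: "x \<in> A \<rightarrow>\<^sub>E B \<Longrightarrow> y \<in> A \<rightarrow>\<^sub>E B \<Longrightarrow> pairing A x y \<in> A <+> A \<rightarrow>\<^sub>E B"
  by (auto simp: pairing_def)

lemma compose_pairing_Inl [simp]: "x \<in> extensional A \<Longrightarrow> compose A (pairing A x y) Inl = x"
  and compose_pairing_Inr [simp]: "y \<in> extensional A \<Longrightarrow> compose A (pairing A x y) Inr = y"
  by (auto simp: compose_def fun_eq_iff extensional_def)

lemma pairing_eq_iff:
  assumes "x \<in> extensional A" "y \<in> extensional A" "x' \<in> extensional A" "y' \<in> extensional A"
  shows "pairing A x y = pairing A x' y' \<longleftrightarrow> x = x' \<and> y = y'"
  using assms by (metis compose_pairing_Inl compose_pairing_Inr)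

lemma pairing_compose_Inl_Inr:
  "w \<in> extensional (A <+> A) \<Longrightarrow> pairing A (compose A w Inl) (compose A w Inr) = w"
  by (auto simp: pairing_def compose_def fun_eq_iff extensional_def split: sum.splits)

lemma pairings_eq:
  assumes "X \<subseteq> A \<rightarrow>\<^sub>E B" "Z \<subseteq> A \<rightarrow>\<^sub>E B"
  shows "pairings A X Z = {w \<in> A <+> A \<rightarrow>\<^sub>E B. compose A w Inl \<in> X \<and> compose A w Inr \<in> Z}"
proof (intro subset_antisym subsetI)
  fix w assume "w \<in> pairings A X Z"
  then obtain x z where "x \<in> X" "z \<in> Z" "w = pairing A x z"
    by (auto simp: pairings_def)
  moreover from this have xz: "x \<in> A \<rightarrow>\<^sub>E B" "z \<in> A \<rightarrow>\<^sub>E B"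
    using assms by blast+
  moreover have "x \<in> extensional A" "z \<in> extensional A"
    using xz by (simp_all add: PiE_def)
  ultimately show "w \<in> {w \<in> A <+> A \<rightarrow>\<^sub>E B. compose A w Inl \<in> X \<and> compose A w Inr \<in> Z}"
    using pairing_mem_PiE[OF xz] by simp
next
  fix w assume w: "w \<in> {w \<in> A <+> A \<rightarrow>\<^sub>E B. compose A w Inl \<in> X \<and> compose A w Inr \<in> Z}"
  then have "pairing A (compose A w Inl) (compose A w Inr) = w"
    by (intro pairing_compose_Inl_Inr) (simp add: PiE_def)
  then show "w \<in> pairings A X Z"
    using w by (force simp: pairings_def)
qed

lemma image_pairings:
  "compose (A <+> A) g ` pairings A X Z = pairings A (compose A g ` X) (compose A g ` Z)"
  by (simp add: pairings_def image_UN image_image compose_pairing)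

lemma continuous_map_compose_left:
  assumes "continuous_map X Y g"
  shows "continuous_map (product_topology (\<lambda>_. X) A) (product_topology (\<lambda>_. Y) A) (compose A g)"
  unfolding continuous_map_componentwise
proof (intro conjI ballI)
  show "compose A g ` topspace (product_topology (\<lambda>_. X) A) \<subseteq> extensional A"
    by auto
  fix i assume i: "i \<in> A"
  then have "continuous_map (product_topology (\<lambda>_. X) A) Y (g \<circ> (\<lambda>x. x i))"
    by (intro continuous_map_compose[OF _ assms] continuous_map_product_projection)
  then show "continuous_map (product_topology (\<lambda>_. X) A) Y (\<lambda>x. compose A g x i)"
    using i by (simp add: compose_eq o_def)
qed

lemma continuous_map_compose_right:
  assumes "s \<in> A \<rightarrow> B"
  shows "continuous_map (product_topology (\<lambda>_. X) B) (product_topology (\<lambda>_. X) A) (\<lambda>w. compose A w s)"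
  unfolding continuous_map_componentwise
  using assms by (auto simp: compose_eq intro: continuous_map_product_projection)

lemma limitin_pairing:
  assumes ev: "\<forall>\<^sub>F d in \<F>. f d \<in> A \<rightarrow>\<^sub>E topspace X \<and> g d \<in> A \<rightarrow>\<^sub>E topspace X"
    and ext: "x \<in> extensional A" "y \<in> extensional A"
  shows "limitin (product_topology (\<lambda>_. X) (A <+> A)) (\<lambda>d. pairing A (f d) (g d)) (pairing A x y) \<F> \<longleftrightarrow>
    limitin (product_topology (\<lambda>_. X) A) f x \<F> \<and> limitin (product_topology (\<lambda>_. X) A) g y \<F>"
proof -
  have "\<forall>\<^sub>F d in \<F>. pairing A (f d) (g d) \<in> A <+> A \<rightarrow>\<^sub>E topspace X"
    using ev by (rule eventually_mono) (simp add: pairing_mem_PiE)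
  moreover have "\<forall>\<^sub>F d in \<F>. f d \<in> A \<rightarrow>\<^sub>E topspace X" "\<forall>\<^sub>F d in \<F>. g d \<in> A \<rightarrow>\<^sub>E topspace X"
    using ev by (auto elim: eventually_mono)
  moreover have "pairing A x y \<in> extensional (A <+> A)"
    by (simp add: pairing_def)
  ultimately show ?thesis
    using ext by (simp add: limitin_componentwise ball_Un Plus_def)
qed

section \<open>Closures, cluster points and quotients\<close>

lemma in_closure_of_image_iff:
  assumes "f ` D \<subseteq> topspace X"
  shows "x \<in> X closure_of (f ` D) \<longleftrightarrow>
    (\<exists>\<F>. \<F> \<noteq> bot \<and> (\<forall>\<^sub>F d in \<F>. d \<in> D) \<and> limitin X f x \<F>)"
proof
  assume x: "x \<in> X closure_of (f ` D)"
  define \<F> where "\<F> = inf (filtercomap f (nhdsin X x)) (principal D)"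
  have xX: "x \<in> topspace X"
    using x by (simp add: in_closure_of)
  have "\<F> \<noteq> bot"
  proof
    assume "\<F> = bot"
    then obtain Q where "eventually Q (nhdsin X x)" "\<forall>d. Q (f d) \<longrightarrow> d \<notin> D"
      by (auto simp: \<F>_def trivial_limit_def eventually_inf_principal eventually_filtercomap)
    then obtain U where "openin X U" "x \<in> U" "\<forall>d\<in>D. f d \<notin> U"
      using xX by (auto simp: eventually_nhdsin)
    then show False
      using x by (fastforce simp: in_closure_of)
  qed
  moreover have "\<forall>\<^sub>F d in \<F>. d \<in> D"
    by (simp add: \<F>_def eventually_inf_principal)
  moreover have "\<forall>\<^sub>F d in \<F>. f d \<in> U" if "openin X U" "x \<in> U" for U
    unfolding \<F>_def eventually_inf_principal eventually_filtercomap
    using that xX by (intro exI[of _ "\<lambda>y. y \<in> U"]) (auto simp: eventually_nhdsin)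
  then have "limitin X f x \<F>"
    using xX by (simp add: limitin_def)
  ultimately show "\<exists>\<F>. \<F> \<noteq> bot \<and> (\<forall>\<^sub>F d in \<F>. d \<in> D) \<and> limitin X f x \<F>"
    by blast
next
  assume "\<exists>\<F>. \<F> \<noteq> bot \<and> (\<forall>\<^sub>F d in \<F>. d \<in> D) \<and> limitin X f x \<F>"
  then obtain \<F> where \<F>: "\<F> \<noteq> bot" "\<forall>\<^sub>F d in \<F>. d \<in> D" "limitin X f x \<F>"
    by blast
  have "\<forall>\<^sub>F d in \<F>. f d \<in> X closure_of (f ` D)"
    using \<F>(2) closure_of_subset[OF assms] by (auto elim!: eventually_mono)
  then show "x \<in> X closure_of (f ` D)"
    using limitin_closedin[OF \<F>(3) closedin_closure_of] \<F>(1) by blast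
qed

lemma compact_space_cluster_point:
  assumes compact: "compact_space X" and nonempty: "J \<noteq> {}"
    and subset: "\<And>j. j \<in> J \<Longrightarrow> K j \<subseteq> topspace X \<and> K j \<noteq> {}"
    and directed: "\<And>i j. i \<in> J \<Longrightarrow> j \<in> J \<Longrightarrow> \<exists>k\<in>J. K k \<subseteq> K i \<inter> K j"
  shows "\<exists>x\<in>topspace X. \<forall>j\<in>J. x \<in> X closure_of K j"
proof -
  have lower: "\<exists>k\<in>J. \<forall>j\<in>F. K k \<subseteq> K j" if "finite F" "F \<subseteq> J" for F
    using that
  proof (induction F rule: finite_induct)
    case empty
    then show ?case using nonempty by auto
  next
    case (insert i F)
    then obtain k where "k \<in> J" "\<forall>j\<in>F. K k \<subseteq> K j" by auto
    moreover from this obtain l where "l \<in> J" "K l \<subseteq> K i \<inter> K k"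
      using directed[of i k] insert.prems by auto
    ultimately show ?case by (intro bexI[of _ l]) auto
  qed
  have "topspace X \<inter> \<Inter>\<F> \<noteq> {}" if \<F>: "finite \<F>" "\<F> \<subseteq> (\<lambda>j. X closure_of K j) ` J" for \<F>
  proof -
    obtain F where F: "finite F" "F \<subseteq> J" "\<F> = (\<lambda>j. X closure_of K j) ` F"
      using finite_subset_image[OF \<F>] by blast
    obtain k where k: "k \<in> J" "\<forall>j\<in>F. K k \<subseteq> K j"
      using lower[OF F(1,2)] by blast
    then have "K k \<subseteq> X closure_of K j" if "j \<in> F" for j
      using that F(2) subset closure_of_subset[of "K j" X] by blast
    then show ?thesis
      using subset[OF k(1)] unfolding F(3) by blast
  qed
  then have "topspace X \<inter> (\<Inter>j\<in>J. X closure_of K j) \<noteq> {}"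
    using compact unfolding compact_space_def compactin_fip by fastforce
  then show ?thesis
    by blast
qed

lemma continuous_map_quotient_topology:
  "continuous_map Y (quotient_topology Y R) (\<lambda>y. R `` {y})"
  by (auto simp: continuous_map_def openin_quotient_topology topspace_quotient_topology intro: quotientI)

lemma quotient_map_quotient_topology:
  "quotient_map Y (quotient_topology Y R) (\<lambda>y. R `` {y})"
  unfolding quotient_map_def
  by (auto simp: openin_quotient_topology topspace_quotient_topology quotient_def)

lemma closed_map_quotient_topology:
  assumes Y: "compact_space Y" "Hausdorff_space Y"
    and R: "equiv (topspace Y) R" and closed: "closedin (prod_topology Y Y) R"
  shows "closed_map Y (quotient_topology Y R) (\<lambda>y. R `` {y})"
  unfolding closed_map_def
proof (intro allI impI)
  fix S assume S: "closedin Y S"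
  have "compactin (prod_topology Y Y) (R \<inter> (S \<times> topspace Y))"
    using Y closed S
    by (intro closedin_compact_space closedin_Int)
      (auto simp: compact_space_prod_topology closedin_prod_Times_iff)
  then have "closedin Y (snd ` (R \<inter> (S \<times> topspace Y)))"
    by (intro compactin_imp_closedin[OF Y(2)] image_compactin[OF _ continuous_map_snd])
  also have "snd ` (R \<inter> (S \<times> topspace Y)) = {y \<in> topspace Y. R `` {y} \<in> (\<lambda>y. R `` {y}) ` S}"
  proof (rule Set.set_eqI)
    fix y
    have "y \<in> snd ` (R \<inter> (S \<times> topspace Y)) \<longleftrightarrow> y \<in> topspace Y \<and> (\<exists>s\<in>S. (s, y) \<in> R)"
      by force
    also have "\<dots> \<longleftrightarrow> y \<in> topspace Y \<and> (\<exists>s\<in>S. R `` {y} = R `` {s})"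
      using eq_equiv_class_iff[OF R] closedin_subset[OF S] by (intro conj_cong bex_cong) auto
    finally show "y \<in> snd ` (R \<inter> (S \<times> topspace Y)) \<longleftrightarrow> y \<in> {y \<in> topspace Y. R `` {y} \<in> (\<lambda>y. R `` {y}) ` S}"
      by (simp add: image_iff)
  qed
  finally have "openin Y (topspace Y - {y \<in> topspace Y. R `` {y} \<in> (\<lambda>y. R `` {y}) ` S})"
    by blast
  also have "\<dots> = {y \<in> topspace Y. R `` {y} \<in> topspace Y // R - (\<lambda>y. R `` {y}) ` S}"
    by (auto intro: quotientI)
  finally show "closedin (quotient_topology Y R) ((\<lambda>y. R `` {y}) ` S)"
    using closedin_subset[OF S]
    by (auto simp: closedin_def openin_quotient_topology topspace_quotient_topology intro: quotientI)
qed

lemma Hausdorff_space_quotient_topology: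
  assumes Y: "compact_space Y" "Hausdorff_space Y"
    and R: "equiv (topspace Y) R" "closedin (prod_topology Y Y) R"
  shows "Hausdorff_space (quotient_topology Y R)"
proof -
  have "normal_space Y"
    using Y by (simp add: compact_Hausdorff_or_regular_imp_normal_space)
  moreover have "(\<lambda>y. R `` {y}) ` topspace Y = topspace (quotient_topology Y R)"
    by (rule quotient_imp_surjective_map[OF quotient_map_quotient_topology])
  ultimately show ?thesis
    using normal_Hausdorff_space_closed_continuous_map_image[OF _ Y(2)
        closed_map_quotient_topology[OF Y R] continuous_map_quotient_topology]
    by blast
qed

section \<open>Closed invariant sets of tuples\<close>

abbreviation flow_power :: "('g, 'y) flow \<Rightarrow> 'j set \<Rightarrow> ('j \<Rightarrow> 'y) topology" where
  "flow_power \<Phi> A \<equiv> product_topology (\<lambda>_. flow_space \<Phi>) A"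

definition closed_invariant :: "('g, 'y) flow \<Rightarrow> 'j set \<Rightarrow> ('j \<Rightarrow> 'y) set \<Rightarrow> bool" where
  "closed_invariant \<Phi> A Z \<longleftrightarrow> closedin (flow_power \<Phi> A) Z \<and>
     (\<forall>g\<in>flow_group \<Phi>. \<forall>x\<in>Z. compose A (flow_act \<Phi> g) x \<in> Z)"

lemma topspace_flow_space [simp]: "topspace (flow_space \<Phi>) = flow_carrier \<Phi>"
  by (simp add: flow_carrier_def)

lemma closed_invariant_closedin: "closed_invariant \<Phi> A Z \<Longrightarrow> closedin (flow_power \<Phi> A) Z"
  by (simp add: closed_invariant_def)

lemma closed_invariant_act:
  "closed_invariant \<Phi> A Z \<Longrightarrow> g \<in> flow_group \<Phi> \<Longrightarrow> x \<in> Z \<Longrightarrow> compose A (flow_act \<Phi> g) x \<in> Z"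
  by (simp add: closed_invariant_def)

lemma closed_invariant_subset: "closed_invariant \<Phi> A Z \<Longrightarrow> Z \<subseteq> A \<rightarrow>\<^sub>E flow_carrier \<Phi>"
  using closedin_subset[of "flow_power \<Phi> A" Z] by (simp add: closed_invariant_def)

lemma closed_invariant_Int:
  "closed_invariant \<Phi> A Z \<Longrightarrow> closed_invariant \<Phi> A W \<Longrightarrow> closed_invariant \<Phi> A (Z \<inter> W)"
  by (simp add: closed_invariant_def closedin_Int)

text \<open>
  The record of a flow carries no group operation; the assumptions say that the maps by which the
  elements of the group act are closed under composition and inverses.
\<close>

locale compact_flow =
  fixes \<Phi> :: "('g, 'y) flow"
  assumes compact: "compact_space (flow_space \<Phi>)"
    and Hausdorff: "Hausdorff_space (flow_space \<Phi>)"
    and continuous_act: "g \<in> flow_group \<Phi> \<Longrightarrow> continuous_map (flow_space \<Phi>) (flow_space \<Phi>) (flow_act \<Phi> g)"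
    and act_one: "\<exists>e\<in>flow_group \<Phi>. \<forall>y\<in>flow_carrier \<Phi>. flow_act \<Phi> e y = y"
    and act_mult: "g \<in> flow_group \<Phi> \<Longrightarrow> h \<in> flow_group \<Phi> \<Longrightarrow>
      \<exists>k\<in>flow_group \<Phi>. \<forall>y\<in>flow_carrier \<Phi>. flow_act \<Phi> k y = flow_act \<Phi> g (flow_act \<Phi> h y)"
    and act_inverse: "g \<in> flow_group \<Phi> \<Longrightarrow>
      \<exists>k\<in>flow_group \<Phi>. \<forall>y\<in>flow_carrier \<Phi>.
        flow_act \<Phi> k (flow_act \<Phi> g y) = y \<and> flow_act \<Phi> g (flow_act \<Phi> k y) = y"
begin

abbreviation "Y \<equiv> flow_carrier \<Phi>"

lemma compact_power: "compact_space (flow_power \<Phi> A)"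
  using compact by (simp add: compact_space_product_topology)

lemma Hausdorff_power: "Hausdorff_space (flow_power \<Phi> A)"
  using Hausdorff by (simp add: Hausdorff_space_product_topology)

lemma act_funcset: "g \<in> flow_group \<Phi> \<Longrightarrow> flow_act \<Phi> g \<in> Y \<rightarrow> Y"
  using continuous_map_funspace[OF continuous_act] by simp

lemma compose_act_PiE: "g \<in> flow_group \<Phi> \<Longrightarrow> x \<in> A \<rightarrow>\<^sub>E Y \<Longrightarrow> compose A (flow_act \<Phi> g) x \<in> A \<rightarrow>\<^sub>E Y"
  by (rule compose_mem_PiE[OF _ act_funcset])

lemma closed_invariant_carrier: "closed_invariant \<Phi> A (A \<rightarrow>\<^sub>E Y)"
  unfolding closed_invariant_def
  using closedin_topspace[of "flow_power \<Phi> A"] compose_act_PiE by simp blast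

lemma closed_invariant_closure:
  assumes "Z \<subseteq> A \<rightarrow>\<^sub>E Y"
    and invariant: "\<And>g x. g \<in> flow_group \<Phi> \<Longrightarrow> x \<in> Z \<Longrightarrow> compose A (flow_act \<Phi> g) x \<in> Z"
  shows "closed_invariant \<Phi> A (flow_power \<Phi> A closure_of Z)"
  unfolding closed_invariant_def
proof (intro conjI ballI)
  fix g x assume g: "g \<in> flow_group \<Phi>" and x: "x \<in> flow_power \<Phi> A closure_of Z"
  have "compose A (flow_act \<Phi> g) ` (flow_power \<Phi> A closure_of Z) \<subseteq>
      flow_power \<Phi> A closure_of (compose A (flow_act \<Phi> g) ` Z)"
    by (intro continuous_map_image_closure_subset continuous_map_compose_left continuous_act g)
  also have "\<dots> \<subseteq> flow_power \<Phi> A closure_of Z"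
    using invariant[OF g] by (intro closure_of_mono) auto
  finally show "compose A (flow_act \<Phi> g) x \<in> flow_power \<Phi> A closure_of Z"
    using x by blast
qed simp

lemma closed_invariant_reindex_image:
  assumes K: "closed_invariant \<Phi> B K" and s: "s \<in> A \<rightarrow> B"
  shows "closed_invariant \<Phi> A ((\<lambda>w. compose A w s) ` K)"
  unfolding closed_invariant_def
proof (intro conjI ballI)
  show "closedin (flow_power \<Phi> A) ((\<lambda>w. compose A w s) ` K)"
    using continuous_imp_closed_map[OF continuous_map_compose_right[OF s] compact_power Hausdorff_power]
      closed_invariant_closedin[OF K] unfolding closed_map_def by blast
  fix g x assume "g \<in> flow_group \<Phi>" "x \<in> (\<lambda>w. compose A w s) ` K"
  then obtain w where w: "compose B (flow_act \<Phi> g) w \<in> K" "x = compose A w s"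
    using K by (auto simp: closed_invariant_def)
  moreover have "compose A (flow_act \<Phi> g) (compose A w s) = compose A (compose B (flow_act \<Phi> g) w) s"
    by (rule compose_assoc[OF s])
  ultimately show "compose A (flow_act \<Phi> g) x \<in> (\<lambda>w. compose A w s) ` K"
    by auto
qed

lemma closed_invariant_reindex_vimage:
  assumes Z: "closed_invariant \<Phi> A Z" and s: "s \<in> A \<rightarrow> B"
  shows "closed_invariant \<Phi> B {w \<in> B \<rightarrow>\<^sub>E Y. compose A w s \<in> Z}"
  unfolding closed_invariant_def
proof (intro conjI ballI)
  show "closedin (flow_power \<Phi> B) {w \<in> B \<rightarrow>\<^sub>E Y. compose A w s \<in> Z}"
    using closedin_continuous_map_preimage[OF continuous_map_compose_right[OF s]
        closed_invariant_closedin[OF Z]] by simp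
  fix g w assume g: "g \<in> flow_group \<Phi>" and w: "w \<in> {w \<in> B \<rightarrow>\<^sub>E Y. compose A w s \<in> Z}"
  have "compose A (compose B (flow_act \<Phi> g) w) s = compose A (flow_act \<Phi> g) (compose A w s)"
    by (rule compose_assoc[OF s, symmetric])
  then show "compose B (flow_act \<Phi> g) w \<in> {w \<in> B \<rightarrow>\<^sub>E Y. compose A w s \<in> Z}"
    using w closed_invariant_act[OF Z g] compose_act_PiE[OF g, of w B] by simp
qed

lemma closed_invariant_pairings:
  assumes Z: "closed_invariant \<Phi> A Z" and W: "closed_invariant \<Phi> A W"
  shows "closed_invariant \<Phi> (A <+> A) (pairings A Z W)"
proof -
  have "pairings A Z W = {w \<in> A <+> A \<rightarrow>\<^sub>E Y. compose A w Inl \<in> Z} \<inter> {w \<in> A <+> A \<rightarrow>\<^sub>E Y. compose A w Inr \<in> W}"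
    unfolding pairings_eq[OF closed_invariant_subset[OF Z] closed_invariant_subset[OF W]] by blast
  then show ?thesis
    using Z W by (auto intro!: closed_invariant_Int closed_invariant_reindex_vimage)
qed

end

section \<open>The Ellis semigroup\<close>

context compact_flow
begin

abbreviation "E \<equiv> ellis_semigroup \<Phi>"

lemma compose_flow_map:
  "x \<in> A \<rightarrow> Y \<Longrightarrow> compose A (restrict (flow_act \<Phi> g) Y) x = compose A (flow_act \<Phi> g) x"
  by (auto simp: compose_def fun_eq_iff)

lemma closed_invariant_flow_map:
  assumes "closed_invariant \<Phi> A Z" "h \<in> flow_maps \<Phi>" "x \<in> Z"
  shows "compose A h x \<in> Z"
proof -
  have "x \<in> A \<rightarrow> Y"
    using closed_invariant_subset[OF assms(1)] assms(3) by auto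
  then show ?thesis
    using assms closed_invariant_act by (auto simp: flow_maps_def compose_flow_map)
qed

lemma flow_maps_subset: "flow_maps \<Phi> \<subseteq> Y \<rightarrow>\<^sub>E Y"
  unfolding flow_maps_def by (rule image_subsetI) (simp add: act_funcset)

lemma id_flow_maps: "(\<lambda>y\<in>Y. y) \<in> flow_maps \<Phi>"
proof -
  obtain e where "e \<in> flow_group \<Phi>" "\<forall>y\<in>Y. flow_act \<Phi> e y = y"
    using act_one by blast
  then show ?thesis
    unfolding flow_maps_def by (intro image_eqI[of _ _ e]) auto
qed

lemma compose_act_flow_maps:
  assumes "g \<in> flow_group \<Phi>" "h \<in> flow_maps \<Phi>"
  shows "compose Y (flow_act \<Phi> g) h \<in> flow_maps \<Phi>"
proof -
  obtain h' where h': "h' \<in> flow_group \<Phi>" "h = restrict (flow_act \<Phi> h') Y"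
    using assms(2) by (auto simp: flow_maps_def)
  obtain k where "k \<in> flow_group \<Phi>" "\<forall>y\<in>Y. flow_act \<Phi> k y = flow_act \<Phi> g (flow_act \<Phi> h' y)"
    using act_mult[OF assms(1) h'(1)] by blast
  then show ?thesis
    unfolding flow_maps_def h'(2) by (intro image_eqI[of _ _ k]) (auto simp: compose_def)
qed

lemma ellis_semigroup_eq: "E = flow_power \<Phi> Y closure_of flow_maps \<Phi>"
  by (simp add: ellis_semigroup_def self_maps_def)

lemma closed_invariant_ellis_semigroup: "closed_invariant \<Phi> Y E"
  unfolding ellis_semigroup_eq
  using flow_maps_subset compose_act_flow_maps by (rule closed_invariant_closure)

lemma ellis_semigroup_PiE: "e \<in> E \<Longrightarrow> e \<in> Y \<rightarrow>\<^sub>E Y"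
  using closed_invariant_subset[OF closed_invariant_ellis_semigroup] by blast

lemma flow_maps_ellis_semigroup: "flow_maps \<Phi> \<subseteq> E"
  unfolding ellis_semigroup_eq using flow_maps_subset by (intro closure_of_subset) simp

lemma id_ellis_semigroup: "(\<lambda>y\<in>Y. y) \<in> E"
  using id_flow_maps flow_maps_ellis_semigroup by blast

lemma closed_invariant_ellis_act:
  assumes Z: "closed_invariant \<Phi> A Z" and "e \<in> E" "x \<in> Z"
  shows "compose A e x \<in> Z"
proof -
  have "x \<in> A \<rightarrow> Y"
    using closed_invariant_subset[OF Z] \<open>x \<in> Z\<close> by auto
  then have "(\<lambda>e. compose A e x) ` E \<subseteq> flow_power \<Phi> A closure_of ((\<lambda>e. compose A e x) ` flow_maps \<Phi>)"
    unfolding ellis_semigroup_eq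
    by (intro continuous_map_image_closure_subset continuous_map_compose_right)
  also have "\<dots> \<subseteq> Z"
    using closed_invariant_flow_map[OF Z _ \<open>x \<in> Z\<close>] closed_invariant_closedin[OF Z]
    by (intro closure_of_minimal) auto
  finally show ?thesis
    using \<open>e \<in> E\<close> by blast
qed

lemma ellis_mult_closed: "e \<in> E \<Longrightarrow> f \<in> E \<Longrightarrow> compose Y e f \<in> E"
  using closed_invariant_ellis_act[OF closed_invariant_ellis_semigroup] .

lemma compose_ellis_mult:
  "x \<in> A \<rightarrow>\<^sub>E Y \<Longrightarrow> compose A (compose Y e f) x = compose A e (compose A f x)"
  using compose_assoc[of x A Y e f] by (auto simp: PiE_def)

lemma ellis_mult_assoc: "f \<in> E \<Longrightarrow> compose Y (compose Y d e) f = compose Y d (compose Y e f)"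
  by (intro compose_ellis_mult ellis_semigroup_PiE)

definition translates_closure :: "('y \<Rightarrow> 'y) set \<Rightarrow> ('y + 'y \<Rightarrow> 'y) set" where
  "translates_closure B = flow_power \<Phi> (Y <+> Y) closure_of
     ((\<lambda>(h, b). pairing Y h (compose Y h b)) ` (flow_maps \<Phi> \<times> B))"

lemma translates_PiE:
  assumes "B \<subseteq> E" "h \<in> flow_maps \<Phi>" "b \<in> B"
  shows "h \<in> Y \<rightarrow>\<^sub>E Y" "compose Y h b \<in> Y \<rightarrow>\<^sub>E Y"
proof -
  have "h \<in> E" "compose Y h b \<in> E"
    using assms flow_maps_ellis_semigroup ellis_mult_closed by blast+
  then show "h \<in> Y \<rightarrow>\<^sub>E Y" "compose Y h b \<in> Y \<rightarrow>\<^sub>E Y"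
    by (simp_all only: ellis_semigroup_PiE)
qed

lemma pairing_translates_PiE:
  assumes "B \<subseteq> E" "h \<in> flow_maps \<Phi>" "b \<in> B"
  shows "pairing Y h (compose Y h b) \<in> Y <+> Y \<rightarrow>\<^sub>E Y"
  using translates_PiE[OF assms] by (rule pairing_mem_PiE)

lemma closed_invariant_translates_closure:
  assumes "B \<subseteq> E"
  shows "closed_invariant \<Phi> (Y <+> Y) (translates_closure B)"
  unfolding translates_closure_def
proof (rule closed_invariant_closure)
  let ?P = "(\<lambda>(h, b). pairing Y h (compose Y h b)) ` (flow_maps \<Phi> \<times> B)"
  show "?P \<subseteq> Y <+> Y \<rightarrow>\<^sub>E Y"
    using pairing_translates_PiE[OF assms] by (simp add: image_subset_iff)
  fix g x assume g: "g \<in> flow_group \<Phi>" and "x \<in> ?P"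
  then obtain h b where hb: "h \<in> flow_maps \<Phi>" "b \<in> B" "x = pairing Y h (compose Y h b)"
    by auto
  have "compose (Y <+> Y) (flow_act \<Phi> g) x =
      pairing Y (compose Y (flow_act \<Phi> g) h) (compose Y (compose Y (flow_act \<Phi> g) h) b)"
    using hb assms by (simp add: compose_pairing ellis_mult_assoc subset_iff)
  then show "compose (Y <+> Y) (flow_act \<Phi> g) x \<in> ?P"
    using compose_act_flow_maps[OF g hb(1)] hb(2) by auto
qed

lemma ellis_circ_iff:
  assumes B: "B \<subseteq> E" and ac: "a \<in> extensional Y" "c \<in> extensional Y"
  shows "c \<in> ellis_circ \<Phi> a B \<longleftrightarrow> pairing Y a c \<in> translates_closure B"
proof -
  let ?f = "\<lambda>(h, b). pairing Y h (compose Y h b)"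
  have "?f ` (flow_maps \<Phi> \<times> B) \<subseteq> topspace (flow_power \<Phi> (Y <+> Y))"
    using pairing_translates_PiE[OF B] by (simp add: image_subset_iff)
  then have "pairing Y a c \<in> translates_closure B \<longleftrightarrow>
      (\<exists>\<F>. \<F> \<noteq> bot \<and> (\<forall>\<^sub>F d in \<F>. d \<in> flow_maps \<Phi> \<times> B) \<and>
        limitin (flow_power \<Phi> (Y <+> Y)) ?f (pairing Y a c) \<F>)"
    unfolding translates_closure_def by (rule in_closure_of_image_iff)
  moreover have "limitin (flow_power \<Phi> (Y <+> Y)) ?f (pairing Y a c) \<F> \<longleftrightarrow>
      limitin (flow_power \<Phi> Y) (\<lambda>(h, b). h) a \<F> \<and> limitin (flow_power \<Phi> Y) (\<lambda>(h, b). compose Y h b) c \<F>"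
    if "\<forall>\<^sub>F d in \<F>. d \<in> flow_maps \<Phi> \<times> B" for \<F>
  proof -
    have "\<forall>\<^sub>F d in \<F>. (case d of (h, b) \<Rightarrow> h) \<in> Y \<rightarrow>\<^sub>E topspace (flow_space \<Phi>) \<and>
        (case d of (h, b) \<Rightarrow> compose Y h b) \<in> Y \<rightarrow>\<^sub>E topspace (flow_space \<Phi>)"
      using that
    proof (rule eventually_mono)
      fix d assume "d \<in> flow_maps \<Phi> \<times> B"
      then show "(case d of (h, b) \<Rightarrow> h) \<in> Y \<rightarrow>\<^sub>E topspace (flow_space \<Phi>) \<and>
          (case d of (h, b) \<Rightarrow> compose Y h b) \<in> Y \<rightarrow>\<^sub>E topspace (flow_space \<Phi>)"
        using translates_PiE[OF B, of "fst d" "snd d"] by (cases d) simp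
    qed
    from limitin_pairing[OF this ac] show ?thesis
      by (simp add: case_prod_unfold)
  qed
  ultimately show ?thesis
    by (auto simp: ellis_circ_def self_maps_def ellis_mult_def case_prod_unfold mem_Times_iff)
qed

end

section \<open>Minimal left ideals and the Ellis group\<close>

locale ellis_ideal = compact_flow \<Phi> for \<Phi> :: "('g, 'y) flow" +
  fixes M u
  assumes minimal: "minimal_left_ideal \<Phi> M" and u_mem: "u \<in> M"
    and idempotent: "ellis_mult \<Phi> u u = u"
begin

abbreviation "uM \<equiv> carrier (ellis_group \<Phi> M u)"

lemma left_ideal: "left_ideal \<Phi> M"
  using minimal by (simp add: minimal_left_ideal_def)

lemma ideal_subset: "m \<in> M \<Longrightarrow> m \<in> E"
  using left_ideal by (auto simp: left_ideal_def)

lemma ideal_mult: "e \<in> E \<Longrightarrow> m \<in> M \<Longrightarrow> compose Y e m \<in> M"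
  using left_ideal by (auto simp: left_ideal_def ellis_mult_def)

lemma ideal_eq_translates:
  assumes m: "m \<in> M"
  shows "(\<lambda>e. compose Y e m) ` E = M"
proof -
  have "left_ideal \<Phi> ((\<lambda>e. compose Y e m) ` E)"
    unfolding left_ideal_def ellis_mult_def
    using id_ellis_semigroup ideal_subset[OF m] ellis_mult_closed
    by (auto simp flip: ellis_mult_assoc)
  moreover have "(\<lambda>e. compose Y e m) ` E \<subseteq> M"
    using m ideal_mult by auto
  ultimately show ?thesis
    using minimal by (auto simp: minimal_left_ideal_def)
qed

lemma ideal_transitive:
  assumes "m \<in> M" "n \<in> M"
  obtains e where "e \<in> E" "compose Y e m = n"
proof -
  have "n \<in> (\<lambda>e. compose Y e m) ` E"
    using assms by (simp add: ideal_eq_translates)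
  then show thesis
    using that by auto
qed

lemma closed_invariant_ideal: "closed_invariant \<Phi> Y M"
proof -
  have "u \<in> Y \<rightarrow> Y"
    using ellis_semigroup_PiE[OF ideal_subset[OF u_mem]] by auto
  from closed_invariant_reindex_image[OF closed_invariant_ellis_semigroup this]
  show ?thesis
    by (simp add: ideal_eq_translates[OF u_mem])
qed

lemma ideal_minimal:
  assumes "closed_invariant \<Phi> Y Z" "Z \<subseteq> M" "Z \<noteq> {}"
  shows "Z = M"
proof -
  have "left_ideal \<Phi> Z"
    unfolding left_ideal_def ellis_mult_def
    using assms closed_invariant_ellis_act ideal_subset by auto
  then show ?thesis
    using minimal assms by (auto simp: minimal_left_ideal_def)
qed

lemma mult_u:
  assumes "m \<in> M"
  shows "compose Y m u = m"
proof -
  obtain e where "compose Y e u = m"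
    using ideal_transitive[OF u_mem assms] .
  then show ?thesis
    using idempotent ellis_mult_assoc[OF ideal_subset[OF u_mem], of e u] by (auto simp: ellis_mult_def)
qed

lemma mem_uM_iff: "g \<in> uM \<longleftrightarrow> g \<in> M \<and> compose Y u g = g"
proof
  assume "g \<in> uM"
  then obtain m where m: "m \<in> M" "g = compose Y u m"
    by (auto simp: ellis_group_def ellis_mult_def)
  then have "compose Y u g = compose Y (compose Y u u) m"
    by (simp add: ellis_mult_assoc ideal_subset)
  then show "g \<in> M \<and> compose Y u g = g"
    using m ideal_mult[OF ideal_subset[OF u_mem]] idempotent by (simp add: ellis_mult_def)
next
  assume "g \<in> M \<and> compose Y u g = g"
  then show "g \<in> uM"
    by (simp add: ellis_group_def ellis_mult_def rev_image_eqI[of g])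
qed

lemma uM_subset: "g \<in> uM \<Longrightarrow> g \<in> M"
  by (simp add: mem_uM_iff)

lemma u_mult: "g \<in> uM \<Longrightarrow> compose Y u g = g"
  by (simp add: mem_uM_iff)

lemma uM_ellis_semigroup: "g \<in> uM \<Longrightarrow> g \<in> E"
  by (simp add: uM_subset ideal_subset)

lemma u_mult_mem: "m \<in> M \<Longrightarrow> compose Y u m \<in> uM"
  by (simp add: ellis_group_def ellis_mult_def)

lemma u_uM: "u \<in> uM"
  using u_mem idempotent by (simp add: mem_uM_iff ellis_mult_def)

lemma uM_mult:
  assumes "g \<in> uM" "m \<in> M"
  shows "compose Y g m \<in> uM"
  using assms ideal_mult[OF uM_ellis_semigroup] u_mult
  by (simp add: mem_uM_iff flip: ellis_mult_assoc[OF ideal_subset])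

lemma left_inverse:
  assumes m: "m \<in> M"
  obtains k where "k \<in> uM" "compose Y k m = u"
proof -
  have um: "compose Y u m \<in> M"
    using m by (intro ideal_mult ideal_subset u_mem)
  obtain e where e: "e \<in> E" "compose Y e (compose Y u m) = u"
    using ideal_transitive[OF um u_mem] .
  let ?k = "compose Y u (compose Y e u)"
  have "compose Y ?k m = compose Y u (compose Y e (compose Y u m))"
    using m by (simp add: ellis_mult_assoc ideal_subset)
  then have "compose Y ?k m = u"
    using e idempotent by (simp add: ellis_mult_def)
  moreover have "?k \<in> uM"
    using e u_mem by (intro u_mult_mem ideal_mult)
  ultimately show thesis
    using that by blast
qed

lemma one_ellis_group [simp]: "\<one>\<^bsub>ellis_group \<Phi> M u\<^esub> = u"
  and mult_ellis_group [simp]: "g \<otimes>\<^bsub>ellis_group \<Phi> M u\<^esub> h = compose Y g h"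
  by (simp_all add: ellis_group_def ellis_mult_def)

lemma group_ellis_group: "group (ellis_group \<Phi> M u)"
proof (rule groupI)
  show "\<one>\<^bsub>ellis_group \<Phi> M u\<^esub> \<in> uM"
    using u_uM by simp
next
  fix g h assume "g \<in> uM" "h \<in> uM"
  then show "g \<otimes>\<^bsub>ellis_group \<Phi> M u\<^esub> h \<in> uM"
    using uM_mult[OF _ uM_subset] by simp
next
  fix g h k assume "k \<in> uM"
  then show "g \<otimes>\<^bsub>ellis_group \<Phi> M u\<^esub> h \<otimes>\<^bsub>ellis_group \<Phi> M u\<^esub> k =
      g \<otimes>\<^bsub>ellis_group \<Phi> M u\<^esub> (h \<otimes>\<^bsub>ellis_group \<Phi> M u\<^esub> k)"
    by (simp add: ellis_mult_assoc uM_ellis_semigroup)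
next
  fix g assume g: "g \<in> uM"
  then show "\<one>\<^bsub>ellis_group \<Phi> M u\<^esub> \<otimes>\<^bsub>ellis_group \<Phi> M u\<^esub> g = g"
    by (simp add: u_mult)
  obtain k where "k \<in> uM" "compose Y k g = u"
    using left_inverse[OF uM_subset[OF g]] .
  then show "\<exists>h\<in>uM. h \<otimes>\<^bsub>ellis_group \<Phi> M u\<^esub> g = \<one>\<^bsub>ellis_group \<Phi> M u\<^esub>"
    by auto
qed

lemma right_cancel:
  assumes v: "v \<in> E" and mn: "m \<in> M" "n \<in> M" and eq: "compose Y m v = compose Y n v"
  shows "m = n"
proof -
  let ?g = "compose Y u (compose Y v u)"
  have g: "?g \<in> uM"
    using v u_mem by (intro u_mult_mem ideal_mult)
  obtain k where k: "k \<in> uM" "compose Y ?g k = u"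
    using group.r_inv_ex[OF group_ellis_group g] by auto
  have "m' = compose Y (compose Y m' v) k" if m': "m' \<in> M" for m'
  proof -
    have "m' = compose Y m' (compose Y ?g k)"
      using mult_u[OF m'] k(2) by simp
    also have "\<dots> = compose Y (compose Y m' u) (compose Y v (compose Y u k))"
      using k(1) v u_mem by (simp add: ellis_mult_assoc uM_ellis_semigroup ideal_subset ellis_mult_closed)
    also have "\<dots> = compose Y (compose Y m' v) k"
      using mult_u[OF m'] u_mult[OF k(1)] by (simp add: ellis_mult_assoc uM_ellis_semigroup k(1))
    finally show ?thesis .
  qed
  then show ?thesis
    using mn eq by metis
qed

lemma mem_tau_closure_iff:
  assumes "B \<subseteq> uM" "c \<in> uM"
  shows "c \<in> tau_closure \<Phi> M u B \<longleftrightarrow> pairing Y u c \<in> translates_closure B"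
proof -
  have "u \<in> extensional Y" "c \<in> extensional Y"
    using ellis_semigroup_PiE ideal_subset u_mem uM_ellis_semigroup[OF assms(2)] by (auto simp: PiE_def)
  then show ?thesis
    using ellis_circ_iff[of B u c] assms uM_ellis_semigroup
    by (auto simp: tau_closure_def)
qed

end

section \<open>Right multiplications and their graphs\<close>

text \<open>
  A point \<open>z\<close> with \<open>u z = z\<close> at which evaluation is injective on \<open>M\<close> identifies \<open>M\<close> with the orbit
  \<open>M z\<close>. The minimal closed invariant subsets of \<open>M z \<times> M z\<close> are then the graphs of the right
  multiplications by the elements of \<open>u M\<close>.
\<close>

locale ellis_coordinates = ellis_ideal \<Phi> M u for \<Phi> :: "('g, 'y) flow" and M u +
  fixes A :: "'j set" and z :: "'j \<Rightarrow> 'y"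
  assumes z_PiE: "z \<in> A \<rightarrow>\<^sub>E Y" and u_act: "compose A u z = z"
    and inj_eval: "inj_on (\<lambda>m. compose A m z) M"
begin

definition orbit :: "('j \<Rightarrow> 'y) set" where
  "orbit = (\<lambda>m. compose A m z) ` M"

definition mult_graph :: "('y \<Rightarrow> 'y) \<Rightarrow> ('j + 'j \<Rightarrow> 'y) set" where
  "mult_graph b = (\<lambda>m. pairing A (compose A m z) (compose A (compose Y m b) z)) ` M"

lemma z_funcset: "z \<in> A \<rightarrow> Y"
  using z_PiE by auto

lemma closed_invariant_orbit: "closed_invariant \<Phi> A orbit"
  unfolding orbit_def by (rule closed_invariant_reindex_image[OF closed_invariant_ideal z_funcset])

lemma mem_mult_graph_iff:
  assumes "x \<in> extensional A" "y \<in> extensional A"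
  shows "pairing A x y \<in> mult_graph b \<longleftrightarrow>
    (\<exists>m\<in>M. x = compose A m z \<and> y = compose A (compose Y m b) z)"
  using assms by (auto simp: mult_graph_def pairing_eq_iff)

lemma base_pair_mult_graph: "b \<in> uM \<Longrightarrow> pairing A z (compose A b z) \<in> mult_graph b"
  unfolding mult_graph_def
  by (intro image_eqI[of _ _ u]) (simp_all add: u_act u_mem u_mult)

lemma mult_graph_subset_pairings: "b \<in> uM \<Longrightarrow> mult_graph b \<subseteq> pairings A orbit orbit"
  unfolding mult_graph_def orbit_def pairings_def
  using ideal_mult[OF ideal_subset uM_subset] by auto

lemma mult_graph_subset:
  assumes b: "b \<in> uM" and V: "closed_invariant \<Phi> (A <+> A) V" and "mult_graph b \<inter> V \<noteq> {}"
  shows "mult_graph b \<subseteq> V"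
proof
  fix w assume "w \<in> mult_graph b"
  then obtain n where n: "n \<in> M" "w = pairing A (compose A n z) (compose A (compose Y n b) z)"
    by (auto simp: mult_graph_def)
  obtain m where m: "m \<in> M" "pairing A (compose A m z) (compose A (compose Y m b) z) \<in> V"
    using assms(3) by (auto simp: mult_graph_def)
  obtain e where e: "e \<in> E" "compose Y e m = n"
    using ideal_transitive[OF m(1) n(1)] .
  have "w = compose (A <+> A) e (pairing A (compose A m z) (compose A (compose Y m b) z))"
    using z_PiE b unfolding n(2) e(2)[symmetric]
    by (simp add: compose_pairing ellis_mult_assoc uM_ellis_semigroup flip: compose_ellis_mult)
  then show "w \<in> V"
    using closed_invariant_ellis_act[OF V e(1) m(2)] by simp
qed

lemma closed_invariant_mult_graph:
  assumes b: "b \<in> uM"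
  shows "closed_invariant \<Phi> (A <+> A) (mult_graph b)"
proof -
  let ?w = "pairing A z (compose A b z)"
  have "mult_graph b = (\<lambda>m. compose (A <+> A) m ?w) ` M"
    unfolding mult_graph_def using z_PiE by (simp add: compose_pairing compose_ellis_mult)
  moreover have "compose A b z \<in> A \<rightarrow>\<^sub>E Y"
    using closed_invariant_subset[OF closed_invariant_orbit] uM_subset[OF b] by (auto simp: orbit_def)
  then have "?w \<in> A <+> A \<rightarrow> Y"
    using pairing_mem_PiE[OF z_PiE] by auto
  ultimately show ?thesis
    using closed_invariant_reindex_image[OF closed_invariant_ideal] by simp
qed

lemma mult_graph_subset_imp_eq:
  assumes a: "a \<in> uM" and b: "b \<in> uM" and "mult_graph a \<subseteq> mult_graph b"
  shows "a = b"
proof -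
  have "pairing A z (compose A a z) \<in> mult_graph b"
    using base_pair_mult_graph[OF a] assms(3) by blast
  then obtain m where m: "m \<in> M" "z = compose A m z" "compose A a z = compose A (compose Y m b) z"
    using z_PiE by (auto simp: mem_mult_graph_iff PiE_def)
  then have "m = u"
    using inj_onD[OF inj_eval _ m(1) u_mem] u_act by simp
  then show ?thesis
    using m(3) inj_onD[OF inj_eval] uM_subset[OF a] uM_subset[OF b] u_mult[OF b] by simp
qed

lemma ex_mult_graph_subset:
  assumes V: "closed_invariant \<Phi> (A <+> A) V" and "V \<inter> pairings A orbit orbit \<noteq> {}"
  shows "\<exists>b\<in>uM. mult_graph b \<subseteq> V"
proof -
  obtain m n where m: "m \<in> M" and n: "n \<in> M" and V': "pairing A (compose A m z) (compose A n z) \<in> V"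
    using assms(2) by (auto simp: pairings_def orbit_def)
  obtain k where k: "k \<in> uM" "compose Y k m = u"
    using left_inverse[OF m] .
  let ?b = "compose Y k n"
  have b: "?b \<in> uM"
    by (rule uM_mult[OF k(1) n])
  have "compose (A <+> A) k (pairing A (compose A m z) (compose A n z)) = pairing A z (compose A ?b z)"
    using z_PiE k(2) u_act by (simp add: compose_pairing flip: compose_ellis_mult)
  then have "pairing A z (compose A ?b z) \<in> V"
    using closed_invariant_ellis_act[OF V uM_ellis_semigroup[OF k(1)] V'] by simp
  then show ?thesis
    using mult_graph_subset[OF b V] base_pair_mult_graph[OF b] b by blast
qed

lemma mult_graph_mult_splitE:
  assumes "a \<in> uM" "b \<in> uM" "w \<in> mult_graph (compose Y a b)"
  obtains x y v where "w = pairing A x v" "pairing A x y \<in> mult_graph a" "pairing A y v \<in> mult_graph b"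
proof -
  obtain m where m: "m \<in> M"
    and w: "w = pairing A (compose A m z) (compose A (compose Y m (compose Y a b)) z)"
    using assms(3) by (auto simp: mult_graph_def)
  let ?y = "compose A (compose Y m a) z"
  have "pairing A (compose A m z) ?y \<in> mult_graph a"
    using m by (auto simp: mult_graph_def)
  moreover have "w = pairing A (compose A m z) (compose A (compose Y (compose Y m a) b) z)"
    using w assms(2) by (simp add: ellis_mult_assoc uM_ellis_semigroup)
  moreover have "compose Y m a \<in> M"
    by (rule ideal_mult[OF ideal_subset[OF m] uM_subset[OF assms(1)]])
  then have "pairing A ?y (compose A (compose Y (compose Y m a) b) z) \<in> mult_graph b"
    by (auto simp: mult_graph_def)
  ultimately show thesis
    using that by blast
qed

lemma mult_graph_mult:
  assumes a: "a \<in> uM" and b: "b \<in> uM"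
    and ext: "x \<in> extensional A" "y \<in> extensional A" "v \<in> extensional A"
    and xy: "pairing A x y \<in> mult_graph a" and yv: "pairing A y v \<in> mult_graph b"
  shows "pairing A x v \<in> mult_graph (compose Y a b)"
proof -
  obtain m where m: "m \<in> M" "x = compose A m z" "y = compose A (compose Y m a) z"
    using xy ext by (auto simp: mem_mult_graph_iff)
  obtain n where n: "n \<in> M" "y = compose A n z" "v = compose A (compose Y n b) z"
    using yv ext by (auto simp: mem_mult_graph_iff)
  have "n = compose Y m a"
    using inj_onD[OF inj_eval _ n(1), of "compose Y m a"] m n ideal_mult[OF ideal_subset uM_subset[OF a]]
    by simp
  then show ?thesis
    using m n ext b by (auto simp: mem_mult_graph_iff ellis_mult_assoc uM_ellis_semigroup)
qed

lemma compose_pairing_map_sum: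
  "compose (A <+> A) (pairing Y e f) (map_sum z z) = pairing A (compose A e z) (compose A f z)"
  using z_funcset by (auto simp: pairing_def compose_def fun_eq_iff split: sum.splits)

lemma map_sum_z_funcset: "map_sum z z \<in> A <+> A \<rightarrow> Y <+> Y"
  using z_funcset by auto

lemma mult_graph_subset_if_tau_closure:
  assumes B: "B \<subseteq> uM" and V: "closed_invariant \<Phi> (A <+> A) V" "\<And>b. b \<in> B \<Longrightarrow> mult_graph b \<subseteq> V"
    and c: "c \<in> tau_closure \<Phi> M u B"
  shows "mult_graph c \<subseteq> V"
proof -
  let ?W = "{w \<in> Y <+> Y \<rightarrow>\<^sub>E Y. compose (A <+> A) w (map_sum z z) \<in> V}"
  have cG: "c \<in> uM"
    using c by (simp add: tau_closure_def)
  have "translates_closure B \<subseteq> ?W"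
    unfolding translates_closure_def
  proof (rule closure_of_minimal)
    show "closedin (flow_power \<Phi> (Y <+> Y)) ?W"
      by (intro closed_invariant_closedin closed_invariant_reindex_vimage V(1) map_sum_z_funcset)
    show "(\<lambda>(h, b). pairing Y h (compose Y h b)) ` (flow_maps \<Phi> \<times> B) \<subseteq> ?W"
    proof clarify
      fix h b assume h: "h \<in> flow_maps \<Phi>" and b: "b \<in> B"
      have "pairing A z (compose A b z) \<in> V"
        using V(2)[OF b] base_pair_mult_graph B b by blast
      then have "compose (A <+> A) h (pairing A z (compose A b z)) \<in> V"
        by (rule closed_invariant_flow_map[OF V(1) h])
      then have "compose (A <+> A) (pairing Y h (compose Y h b)) (map_sum z z) \<in> V"
        by (simp add: compose_pairing_map_sum compose_pairing compose_ellis_mult[OF z_PiE])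
      then show "pairing Y h (compose Y h b) \<in> Y <+> Y \<rightarrow>\<^sub>E Y \<and>
          compose (A <+> A) (pairing Y h (compose Y h b)) (map_sum z z) \<in> V"
        using pairing_translates_PiE[OF _ h b] B uM_ellis_semigroup by blast
    qed
  qed
  then have "compose (A <+> A) (pairing Y u c) (map_sum z z) \<in> V"
    using c mem_tau_closure_iff[OF B cG] by blast
  then have "pairing A z (compose A c z) \<in> V"
    by (simp add: compose_pairing_map_sum u_act)
  then show ?thesis
    using mult_graph_subset[OF cG V(1)] base_pair_mult_graph[OF cG] by blast
qed

lemma tau_closure_if_mult_graph_subset:
  assumes B: "B \<subseteq> uM" and c: "c \<in> uM"
    and subset: "\<And>V. closed_invariant \<Phi> (A <+> A) V \<Longrightarrow> (\<And>b. b \<in> B \<Longrightarrow> mult_graph b \<subseteq> V) \<Longrightarrow> mult_graph c \<subseteq> V"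
  shows "c \<in> tau_closure \<Phi> M u B"
proof -
  let ?K = "translates_closure B \<inter> pairings Y M M"
  let ?V = "(\<lambda>w. compose (A <+> A) w (map_sum z z)) ` ?K"
  have "B \<subseteq> E"
    using B uM_ellis_semigroup by blast
  then have V: "closed_invariant \<Phi> (A <+> A) ?V"
    by (intro closed_invariant_reindex_image[OF _ map_sum_z_funcset] closed_invariant_Int
        closed_invariant_translates_closure closed_invariant_pairings closed_invariant_ideal)
  have "mult_graph b \<subseteq> ?V" if b: "b \<in> B" for b
  proof -
    have "b \<in> tau_closure \<Phi> M u B"
      using tau_closure_extensive[OF left_ideal u_mem idempotent B] b by blast
    moreover have "b \<in> M"
      using B b uM_subset by blast
    ultimately have "pairing Y u b \<in> ?K"
      using mem_tau_closure_iff[OF B] B b u_mem pairing_mem_pairings by blast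
    then have "pairing A z (compose A b z) \<in> ?V"
      using compose_pairing_map_sum[of u b] u_act by force
    then show ?thesis
      using mult_graph_subset[OF _ V] base_pair_mult_graph B b by blast
  qed
  then have "mult_graph c \<subseteq> ?V"
    by (rule subset[OF V])
  then have "pairing A z (compose A c z) \<in> ?V"
    using base_pair_mult_graph[OF c] by blast
  then obtain m f where mf: "m \<in> M" "f \<in> M" "pairing Y m f \<in> translates_closure B"
    and "pairing A z (compose A c z) = pairing A (compose A m z) (compose A f z)"
    by (auto simp: pairings_def compose_pairing_map_sum)
  then have "compose A m z = z" "compose A f z = compose A c z"
    using z_PiE by (simp_all add: pairing_eq_iff PiE_def)
  then have "m = u" "f = c"
    using inj_onD[OF inj_eval] mf(1,2) u_mem uM_subset[OF c] u_act by simp_all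
  then show ?thesis
    using mf(3) mem_tau_closure_iff[OF B c] by simp
qed

lemma tau_closure_iff:
  assumes "B \<subseteq> uM" "c \<in> uM"
  shows "c \<in> tau_closure \<Phi> M u B \<longleftrightarrow>
    (\<forall>V. closed_invariant \<Phi> (A <+> A) V \<and> (\<forall>b\<in>B. mult_graph b \<subseteq> V) \<longrightarrow> mult_graph c \<subseteq> V)"
  using mult_graph_subset_if_tau_closure[OF assms(1)] tau_closure_if_mult_graph_subset[OF assms]
  by blast

end

section \<open>Flows with isomorphic lattices of closed invariant sets\<close>

definition closed_invariant_iso ::
  "('h, 'w) flow \<Rightarrow> ('g, 'y) flow \<Rightarrow> ('w \<Rightarrow> 'y) \<Rightarrow> 'j set \<Rightarrow> bool" where
  "closed_invariant_iso \<Phi>' \<Phi> r A \<longleftrightarrow>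
     (`) (compose A r) ` Collect (closed_invariant \<Phi>' A) = Collect (closed_invariant \<Phi> A) \<and>
     (\<forall>Z W. closed_invariant \<Phi>' A Z \<and> closed_invariant \<Phi>' A W \<and>
        compose A r ` Z \<subseteq> compose A r ` W \<longrightarrow> Z \<subseteq> W)"

lemma closed_invariant_iso_image:
  "closed_invariant_iso \<Phi>' \<Phi> r A \<Longrightarrow> closed_invariant \<Phi>' A Z \<Longrightarrow> closed_invariant \<Phi> A (compose A r ` Z)"
  by (auto simp: closed_invariant_iso_def)

lemma closed_invariant_iso_lift:
  assumes "closed_invariant_iso \<Phi>' \<Phi> r A" "closed_invariant \<Phi> A Z"
  obtains W where "closed_invariant \<Phi>' A W" "compose A r ` W = Z"
proof -
  have "Z \<in> (`) (compose A r) ` Collect (closed_invariant \<Phi>' A)"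
    using assms by (simp add: closed_invariant_iso_def)
  then show thesis
    using that by blast
qed

lemma closed_invariant_iso_subset:
  "closed_invariant_iso \<Phi>' \<Phi> r A \<Longrightarrow> closed_invariant \<Phi>' A Z \<Longrightarrow> closed_invariant \<Phi>' A W \<Longrightarrow>
    compose A r ` Z \<subseteq> compose A r ` W \<Longrightarrow> Z \<subseteq> W"
  by (simp add: closed_invariant_iso_def)

lemma closed_invariant_iso_image_Int:
  assumes iso: "closed_invariant_iso \<Phi>' \<Phi> r A"
    and Z: "closed_invariant \<Phi>' A Z" and W: "closed_invariant \<Phi>' A W"
  shows "compose A r ` (Z \<inter> W) = compose A r ` Z \<inter> compose A r ` W"
proof
  obtain V where V: "closed_invariant \<Phi>' A V" "compose A r ` V = compose A r ` Z \<inter> compose A r ` W"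
    using closed_invariant_iso_lift[OF iso closed_invariant_Int] closed_invariant_iso_image[OF iso] Z W
    by metis
  then have "V \<subseteq> Z \<inter> W"
    using closed_invariant_iso_subset[OF iso V(1)] Z W by simp
  then show "compose A r ` Z \<inter> compose A r ` W \<subseteq> compose A r ` (Z \<inter> W)"
    using V(2) by blast
qed blast

locale ellis_correspondence =
  tgt: ellis_coordinates \<Phi> M u A z + src: ellis_coordinates \<Phi>' M' u' A z'
  for \<Phi> :: "('g, 'y) flow" and M u and \<Phi>' :: "('h, 'w) flow" and M' u'
    and A :: "'j set" and z z' +
  fixes r :: "'w \<Rightarrow> 'y"
  assumes iso: "closed_invariant_iso \<Phi>' \<Phi> r (A <+> A)"
    and image_orbit: "compose A r ` src.orbit = tgt.orbit"
begin

lemma image_mult_graph: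
  assumes a: "a \<in> src.uM"
  obtains b where "b \<in> tgt.uM" "compose (A <+> A) r ` src.mult_graph a = tgt.mult_graph b"
proof -
  note graph = src.closed_invariant_mult_graph[OF a]
  have "compose (A <+> A) r ` src.mult_graph a \<subseteq> pairings A tgt.orbit tgt.orbit"
    using src.mult_graph_subset_pairings[OF a] by (auto simp flip: image_pairings image_orbit)
  moreover have "src.mult_graph a \<noteq> {}"
    using src.base_pair_mult_graph[OF a] by blast
  ultimately obtain b where b: "b \<in> tgt.uM" "tgt.mult_graph b \<subseteq> compose (A <+> A) r ` src.mult_graph a"
    using tgt.ex_mult_graph_subset[OF closed_invariant_iso_image[OF iso graph]] by blast
  obtain W where W: "closed_invariant \<Phi>' (A <+> A) W" "compose (A <+> A) r ` W = tgt.mult_graph b"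
    using closed_invariant_iso_lift[OF iso tgt.closed_invariant_mult_graph[OF b(1)]] .
  have "W \<subseteq> src.mult_graph a"
    using closed_invariant_iso_subset[OF iso W(1) graph] W(2) b(2) by simp
  moreover have "W \<noteq> {}"
    using W(2) tgt.base_pair_mult_graph[OF b(1)] by blast
  ultimately have "src.mult_graph a \<subseteq> W"
    using src.mult_graph_subset[OF a W(1)] by blast
  then show thesis
    using that[OF b(1)] b(2) W(2) by blast
qed

definition ellis_iso :: "('w \<Rightarrow> 'w) \<Rightarrow> 'y \<Rightarrow> 'y" where
  "ellis_iso a = (THE b. b \<in> tgt.uM \<and> compose (A <+> A) r ` src.mult_graph a = tgt.mult_graph b)"

lemma ellis_iso_eqI:
  assumes "b \<in> tgt.uM" "compose (A <+> A) r ` src.mult_graph a = tgt.mult_graph b"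
  shows "ellis_iso a = b"
  unfolding ellis_iso_def
  using assms tgt.mult_graph_subset_imp_eq by (intro the_equality) auto

lemma
  assumes "a \<in> src.uM"
  shows ellis_iso_mem: "ellis_iso a \<in> tgt.uM"
    and image_mult_graph_eq: "compose (A <+> A) r ` src.mult_graph a = tgt.mult_graph (ellis_iso a)"
  using image_mult_graph[OF assms] ellis_iso_eqI by metis+

lemma ellis_iso_mult:
  assumes a: "a \<in> src.uM" and b: "b \<in> src.uM"
  shows "ellis_iso (compose src.Y a b) = compose tgt.Y (ellis_iso a) (ellis_iso b)"
proof -
  have ab: "compose src.Y a b \<in> src.uM"
    using src.uM_mult[OF a src.uM_subset[OF b]] .
  have prod: "compose tgt.Y (ellis_iso a) (ellis_iso b) \<in> tgt.uM"
    using tgt.uM_mult[OF ellis_iso_mem[OF a] tgt.uM_subset[OF ellis_iso_mem[OF b]]] .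
  have "compose (A <+> A) r ` src.mult_graph (compose src.Y a b) \<subseteq>
      tgt.mult_graph (compose tgt.Y (ellis_iso a) (ellis_iso b))"
  proof
    fix w assume "w \<in> compose (A <+> A) r ` src.mult_graph (compose src.Y a b)"
    then obtain x y v where "w = pairing A (compose A r x) (compose A r v)"
      and "pairing A x y \<in> src.mult_graph a" "pairing A y v \<in> src.mult_graph b"
      by (auto simp: compose_pairing elim: src.mult_graph_mult_splitE[OF a b])
    then have "w = pairing A (compose A r x) (compose A r v)"
      "pairing A (compose A r x) (compose A r y) \<in> tgt.mult_graph (ellis_iso a)"
      "pairing A (compose A r y) (compose A r v) \<in> tgt.mult_graph (ellis_iso b)"
      by (auto simp flip: compose_pairing image_mult_graph_eq[OF a] image_mult_graph_eq[OF b])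
    then show "w \<in> tgt.mult_graph (compose tgt.Y (ellis_iso a) (ellis_iso b))"
      using tgt.mult_graph_mult[OF ellis_iso_mem[OF a] ellis_iso_mem[OF b] compose_extensional
          compose_extensional compose_extensional]
      by blast
  qed
  then show ?thesis
    unfolding image_mult_graph_eq[OF ab]
    by (rule tgt.mult_graph_subset_imp_eq[OF ellis_iso_mem[OF ab] prod])
qed

lemma inj_ellis_iso: "inj_on ellis_iso src.uM"
proof (rule inj_onI)
  fix a b assume a: "a \<in> src.uM" and b: "b \<in> src.uM" and "ellis_iso a = ellis_iso b"
  then have "compose (A <+> A) r ` src.mult_graph a \<subseteq> compose (A <+> A) r ` src.mult_graph b"
    by (simp add: image_mult_graph_eq)
  then have "src.mult_graph a \<subseteq> src.mult_graph b"
    using closed_invariant_iso_subset[OF iso] src.closed_invariant_mult_graph a b by blast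
  then show "a = b"
    by (rule src.mult_graph_subset_imp_eq[OF a b])
qed

lemma image_ellis_iso: "ellis_iso ` src.uM = tgt.uM"
proof (intro subset_antisym subsetI)
  fix b assume b: "b \<in> tgt.uM"
  obtain W where W: "closed_invariant \<Phi>' (A <+> A) W" "compose (A <+> A) r ` W = tgt.mult_graph b"
    using closed_invariant_iso_lift[OF iso tgt.closed_invariant_mult_graph[OF b]] .
  have pairs: "closed_invariant \<Phi>' (A <+> A) (pairings A src.orbit src.orbit)"
    by (intro src.closed_invariant_pairings src.closed_invariant_orbit)
  have "W \<subseteq> pairings A src.orbit src.orbit"
    using tgt.mult_graph_subset_pairings[OF b]
    by (intro closed_invariant_iso_subset[OF iso W(1) pairs]) (simp add: W(2) image_pairings image_orbit)
  moreover have "W \<noteq> {}"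
    using W(2) tgt.base_pair_mult_graph[OF b] by blast
  ultimately obtain a where a: "a \<in> src.uM" "src.mult_graph a \<subseteq> W"
    using src.ex_mult_graph_subset[OF W(1)] by blast
  then have "tgt.mult_graph (ellis_iso a) \<subseteq> tgt.mult_graph b"
    unfolding W(2)[symmetric] image_mult_graph_eq[OF a(1), symmetric] by (intro image_mono)
  then have "ellis_iso a = b"
    by (rule tgt.mult_graph_subset_imp_eq[OF ellis_iso_mem[OF a(1)] b])
  then show "b \<in> ellis_iso ` src.uM"
    using a(1) by blast
qed (auto intro: ellis_iso_mem)

lemma ellis_iso_tau_closure_iff:
  assumes B: "B \<subseteq> src.uM" and c: "c \<in> src.uM"
  shows "c \<in> tau_closure \<Phi>' M' u' B \<longleftrightarrow> ellis_iso c \<in> tau_closure \<Phi> M u (ellis_iso ` B)"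
proof -
  let ?r = "image (compose (A <+> A) r)"
  have graph: "tgt.mult_graph (ellis_iso a) \<subseteq> ?r V \<longleftrightarrow> src.mult_graph a \<subseteq> V"
    if "closed_invariant \<Phi>' (A <+> A) V" "a \<in> src.uM" for a V
    using closed_invariant_iso_subset[OF iso src.closed_invariant_mult_graph[OF that(2)] that(1)]
    unfolding image_mult_graph_eq[OF that(2), symmetric] by blast
  have "c \<in> tau_closure \<Phi>' M' u' B \<longleftrightarrow>
      (\<forall>V\<in>Collect (closed_invariant \<Phi>' (A <+> A)). (\<forall>b\<in>B. src.mult_graph b \<subseteq> V) \<longrightarrow> src.mult_graph c \<subseteq> V)"
    unfolding src.tau_closure_iff[OF B c] by blast
  also have "\<dots> \<longleftrightarrow> (\<forall>V\<in>Collect (closed_invariant \<Phi>' (A <+> A)).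
      (\<forall>b\<in>ellis_iso ` B. tgt.mult_graph b \<subseteq> ?r V) \<longrightarrow> tgt.mult_graph (ellis_iso c) \<subseteq> ?r V)"
    by (simp add: graph c subsetD[OF B] cong: ball_cong)
  also have "\<dots> \<longleftrightarrow> (\<forall>V\<in>?r ` Collect (closed_invariant \<Phi>' (A <+> A)).
      (\<forall>b\<in>ellis_iso ` B. tgt.mult_graph b \<subseteq> V) \<longrightarrow> tgt.mult_graph (ellis_iso c) \<subseteq> V)"
    by simp
  also have "?r ` Collect (closed_invariant \<Phi>' (A <+> A)) = Collect (closed_invariant \<Phi> (A <+> A))"
    using iso by (simp add: closed_invariant_iso_def)
  also have "(\<forall>V\<in>Collect (closed_invariant \<Phi> (A <+> A)).
      (\<forall>b\<in>ellis_iso ` B. tgt.mult_graph b \<subseteq> V) \<longrightarrow> tgt.mult_graph (ellis_iso c) \<subseteq> V) \<longleftrightarrow>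
      ellis_iso c \<in> tau_closure \<Phi> M u (ellis_iso ` B)"
    using B ellis_iso_mem[OF c] ellis_iso_mem by (subst tgt.tau_closure_iff) blast+
  finally show ?thesis .
qed

lemma image_tau_closure:
  assumes B: "B \<subseteq> src.uM"
  shows "ellis_iso ` tau_closure \<Phi>' M' u' B = tau_closure \<Phi> M u (ellis_iso ` B)"
proof -
  have "tau_closure \<Phi>' M' u' B \<subseteq> src.uM" "tau_closure \<Phi> M u (ellis_iso ` B) \<subseteq> ellis_iso ` src.uM"
    by (auto simp: tau_closure_def image_ellis_iso)
  then show ?thesis
    using ellis_iso_tau_closure_iff[OF B] by blast
qed

lemma openin_image_ellis_iso_iff:
  assumes U: "U \<subseteq> src.uM"
  shows "openin (tau_topology \<Phi> M u) (ellis_iso ` U) \<longleftrightarrow> openin (tau_topology \<Phi>' M' u') U"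
proof -
  have diff: "ellis_iso ` (src.uM - U) = tgt.uM - ellis_iso ` U"
    using inj_on_image_set_diff[OF inj_ellis_iso Diff_subset U] image_ellis_iso by simp
  have "openin (tau_topology \<Phi> M u) (ellis_iso ` U) \<longleftrightarrow>
      ellis_iso ` tau_closure \<Phi>' M' u' (src.uM - U) = ellis_iso ` (src.uM - U)"
    using openin_tau_topology[OF tgt.left_ideal tgt.u_mem tgt.idempotent] U ellis_iso_mem
    by (auto simp: image_tau_closure diff)
  also have "\<dots> \<longleftrightarrow> tau_closure \<Phi>' M' u' (src.uM - U) = src.uM - U"
    by (rule inj_on_image_eq_iff[OF inj_ellis_iso]) (auto simp: tau_closure_def)
  also have "\<dots> \<longleftrightarrow> openin (tau_topology \<Phi>' M' u') U"
    using openin_tau_topology[OF src.left_ideal src.u_mem src.idempotent] U by blast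
  finally show ?thesis .
qed

lemma iso_ellis_iso: "ellis_iso \<in> iso (ellis_group \<Phi>' M' u') (ellis_group \<Phi> M u)"
  using ellis_iso_mem ellis_iso_mult inj_ellis_iso image_ellis_iso
  by (auto simp: iso_def hom_def bij_betw_def)

lemma homeomorphic_map_ellis_iso:
  "homeomorphic_map (tau_topology \<Phi>' M' u') (tau_topology \<Phi> M u) ellis_iso"
proof -
  have top: "topspace (tau_topology \<Phi>' M' u') = src.uM" "topspace (tau_topology \<Phi> M u) = tgt.uM"
    using topspace_tau_topology src.left_ideal src.u_mem src.idempotent tgt.left_ideal tgt.u_mem
      tgt.idempotent by blast+
  show ?thesis
  proof (rule bijective_open_imp_homeomorphic_map)
    show "continuous_map (tau_topology \<Phi>' M' u') (tau_topology \<Phi> M u) ellis_iso"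
      unfolding continuous_map_def top
    proof (intro conjI allI impI)
      fix U assume U: "openin (tau_topology \<Phi> M u) U"
      have "ellis_iso ` {a \<in> src.uM. ellis_iso a \<in> U} = U"
        using openin_subset[OF U] image_ellis_iso by (auto simp: top)
      then show "openin (tau_topology \<Phi>' M' u') {a \<in> src.uM. ellis_iso a \<in> U}"
        using openin_image_ellis_iso_iff[of "{a \<in> src.uM. ellis_iso a \<in> U}"] U by auto
    qed (use ellis_iso_mem in blast)
    show "open_map (tau_topology \<Phi>' M' u') (tau_topology \<Phi> M u) ellis_iso"
      unfolding open_map_def
      using openin_image_ellis_iso_iff openin_subset top by metis
  qed (simp_all add: top image_ellis_iso inj_ellis_iso)
qed

end

locale corresponding_ellis_ideals =
  tgt: ellis_ideal \<Phi> M u + src: ellis_ideal \<Phi>' M' u'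
  for \<Phi> :: "('g, 'y) flow" and M u and \<Phi>' :: "('h, 'w) flow" and M' u' +
  fixes r :: "'w \<Rightarrow> 'y"
  assumes iso: "closed_invariant_iso \<Phi>' \<Phi> r (flow_carrier \<Phi>')"
    and iso_pairs: "closed_invariant_iso \<Phi>' \<Phi> r (flow_carrier \<Phi>' <+> flow_carrier \<Phi>')"
    and iso_tgt: "closed_invariant_iso \<Phi>' \<Phi> r (flow_carrier \<Phi>)"
begin

lemma closed_invariant_image_ideal: "closed_invariant \<Phi> src.Y (compose src.Y r ` M')"
  by (rule closed_invariant_iso_image[OF iso src.closed_invariant_ideal])

lemma image_ideal_minimal:
  assumes Z: "closed_invariant \<Phi> src.Y Z" "Z \<subseteq> compose src.Y r ` M'" "Z \<noteq> {}"
  shows "Z = compose src.Y r ` M'"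
proof -
  obtain W where W: "closed_invariant \<Phi>' src.Y W" "compose src.Y r ` W = Z"
    using closed_invariant_iso_lift[OF iso Z(1)] .
  have "W \<subseteq> M'"
    using closed_invariant_iso_subset[OF iso W(1) src.closed_invariant_ideal] W(2) Z(2) by simp
  then have "W = M'"
    using src.ideal_minimal[OF W(1)] W(2) Z(3) by blast
  then show ?thesis
    using W(2) by simp
qed

definition base_point :: "'w \<Rightarrow> 'y" where
  "base_point = compose src.Y u (compose src.Y r u')"

lemma base_point_mem: "base_point \<in> compose src.Y r ` M'"
  unfolding base_point_def
  using tgt.closed_invariant_ellis_act[OF closed_invariant_image_ideal tgt.ideal_subset[OF tgt.u_mem]]
    src.u_mem by blast

lemma base_point_PiE: "base_point \<in> src.Y \<rightarrow>\<^sub>E tgt.Y"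
  using base_point_mem closed_invariant_subset[OF closed_invariant_image_ideal] by blast

text \<open>
  Lifting the identity of \<open>Y\<close> to a point \<open>s\<close> of \<open>Y'\<^sup>Y\<close> turns the base point into an element of the
  Ellis semigroup of \<open>Y\<close>, and right multiplication by such an element is injective on \<open>M\<close>.
\<close>

lemma inj_eval_base_point: "inj_on (\<lambda>m. compose src.Y m base_point) M"
proof (rule inj_onI)
  fix m n assume mn: "m \<in> M" "n \<in> M" "compose src.Y m base_point = compose src.Y n base_point"
  obtain E' where E': "closed_invariant \<Phi>' tgt.Y E'" "compose tgt.Y r ` E' = tgt.E"
    using closed_invariant_iso_lift[OF iso_tgt tgt.closed_invariant_ellis_semigroup] .
  then obtain s where s: "s \<in> E'" "compose tgt.Y r s = (\<lambda>y\<in>tgt.Y. y)"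
    using tgt.id_ellis_semigroup by (metis imageE)
  have s_fun: "s \<in> tgt.Y \<rightarrow> src.Y"
    using closed_invariant_subset[OF E'(1)] s(1) by auto
  have "compose tgt.Y r (compose tgt.Y u' s) \<in> tgt.E"
    using src.closed_invariant_ellis_act[OF E'(1) src.ideal_subset[OF src.u_mem] s(1)] E'(2) by blast
  moreover have "compose tgt.Y base_point s = compose tgt.Y u (compose tgt.Y r (compose tgt.Y u' s))"
    using s_fun by (auto simp: base_point_def compose_def fun_eq_iff)
  ultimately have v: "compose tgt.Y base_point s \<in> tgt.E"
    using tgt.ellis_mult_closed tgt.ideal_subset[OF tgt.u_mem] by simp
  have "compose tgt.Y k (compose tgt.Y base_point s) = compose tgt.Y (compose src.Y k base_point) s"
    for k :: "'y \<Rightarrow> 'y"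
    by (rule compose_assoc[OF s_fun])
  then show "m = n"
    using tgt.right_cancel[OF v mn(1,2)] mn(3) by simp
qed

lemma ellis_correspondence_base_point: "ellis_correspondence \<Phi> M u \<Phi>' M' u' src.Y base_point u' r"
proof -
  have u': "u' \<in> src.Y \<rightarrow>\<^sub>E src.Y"
    by (rule src.ellis_semigroup_PiE[OF src.ideal_subset[OF src.u_mem]])
  have u_act: "compose src.Y u base_point = base_point"
  proof -
    have "compose src.Y r u' \<in> src.Y \<rightarrow>\<^sub>E tgt.Y"
      using closed_invariant_subset[OF closed_invariant_image_ideal] src.u_mem by blast
    then show ?thesis
      using tgt.idempotent by (simp add: base_point_def ellis_mult_def flip: tgt.compose_ellis_mult)
  qed
  interpret tgt': ellis_coordinates \<Phi> M u src.Y base_point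
    using base_point_PiE u_act inj_eval_base_point by unfold_locales
  interpret src': ellis_coordinates \<Phi>' M' u' src.Y u'
    using u' src.idempotent src.mult_u by unfold_locales (simp_all add: ellis_mult_def inj_on_def)
  have "tgt'.orbit \<subseteq> compose src.Y r ` M'"
    unfolding tgt'.orbit_def
    using tgt.closed_invariant_ellis_act[OF closed_invariant_image_ideal tgt.ideal_subset base_point_mem]
    by blast
  then have "tgt'.orbit = compose src.Y r ` M'"
    using tgt.u_mem by (intro image_ideal_minimal tgt'.closed_invariant_orbit) (auto simp: tgt'.orbit_def)
  moreover have "src'.orbit = M'"
    by (simp add: src'.orbit_def src.mult_u)
  ultimately show ?thesis
    using iso_pairs by unfold_locales simp_all
qed

theorem ellis_groups_isomorphic:
  "\<exists>h. h \<in> iso (ellis_group \<Phi>' M' u') (ellis_group \<Phi> M u) \<and>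
    homeomorphic_map (tau_topology \<Phi>' M' u') (tau_topology \<Phi> M u) h"
  using ellis_correspondence.iso_ellis_iso[OF ellis_correspondence_base_point]
    ellis_correspondence.homeomorphic_map_ellis_iso[OF ellis_correspondence_base_point] by blast

end

section \<open>Factors of flows\<close>

locale flow_factor = compact_flow \<Phi> + factor: compact_flow \<Psi>
  for \<Phi> :: "('g, 'y) flow" and \<Psi> :: "('g, 'q) flow" +
  fixes \<kappa> :: "'y \<Rightarrow> 'q"
  assumes flow_group_eq: "flow_group \<Psi> = flow_group \<Phi>"
    and continuous: "continuous_map (flow_space \<Phi>) (flow_space \<Psi>) \<kappa>"
    and onto: "\<kappa> ` flow_carrier \<Phi> = flow_carrier \<Psi>"
    and equivariant: "g \<in> flow_group \<Phi> \<Longrightarrow> y \<in> flow_carrier \<Phi> \<Longrightarrow> flow_act \<Psi> g (\<kappa> y) = \<kappa> (flow_act \<Phi> g y)"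
begin

definition preimage :: "'j set \<Rightarrow> ('j \<Rightarrow> 'q) set \<Rightarrow> ('j \<Rightarrow> 'y) set" where
  "preimage A Z = {x \<in> A \<rightarrow>\<^sub>E Y. compose A \<kappa> x \<in> Z}"

definition kernel_pairs :: "'j set \<Rightarrow> ('j + 'j \<Rightarrow> 'y) set" where
  "kernel_pairs A = {w \<in> A <+> A \<rightarrow>\<^sub>E Y. compose A \<kappa> (compose A w Inl) = compose A \<kappa> (compose A w Inr)}"

lemma compose_equivariant:
  "g \<in> flow_group \<Phi> \<Longrightarrow> x \<in> A \<rightarrow>\<^sub>E Y \<Longrightarrow>
    compose A (flow_act \<Psi> g) (compose A \<kappa> x) = compose A \<kappa> (compose A (flow_act \<Phi> g) x)"
  using equivariant by (auto simp: compose_def fun_eq_iff)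

lemma image_preimage:
  assumes "Z \<subseteq> A \<rightarrow>\<^sub>E factor.Y"
  shows "compose A \<kappa> ` preimage A Z = Z"
proof (intro subset_antisym subsetI)
  fix q assume q: "q \<in> Z"
  then have "q \<in> compose A \<kappa> ` (A \<rightarrow>\<^sub>E Y)"
    using assms compose_image_PiE[OF onto, of A] by auto
  then show "q \<in> compose A \<kappa> ` preimage A Z"
    using q by (auto simp: preimage_def)
qed (auto simp: preimage_def)

lemma closed_invariant_preimage:
  assumes Z: "closed_invariant \<Psi> A Z"
  shows "closed_invariant \<Phi> A (preimage A Z)"
  unfolding closed_invariant_def
proof (intro conjI ballI)
  show "closedin (flow_power \<Phi> A) (preimage A Z)"
    using closedin_continuous_map_preimage[OF continuous_map_compose_left[OF continuous]
        closed_invariant_closedin[OF Z]]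
    by (simp add: preimage_def)
  fix g x assume g: "g \<in> flow_group \<Phi>" and "x \<in> preimage A Z"
  then have x: "x \<in> A \<rightarrow>\<^sub>E Y" "compose A \<kappa> x \<in> Z"
    by (simp_all add: preimage_def)
  have "compose A (flow_act \<Psi> g) (compose A \<kappa> x) \<in> Z"
    using closed_invariant_act[OF Z _ x(2)] g flow_group_eq by simp
  then have "compose A \<kappa> (compose A (flow_act \<Phi> g) x) \<in> Z"
    unfolding compose_equivariant[OF g x(1)] .
  then show "compose A (flow_act \<Phi> g) x \<in> preimage A Z"
    using compose_act_PiE[OF g x(1)] by (simp add: preimage_def)
qed

lemma closed_invariant_image:
  assumes W: "closed_invariant \<Phi> A W"
  shows "closed_invariant \<Psi> A (compose A \<kappa> ` W)"
  unfolding closed_invariant_def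
proof (intro conjI ballI)
  show "closedin (flow_power \<Psi> A) (compose A \<kappa> ` W)"
    using continuous_imp_closed_map[OF continuous_map_compose_left[OF continuous] compact_power
        factor.Hausdorff_power] closed_invariant_closedin[OF W]
    unfolding closed_map_def by blast
  fix g x assume g: "g \<in> flow_group \<Psi>" and "x \<in> compose A \<kappa> ` W"
  then obtain w where w: "w \<in> W" "x = compose A \<kappa> w"
    by blast
  then have "compose A (flow_act \<Psi> g) x = compose A \<kappa> (compose A (flow_act \<Phi> g) w)"
    using g closed_invariant_subset[OF W] flow_group_eq by (simp add: compose_equivariant subsetD)
  then show "compose A (flow_act \<Psi> g) x \<in> compose A \<kappa> ` W"
    using closed_invariant_act[OF W _ w(1)] g flow_group_eq by simp
qed

lemma closed_invariant_kernel_pairs: "closed_invariant \<Phi> (A <+> A) (kernel_pairs A)"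
  unfolding closed_invariant_def
proof (intro conjI ballI)
  have "continuous_map (flow_power \<Phi> (A <+> A)) (flow_power \<Psi> A) (\<lambda>w. compose A \<kappa> (compose A w s))"
    if "s \<in> A \<rightarrow> A <+> A" for s
    using continuous_map_compose[OF continuous_map_compose_right[OF that]
        continuous_map_compose_left[OF continuous]]
    by (simp add: o_def)
  then have "closedin (flow_power \<Phi> (A <+> A)) {w \<in> topspace (flow_power \<Phi> (A <+> A)).
      compose A \<kappa> (compose A w Inl) = compose A \<kappa> (compose A w Inr)}"
    by (intro closedin_continuous_maps_eq[OF factor.Hausdorff_power]) auto
  then show "closedin (flow_power \<Phi> (A <+> A)) (kernel_pairs A)"
    by (simp add: kernel_pairs_def)
  fix g w assume g: "g \<in> flow_group \<Phi>" and "w \<in> kernel_pairs A"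
  then have w: "w \<in> A <+> A \<rightarrow>\<^sub>E Y" "compose A \<kappa> (compose A w Inl) = compose A \<kappa> (compose A w Inr)"
    by (simp_all add: kernel_pairs_def)
  have "compose A \<kappa> (compose A (compose (A <+> A) (flow_act \<Phi> g) w) s) =
      compose A (flow_act \<Psi> g) (compose A \<kappa> (compose A w s))" if s: "s \<in> A \<rightarrow> A <+> A" for s
    unfolding compose_assoc[OF s, symmetric]
    by (rule compose_equivariant[OF g compose_mem_PiE_right[OF w(1) s], symmetric])
  then show "compose (A <+> A) (flow_act \<Phi> g) w \<in> kernel_pairs A"
    using w(2) compose_act_PiE[OF g w(1)] by (simp add: kernel_pairs_def InlI InrI)
qed

lemma preimage_image_eq:
  assumes "W \<subseteq> A \<rightarrow>\<^sub>E Y"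
  shows "preimage A (compose A \<kappa> ` W) = (\<lambda>w. compose A w Inr) ` (kernel_pairs A \<inter> pairings A W (A \<rightarrow>\<^sub>E Y))"
    (is "_ = ?R")
proof (intro subset_antisym subsetI)
  fix y assume "y \<in> preimage A (compose A \<kappa> ` W)"
  then obtain x where xy: "y \<in> A \<rightarrow>\<^sub>E Y" "x \<in> W" "compose A \<kappa> y = compose A \<kappa> x"
    by (auto simp: preimage_def)
  then have x: "x \<in> A \<rightarrow>\<^sub>E Y"
    using assms by blast
  have "x \<in> extensional A" "y \<in> extensional A"
    using x xy(1) by (simp_all add: PiE_def)
  then have "pairing A x y \<in> kernel_pairs A" "compose A (pairing A x y) Inr = y"
    using pairing_mem_PiE[OF x xy(1)] xy(3) by (simp_all add: kernel_pairs_def)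
  then show "y \<in> ?R"
    using pairing_mem_pairings[OF xy(2,1), of A] by force
next
  fix y assume "y \<in> ?R"
  then obtain w where w: "w \<in> kernel_pairs A" "w \<in> pairings A W (A \<rightarrow>\<^sub>E Y)" "y = compose A w Inr"
    by blast
  then have "compose A w Inl \<in> W" "compose A w Inr \<in> A \<rightarrow>\<^sub>E Y"
    using pairings_eq[OF assms subset_refl] by blast+
  then show "y \<in> preimage A (compose A \<kappa> ` W)"
    using w(1,3) by (auto simp: preimage_def kernel_pairs_def intro: image_eqI[OF sym])
qed

end

locale compatible_factors =
  base: flow_factor \<Phi> \<Psi> \<kappa> + ext: flow_factor \<Phi>' \<Psi>' \<kappa>'
  for \<Phi> :: "('g, 'y) flow" and \<Psi> :: "('g, 'q) flow" and \<kappa>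
    and \<Phi>' :: "('h, 'w) flow" and \<Psi>' :: "('h, 'v) flow" and \<kappa>' +
  fixes r :: "'w \<Rightarrow> 'y" and \<rho> :: "'v \<Rightarrow> 'q"
  assumes r_onto: "r ` flow_carrier \<Phi>' = flow_carrier \<Phi>"
    and commute: "y \<in> flow_carrier \<Phi>' \<Longrightarrow> \<rho> (\<kappa>' y) = \<kappa> (r y)"
    and compatible: "a \<in> flow_carrier \<Phi> \<Longrightarrow> b \<in> flow_carrier \<Phi> \<Longrightarrow> \<kappa> a = \<kappa> b \<Longrightarrow>
      \<exists>a'\<in>flow_carrier \<Phi>'. \<exists>b'\<in>flow_carrier \<Phi>'. \<kappa>' a' = \<kappa>' b' \<and> r a' = a \<and> r b' = b"
begin

lemma compose_commute:
  "x \<in> A \<rightarrow>\<^sub>E ext.Y \<Longrightarrow> compose A \<rho> (compose A \<kappa>' x) = compose A \<kappa> (compose A r x)"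
  using commute by (auto simp: compose_def fun_eq_iff)

lemma image_commute:
  assumes "W \<subseteq> A \<rightarrow>\<^sub>E ext.Y"
  shows "compose A \<rho> ` compose A \<kappa>' ` W = compose A \<kappa> ` compose A r ` W"
  unfolding image_image using assms by (intro image_cong refl compose_commute) blast

lemma image_kernel_pairs_subset:
  "compose (A <+> A) r ` ext.kernel_pairs A \<subseteq> base.kernel_pairs A"
proof clarify
  fix w assume "w \<in> ext.kernel_pairs A"
  then have w: "w \<in> A <+> A \<rightarrow>\<^sub>E ext.Y" "compose A \<kappa>' (compose A w Inl) = compose A \<kappa>' (compose A w Inr)"
    by (simp_all add: ext.kernel_pairs_def)
  have parts: "compose A w Inl \<in> A \<rightarrow>\<^sub>E ext.Y" "compose A w Inr \<in> A \<rightarrow>\<^sub>E ext.Y"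
    by (rule compose_mem_PiE_right[OF w(1)], force)+
  have "compose A \<kappa> (compose A r (compose A w Inl)) = compose A \<kappa> (compose A r (compose A w Inr))"
    using w(2) compose_commute[OF parts(1)] compose_commute[OF parts(2)] by simp
  moreover have "compose A (compose (A <+> A) r w) s = compose A r (compose A w s)" if "s \<in> A \<rightarrow> A <+> A" for s
    by (rule compose_assoc[OF that, symmetric])
  moreover have "compose (A <+> A) r w \<in> A <+> A \<rightarrow>\<^sub>E base.Y"
    using w(1) r_onto by (intro compose_mem_PiE) auto
  ultimately show "compose (A <+> A) r w \<in> base.kernel_pairs A"
    by (simp add: base.kernel_pairs_def InlI InrI)
qed

lemma kernel_pairs_subset_image:
  "base.kernel_pairs A \<subseteq> compose (A <+> A) r ` ext.kernel_pairs A"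
proof
  fix w assume "w \<in> base.kernel_pairs A"
  then have w: "w \<in> A <+> A \<rightarrow>\<^sub>E base.Y" "compose A \<kappa> (compose A w Inl) = compose A \<kappa> (compose A w Inr)"
    by (simp_all add: base.kernel_pairs_def)
  have "\<exists>a' b'. a' \<in> ext.Y \<and> b' \<in> ext.Y \<and> \<kappa>' a' = \<kappa>' b' \<and> r a' = w (Inl i) \<and> r b' = w (Inr i)"
    if "i \<in> A" for i
    using compatible[of "w (Inl i)" "w (Inr i)"] w(1) fun_cong[OF w(2), of i] that
    by (auto simp: compose_eq)
  then obtain f g where fg: "\<And>i. i \<in> A \<Longrightarrow> f i \<in> ext.Y \<and> g i \<in> ext.Y \<and> \<kappa>' (f i) = \<kappa>' (g i) \<and>
      r (f i) = w (Inl i) \<and> r (g i) = w (Inr i)"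
    by metis
  let ?w = "pairing A f g"
  have "?w \<in> ext.kernel_pairs A"
    using fg by (auto simp: ext.kernel_pairs_def pairing_def compose_def fun_eq_iff)
  moreover have "compose (A <+> A) r ?w = w"
    using fg w(1) by (intro extensionalityI[of _ "A <+> A"]) (auto simp: compose_eq PiE_def)
  ultimately show "w \<in> compose (A <+> A) r ` ext.kernel_pairs A"
    by blast
qed

lemma image_kernel_pairs: "compose (A <+> A) r ` ext.kernel_pairs A = base.kernel_pairs A"
  using image_kernel_pairs_subset kernel_pairs_subset_image by (rule subset_antisym)

lemma preimage_image_commute:
  assumes iso: "closed_invariant_iso \<Phi>' \<Phi> r (A <+> A)" and W: "closed_invariant \<Phi>' A W"
  shows "base.preimage A (compose A \<kappa> ` compose A r ` W) = compose A r ` ext.preimage A (compose A \<kappa>' ` W)"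
proof -
  let ?r = "compose (A <+> A) r" and ?right = "\<lambda>w. compose A w Inr"
  have W': "W \<subseteq> A \<rightarrow>\<^sub>E ext.Y"
    by (rule closed_invariant_subset[OF W])
  then have rW: "compose A r ` W \<subseteq> A \<rightarrow>\<^sub>E base.Y"
    unfolding compose_image_PiE[OF r_onto, symmetric] by (rule image_mono)
  have pairs: "closed_invariant \<Phi>' (A <+> A) (pairings A W (A \<rightarrow>\<^sub>E ext.Y))"
    by (rule ext.closed_invariant_pairings[OF W ext.closed_invariant_carrier])
  have "base.preimage A (compose A \<kappa> ` compose A r ` W) =
      ?right ` (base.kernel_pairs A \<inter> pairings A (compose A r ` W) (A \<rightarrow>\<^sub>E base.Y))"
    by (rule base.preimage_image_eq[OF rW])
  also have "\<dots> = ?right ` (?r ` ext.kernel_pairs A \<inter> ?r ` pairings A W (A \<rightarrow>\<^sub>E ext.Y))"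
    by (simp only: image_kernel_pairs image_pairings compose_image_PiE[OF r_onto])
  also have "\<dots> = ?right ` ?r ` (ext.kernel_pairs A \<inter> pairings A W (A \<rightarrow>\<^sub>E ext.Y))"
    by (simp only: closed_invariant_iso_image_Int[OF iso ext.closed_invariant_kernel_pairs pairs])
  also have "\<dots> = compose A r ` ?right ` (ext.kernel_pairs A \<inter> pairings A W (A \<rightarrow>\<^sub>E ext.Y))"
    unfolding image_image by (intro image_cong refl compose_assoc[symmetric]) auto
  also have "\<dots> = compose A r ` ext.preimage A (compose A \<kappa>' ` W)"
    by (simp only: ext.preimage_image_eq[OF W'])
  finally show ?thesis .
qed

lemma image_preimage_commute:
  assumes "closed_invariant \<Psi>' A Z"
  shows "compose A \<rho> ` Z = compose A \<kappa> ` compose A r ` ext.preimage A Z"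
proof -
  have "ext.preimage A Z \<subseteq> A \<rightarrow>\<^sub>E ext.Y"
    by (auto simp: ext.preimage_def)
  then show ?thesis
    using image_commute ext.image_preimage[OF closed_invariant_subset[OF assms]] by metis
qed

lemma subset_if_image_subset:
  assumes iso: "closed_invariant_iso \<Phi>' \<Phi> r A" and iso_pairs: "closed_invariant_iso \<Phi>' \<Phi> r (A <+> A)"
    and Z: "closed_invariant \<Psi>' A Z" and W: "closed_invariant \<Psi>' A W"
    and subset: "compose A \<rho> ` Z \<subseteq> compose A \<rho> ` W"
  shows "Z \<subseteq> W"
proof -
  note pre = ext.closed_invariant_preimage
  have "compose A r ` ext.preimage A Z \<subseteq> base.preimage A (compose A \<kappa> ` compose A r ` ext.preimage A W)"
    using subset closed_invariant_subset[OF closed_invariant_iso_image[OF iso pre[OF Z]]]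
    unfolding image_preimage_commute[OF Z] image_preimage_commute[OF W]
    by (auto simp: base.preimage_def)
  also have "\<dots> = compose A r ` ext.preimage A W"
    unfolding preimage_image_commute[OF iso_pairs pre[OF W]]
    by (simp only: ext.image_preimage[OF closed_invariant_subset[OF W]])
  finally have "ext.preimage A Z \<subseteq> ext.preimage A W"
    by (rule closed_invariant_iso_subset[OF iso pre[OF Z] pre[OF W]])
  then show ?thesis
    using ext.image_preimage[OF closed_invariant_subset[OF Z]]
      ext.image_preimage[OF closed_invariant_subset[OF W]] by blast
qed

theorem closed_invariant_iso_factor:
  assumes iso: "closed_invariant_iso \<Phi>' \<Phi> r A" and iso_pairs: "closed_invariant_iso \<Phi>' \<Phi> r (A <+> A)"
  shows "closed_invariant_iso \<Psi>' \<Psi> \<rho> A"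
  unfolding closed_invariant_iso_def
proof (intro conjI allI impI subset_antisym subsetI)
  fix X assume "X \<in> (`) (compose A \<rho>) ` Collect (closed_invariant \<Psi>' A)"
  then obtain Z where Z: "closed_invariant \<Psi>' A Z" "X = compose A \<rho> ` Z"
    by blast
  have "closed_invariant \<Phi> A (compose A r ` ext.preimage A Z)"
    by (rule closed_invariant_iso_image[OF iso ext.closed_invariant_preimage[OF Z(1)]])
  from base.closed_invariant_image[OF this] show "X \<in> Collect (closed_invariant \<Psi> A)"
    by (simp add: Z image_preimage_commute)
next
  fix X assume "X \<in> Collect (closed_invariant \<Psi> A)"
  then have X: "closed_invariant \<Psi> A X"
    by simp
  obtain W where W: "closed_invariant \<Phi>' A W" "compose A r ` W = base.preimage A X"
    using closed_invariant_iso_lift[OF iso base.closed_invariant_preimage[OF X]] .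
  have "compose A \<rho> ` compose A \<kappa>' ` W = X"
    using image_commute[OF closed_invariant_subset[OF W(1)]]
      base.image_preimage[OF closed_invariant_subset[OF X]] W(2) by simp
  then show "X \<in> (`) (compose A \<rho>) ` Collect (closed_invariant \<Psi>' A)"
    using ext.closed_invariant_image[OF W(1)] by blast
qed (use subset_if_image_subset[OF iso iso_pairs] in blast)

end

section \<open>Quotient flows\<close>

definition flow_congruence :: "('g, 'y) flow \<Rightarrow> 'y rel \<Rightarrow> bool" where
  "flow_congruence \<Phi> R \<longleftrightarrow> equiv (flow_carrier \<Phi>) R \<and>
     closedin (prod_topology (flow_space \<Phi>) (flow_space \<Phi>)) R \<and>
     (\<forall>g\<in>flow_group \<Phi>. \<forall>(x, y)\<in>R. (flow_act \<Phi> g x, flow_act \<Phi> g y) \<in> R)"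

definition quotient_flow :: "('g, 'y) flow \<Rightarrow> 'y rel \<Rightarrow> ('g, 'y set) flow" where
  "quotient_flow \<Phi> R = \<lparr>flow_group = flow_group \<Phi>, flow_space = quotient_topology (flow_space \<Phi>) R,
     flow_act = (\<lambda>g c. flow_act \<Phi> g ` c)\<rparr>"

lemma quotient_flow_simps [simp]:
  "flow_group (quotient_flow \<Phi> R) = flow_group \<Phi>"
  "flow_space (quotient_flow \<Phi> R) = quotient_topology (flow_space \<Phi>) R"
  "flow_act (quotient_flow \<Phi> R) g c = flow_act \<Phi> g ` c"
  by (simp_all add: quotient_flow_def)

lemma flow_carrier_quotient_flow [simp]: "flow_carrier (quotient_flow \<Phi> R) = flow_carrier \<Phi> // R"
  by (simp only: flow_carrier_def quotient_flow_simps topspace_quotient_topology)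

lemma ball_quotient_iff: "(\<forall>c\<in>A // R. P c) \<longleftrightarrow> (\<forall>x\<in>A. P (R `` {x}))"
  by (auto simp: quotient_def)

context compact_flow
begin

lemma image_class:
  assumes R: "flow_congruence \<Phi> R" and g: "g \<in> flow_group \<Phi>" and y: "y \<in> Y"
  shows "flow_act \<Phi> g ` (R `` {y}) = R `` {flow_act \<Phi> g y}"
proof
  show "flow_act \<Phi> g ` (R `` {y}) \<subseteq> R `` {flow_act \<Phi> g y}"
    using R g by (auto simp: flow_congruence_def)
  obtain k where k: "k \<in> flow_group \<Phi>"
    and inverse: "\<And>y. y \<in> Y \<Longrightarrow> flow_act \<Phi> k (flow_act \<Phi> g y) = y \<and> flow_act \<Phi> g (flow_act \<Phi> k y) = y"
    using act_inverse[OF g] by blast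
  show "R `` {flow_act \<Phi> g y} \<subseteq> flow_act \<Phi> g ` (R `` {y})"
  proof clarify
    fix x assume x: "(flow_act \<Phi> g y, x) \<in> R"
    then have "(flow_act \<Phi> k (flow_act \<Phi> g y), flow_act \<Phi> k x) \<in> R"
      using R k by (auto simp: flow_congruence_def)
    moreover have "x \<in> Y"
      using R x by (auto simp: flow_congruence_def equiv_def refl_on_def)
    ultimately have "flow_act \<Phi> k x \<in> R `` {y}" "x = flow_act \<Phi> g (flow_act \<Phi> k x)"
      using inverse y by auto
    then show "x \<in> flow_act \<Phi> g ` (R `` {y})"
      by blast
  qed
qed

lemma continuous_map_quotient_act:
  assumes R: "flow_congruence \<Phi> R" and g: "g \<in> flow_group \<Phi>"
  shows "continuous_map (flow_space (quotient_flow \<Phi> R)) (flow_space (quotient_flow \<Phi> R))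
    (flow_act (quotient_flow \<Phi> R) g)"
proof -
  have "continuous_map (flow_space \<Phi>) (quotient_topology (flow_space \<Phi>) R) (\<lambda>y. R `` {flow_act \<Phi> g y})"
    using continuous_map_compose[OF continuous_act[OF g] continuous_map_quotient_topology]
    by (simp add: o_def)
  then have "continuous_map (flow_space \<Phi>) (quotient_topology (flow_space \<Phi>) R)
      (image (flow_act \<Phi> g) \<circ> (\<lambda>y. R `` {y}))"
    by (rule continuous_map_eq) (simp add: image_class[OF R g])
  then show ?thesis
    using continuous_compose_quotient_map[OF quotient_map_quotient_topology] by (simp add: quotient_flow_def)
qed

lemma compact_flow_quotient:
  assumes R: "flow_congruence \<Phi> R"
  shows "compact_flow (quotient_flow \<Phi> R)" (is "compact_flow ?Q")
proof
  have "topspace (quotient_topology (flow_space \<Phi>) R) = (\<lambda>y. R `` {y}) ` topspace (flow_space \<Phi>)"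
    using quotient_imp_surjective_map[OF quotient_map_quotient_topology] by metis
  then show "compact_space (flow_space ?Q)"
    using image_compactin[OF compact[unfolded compact_space_def] continuous_map_quotient_topology]
    by (simp add: compact_space_def)
  show "Hausdorff_space (flow_space ?Q)"
    using R compact Hausdorff by (simp add: Hausdorff_space_quotient_topology flow_congruence_def)
  show "continuous_map (flow_space ?Q) (flow_space ?Q) (flow_act ?Q g)" if "g \<in> flow_group ?Q" for g
    using continuous_map_quotient_act[OF R] that by simp
  obtain e where "e \<in> flow_group \<Phi>" "\<forall>y\<in>Y. flow_act \<Phi> e y = y"
    using act_one by blast
  then show "\<exists>e\<in>flow_group ?Q. \<forall>c\<in>flow_carrier ?Q. flow_act ?Q e c = c"
    by (auto simp: ball_quotient_iff image_class[OF R] intro!: bexI[of _ e])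
next
  fix g h assume "g \<in> flow_group ?Q" "h \<in> flow_group ?Q"
  then have gh: "g \<in> flow_group \<Phi>" "h \<in> flow_group \<Phi>"
    by simp_all
  then obtain k where "k \<in> flow_group \<Phi>" "\<forall>y\<in>Y. flow_act \<Phi> k y = flow_act \<Phi> g (flow_act \<Phi> h y)"
    using act_mult by blast
  then show "\<exists>k\<in>flow_group ?Q. \<forall>c\<in>flow_carrier ?Q. flow_act ?Q k c = flow_act ?Q g (flow_act ?Q h c)"
    using gh act_funcset by (auto simp: ball_quotient_iff image_class[OF R] Pi_iff intro!: bexI[of _ k])
next
  fix g assume "g \<in> flow_group ?Q"
  then have g: "g \<in> flow_group \<Phi>"
    by simp
  then obtain k where "k \<in> flow_group \<Phi>"
    "\<forall>y\<in>Y. flow_act \<Phi> k (flow_act \<Phi> g y) = y \<and> flow_act \<Phi> g (flow_act \<Phi> k y) = y"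
    using act_inverse by blast
  then show "\<exists>k\<in>flow_group ?Q. \<forall>c\<in>flow_carrier ?Q.
      flow_act ?Q k (flow_act ?Q g c) = c \<and> flow_act ?Q g (flow_act ?Q k c) = c"
    using g act_funcset by (auto simp: ball_quotient_iff image_class[OF R] Pi_iff intro!: bexI[of _ k])
qed

lemma flow_factor_quotient:
  assumes R: "flow_congruence \<Phi> R"
  shows "flow_factor \<Phi> (quotient_flow \<Phi> R) (\<lambda>y. R `` {y})"
proof (intro flow_factor.intro flow_factor_axioms.intro compact_flow_axioms compact_flow_quotient[OF R])
  show "continuous_map (flow_space \<Phi>) (flow_space (quotient_flow \<Phi> R)) (\<lambda>y. R `` {y})"
    by (simp add: continuous_map_quotient_topology)
  show "(\<lambda>y. R `` {y}) ` Y = flow_carrier (quotient_flow \<Phi> R)"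
    by (auto simp: quotient_def)
qed (simp_all add: image_class[OF R])

end

lemma closed_invariant_iso_quotient:
  assumes flows: "compact_flow \<Phi>" "compact_flow \<Phi>'"
    and R: "flow_congruence \<Phi> R" "flow_congruence \<Phi>' R'"
    and r_onto: "r ` flow_carrier \<Phi>' = flow_carrier \<Phi>"
    and compatible: "{(r a, r b) |a b. (a, b) \<in> R'} = R"
    and iso: "closed_invariant_iso \<Phi>' \<Phi> r A" "closed_invariant_iso \<Phi>' \<Phi> r (A <+> A)"
  shows "closed_invariant_iso (quotient_flow \<Phi>' R') (quotient_flow \<Phi> R) (\<lambda>c. R `` (r ` c)) A"
proof -
  have equiv: "equiv (flow_carrier \<Phi>) R" "equiv (flow_carrier \<Phi>') R'"
    using R by (simp_all add: flow_congruence_def)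
  have "compatible_factors \<Phi> (quotient_flow \<Phi> R) (\<lambda>y. R `` {y})
      \<Phi>' (quotient_flow \<Phi>' R') (\<lambda>y. R' `` {y}) r (\<lambda>c. R `` (r ` c))"
  proof (intro compatible_factors.intro compatible_factors_axioms.intro r_onto
      compact_flow.flow_factor_quotient flows R)
    fix y assume y: "y \<in> flow_carrier \<Phi>'"
    have "R `` {r x} = R `` {r y}" if "(y, x) \<in> R'" for x
    proof -
      have "(r y, r x) \<in> R"
        using compatible that by blast
      from equiv_class_eq[OF equiv(1) this] show ?thesis ..
    qed
    moreover have "(y, y) \<in> R'"
      using equiv(2) y by (auto simp: equiv_def refl_on_def)
    ultimately show "R `` (r ` (R' `` {y})) = R `` {r y}"
      by blast
  next
    fix a b assume ab: "a \<in> flow_carrier \<Phi>" "b \<in> flow_carrier \<Phi>" "R `` {a} = R `` {b}"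
    have "(a, b) \<in> R"
      by (rule eq_equiv_class[OF ab(3) equiv(1) ab(2)])
    then obtain a' b' where ab': "(a', b') \<in> R'" "r a' = a" "r b' = b"
      using compatible by blast
    have "R' `` {a'} = R' `` {b'}"
      by (rule equiv_class_eq[OF equiv(2) ab'(1)])
    moreover have "a' \<in> flow_carrier \<Phi>'" "b' \<in> flow_carrier \<Phi>'"
      using equiv(2) ab'(1) by (auto simp: equiv_def refl_on_def)
    ultimately show "\<exists>a'\<in>flow_carrier \<Phi>'. \<exists>b'\<in>flow_carrier \<Phi>'. R' `` {a'} = R' `` {b'} \<and> r a' = a \<and> r b' = b"
      using ab'(2,3) by blast
  qed
  then show ?thesis
    using iso by (rule compatible_factors.closed_invariant_iso_factor)
qed

section \<open>Formulas\<close>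

lemma teval_rename: "teval M v e (trename w t) = teval M (\<lambda>x. v (w x)) e t"
proof (induction t)
  case (Fn f ts)
  have "map (teval M v e \<circ> trename w) ts = map (teval M (\<lambda>x. v (w x)) e) ts"
    by (intro map_cong refl) (simp only: o_apply Fn.IH)
  then show ?case
    by (simp only: tm.map teval.simps list.map_comp)
qed simp_all

lemma sat_rename: "sat M v e (rename w \<phi>) \<longleftrightarrow> sat M (\<lambda>x. v (w x)) e \<phi>"
proof (induction \<phi> arbitrary: e)
  case (Rel P ts)
  have "map (teval M v e \<circ> trename w) ts = map (teval M (\<lambda>x. v (w x)) e) ts"
    by (simp add: teval_rename)
  then show ?case
    by (simp only: fm.map sat.simps list.map_comp)
qed (simp_all add: teval_rename)

lemma holds_rename: "holds M v (rename w \<phi>) \<longleftrightarrow> holds M (v \<circ> w) \<phi>"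
  by (simp add: holds_def sat_rename o_def)

lemma teval_cong:
  "(\<And>x. x \<in> tatoms t \<Longrightarrow> v x = v' x) \<Longrightarrow> (\<And>n. n \<in> bvars_tm t \<Longrightarrow> e n = e' n) \<Longrightarrow>
    teval M v e t = teval M v' e' t"
proof (induction t)
  case (Fn f ts)
  have "map (teval M v e) ts = map (teval M v' e') ts"
    by (intro map_cong refl Fn.IH) (use Fn.prems in auto)
  then show ?case
    by (simp only: teval.simps)
qed simp_all

lemma sat_cong:
  "(\<And>x. x \<in> atoms \<phi> \<Longrightarrow> v x = v' x) \<Longrightarrow> (\<And>n. n \<in> unbound \<phi> \<Longrightarrow> e n = e' n) \<Longrightarrow>
    sat M v e \<phi> \<longleftrightarrow> sat M v' e' \<phi>"
proof (induction \<phi> arbitrary: e e')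
  case (Eq s t)
  then show ?case
    using teval_cong[of s v v' e e' M] teval_cong[of t v v' e e' M] by simp
next
  case (Rel P ts)
  have "map (teval M v e) ts = map (teval M v' e') ts"
    by (intro map_cong refl teval_cong) (use Rel.prems in auto)
  then show ?case
    by (simp only: sat.simps)
next
  case (Neg \<phi>)
  then show ?case by simp
next
  case (Conj \<phi> \<psi>)
  have "sat M v e \<phi> \<longleftrightarrow> sat M v' e' \<phi>" "sat M v e \<psi> \<longleftrightarrow> sat M v' e' \<psi>"
    using Conj.prems by (auto intro!: Conj.IH)
  then show ?case by simp
next
  case (Ex n \<phi>)
  have "sat M v (e(n := d)) \<phi> \<longleftrightarrow> sat M v' (e'(n := d)) \<phi>" for d
    using Ex.prems by (intro Ex.IH) auto
  then show ?case by simp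
qed

lemma holds_cong:
  "\<phi> \<in> fmls L V \<Longrightarrow> (\<And>x. x \<in> V \<Longrightarrow> v x = v' x) \<Longrightarrow> holds M v \<phi> \<longleftrightarrow> holds M v' \<phi>"
  unfolding holds_def by (intro sat_cong) (auto simp: fmls_def)

lemma sat_eq_holds: "\<phi> \<in> fmls L V \<Longrightarrow> sat M v e \<phi> \<longleftrightarrow> holds M v \<phi>"
  unfolding holds_def by (intro sat_cong) (auto simp: fmls_def)

lemma holds_Neg [simp]: "holds M v (Neg \<phi>) \<longleftrightarrow> \<not> holds M v \<phi>"
  and holds_Conj [simp]: "holds M v (Conj \<phi> \<psi>) \<longleftrightarrow> holds M v \<phi> \<and> holds M v \<psi>"
  by (simp_all add: holds_def)

lemma wf_tm_rename [simp]: "wf_tm L (trename w t) \<longleftrightarrow> wf_tm L t"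
  by (induction t) auto

lemma wf_fm_rename [simp]: "wf_fm L (rename w \<phi>) \<longleftrightarrow> wf_fm L \<phi>"
  by (induction \<phi>) auto

lemma bvars_tm_rename [simp]: "bvars_tm (trename w t) = bvars_tm t"
  by (induction t) auto

lemma unbound_rename [simp]: "unbound (rename w \<phi>) = unbound \<phi>"
  by (induction \<phi>) auto

lemma rename_fmls: "\<phi> \<in> fmls L V \<Longrightarrow> w ` V \<subseteq> V' \<Longrightarrow> rename w \<phi> \<in> fmls L V'"
  by (auto simp: fmls_def fm.set_map)

lemma rename_mem_fmls_iff:
  assumes "\<phi> \<in> fmls L V" "inj_on w V" "U \<subseteq> V"
  shows "rename w \<phi> \<in> fmls L (w ` U) \<longleftrightarrow> \<phi> \<in> fmls L U"
proof -
  have "w ` atoms \<phi> \<subseteq> w ` U \<longleftrightarrow> atoms \<phi> \<subseteq> U"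
    using assms by (intro inj_on_image_subset_iff[of w V]) (auto simp: fmls_def)
  then show ?thesis
    using assms(1) by (auto simp: fmls_def fm.set_map)
qed

lemma fmls_mono: "V \<subseteq> V' \<Longrightarrow> fmls L V \<subseteq> fmls L V'"
  by (auto simp: fmls_def)

lemma rename_cong: "\<phi> \<in> fmls L V \<Longrightarrow> (\<And>x. x \<in> V \<Longrightarrow> w x = w' x) \<Longrightarrow> rename w \<phi> = rename w' \<phi>"
  by (intro fm.map_cong refl) (auto simp: fmls_def)

lemma rename_idI: "\<phi> \<in> fmls L V \<Longrightarrow> (\<And>x. x \<in> V \<Longrightarrow> w x = x) \<Longrightarrow> rename w \<phi> = \<phi>"
  using rename_cong[of \<phi> L V w id] by (simp add: fm.map_id)

lemma Neg_mem_fmls [simp]: "Neg \<phi> \<in> fmls L V \<longleftrightarrow> \<phi> \<in> fmls L V"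
  and Conj_mem_fmls [simp]: "Conj \<phi> \<psi> \<in> fmls L V \<longleftrightarrow> \<phi> \<in> fmls L V \<and> \<psi> \<in> fmls L V"
  by (auto simp: fmls_def)

lemma finite_tatoms: "finite (tatoms t)"
  by (induction t) auto

lemma finite_atoms: "finite (atoms \<phi>)"
  by (induction \<phi>) (auto simp: finite_tatoms)

lemma finite_parameters:
  assumes "\<phi> \<in> fmls L (I <+> A)"
  obtains a where "finite a" "a \<subseteq> A" "\<phi> \<in> fmls L (I <+> a)"
proof
  show "finite (Inr -` atoms \<phi>)"
    by (rule finite_vimageI[OF finite_atoms]) (simp add: inj_on_def)
  show "Inr -` atoms \<phi> \<subseteq> A" "\<phi> \<in> fmls L (I <+> (Inr -` atoms \<phi>))"
    using assms by (auto simp: fmls_def)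
qed

lemma ex_conjunction:
  assumes "finite q" "q \<subseteq> fmls L V"
  shows "\<exists>\<xi>\<in>fmls L V. \<forall>(M :: ('f, 'p, 'a) struct) v. holds M v \<xi> \<longleftrightarrow> (\<forall>\<phi>\<in>q. holds M v \<phi>)"
  using assms
proof (induction q rule: finite_induct)
  case empty
  let ?t = "Ex 0 (Eq (BVar 0) (BVar 0)) :: ('f, 'p, 'c) fm"
  have "?t \<in> fmls L V" by (simp add: fmls_def)
  then show ?case by (intro bexI[of _ "Neg (Conj ?t (Neg ?t))"]) auto
next
  case (insert \<phi> q)
  then obtain \<xi> where "\<xi> \<in> fmls L V"
    "\<forall>(M :: ('f, 'p, 'a) struct) v. holds M v \<xi> \<longleftrightarrow> (\<forall>\<phi>\<in>q. holds M v \<phi>)"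
    by auto
  then show ?case
    using insert.prems by (intro bexI[of _ "Conj \<phi> \<xi>"]) auto
qed

fun bind_tm :: "'v \<Rightarrow> nat \<Rightarrow> ('f, 'v) tm \<Rightarrow> ('f, 'v) tm" where
  "bind_tm k n (BVar m) = BVar m"
| "bind_tm k n (Atom x) = (if x = k then BVar n else Atom x)"
| "bind_tm k n (Fn f ts) = Fn f (map (bind_tm k n) ts)"

fun bind_fm :: "'v \<Rightarrow> nat \<Rightarrow> ('f, 'p, 'v) fm \<Rightarrow> ('f, 'p, 'v) fm" where
  "bind_fm k n (Eq s t) = Eq (bind_tm k n s) (bind_tm k n t)"
| "bind_fm k n (Rel P ts) = Rel P (map (bind_tm k n) ts)"
| "bind_fm k n (Neg \<phi>) = Neg (bind_fm k n \<phi>)"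
| "bind_fm k n (Conj \<phi> \<psi>) = Conj (bind_fm k n \<phi>) (bind_fm k n \<psi>)"
| "bind_fm k n (Ex m \<phi>) = Ex m (bind_fm k n \<phi>)"

fun quantified :: "('f, 'p, 'v) fm \<Rightarrow> nat set" where
  "quantified (Neg \<phi>) = quantified \<phi>"
| "quantified (Conj \<phi> \<psi>) = quantified \<phi> \<union> quantified \<psi>"
| "quantified (Ex m \<phi>) = insert m (quantified \<phi>)"
| "quantified _ = {}"

lemma finite_quantified: "finite (quantified \<phi>)"
  by (induction \<phi> rule: quantified.induct) auto

lemma teval_bind: "teval M v e (bind_tm k n t) = teval M (v(k := e n)) e t"
proof (induction t)
  case (Fn f ts)
  have "map (teval M v e \<circ> bind_tm k n) ts = map (teval M (v(k := e n)) e) ts"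
    by (intro map_cong refl) (simp only: o_apply Fn.IH)
  then show ?case
    by (simp only: bind_tm.simps teval.simps list.map_comp)
qed simp_all

lemma sat_bind: "n \<notin> quantified \<phi> \<Longrightarrow> sat M v e (bind_fm k n \<phi>) \<longleftrightarrow> sat M (v(k := e n)) e \<phi>"
proof (induction \<phi> arbitrary: e)
  case (Rel P ts)
  have "map (teval M v e \<circ> bind_tm k n) ts = map (teval M (v(k := e n)) e) ts"
    by (simp add: teval_bind)
  then show ?case
    by (simp only: bind_fm.simps sat.simps list.map_comp)
qed (auto simp: teval_bind)

lemma wf_tm_bind: "wf_tm L (bind_tm k n t) \<longleftrightarrow> wf_tm L t"
  by (induction t) auto

lemma wf_fm_bind: "wf_fm L (bind_fm k n \<phi>) \<longleftrightarrow> wf_fm L \<phi>"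
  by (induction \<phi>) (auto simp: wf_tm_bind)

lemma tatoms_bind: "tatoms (bind_tm k n t) = tatoms t - {k}"
  by (induction t) auto

lemma atoms_bind: "atoms (bind_fm k n \<phi>) = atoms \<phi> - {k}"
  by (induction \<phi>) (auto simp: tatoms_bind)

lemma bvars_tm_bind: "bvars_tm (bind_tm k n t) \<subseteq> insert n (bvars_tm t)"
  by (induction t) auto

lemma unbound_bind: "unbound (bind_fm k n \<phi>) \<subseteq> insert n (unbound \<phi>)"
proof (induction \<phi>)
  case (Eq s t)
  then show ?case
    using bvars_tm_bind[of k n s] bvars_tm_bind[of k n t] by auto
next
  case (Rel P ts)
  then show ?case
    using bvars_tm_bind[of k n] by fastforce
qed auto

lemma ex_quantify_atom:
  assumes \<phi>: "\<phi> \<in> fmls L (insert k V)"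
  shows "\<exists>\<psi>\<in>fmls L V. \<forall>(M :: ('f, 'p, 'a) struct) v. holds M v \<psi> \<longleftrightarrow> (\<exists>d\<in>univ M. holds M (v(k := d)) \<phi>)"
proof -
  obtain n where n: "n \<notin> quantified \<phi>"
    using ex_new_if_finite[OF infinite_UNIV_nat finite_quantified] by blast
  have "Ex n (bind_fm k n \<phi>) \<in> fmls L V"
    using \<phi> unbound_bind[of k n \<phi>] by (auto simp: fmls_def wf_fm_bind atoms_bind)
  moreover have "holds M v (Ex n (bind_fm k n \<phi>)) \<longleftrightarrow> (\<exists>d\<in>univ M. holds M (v(k := d)) \<phi>)"
    for M :: "('f, 'p, 'a) struct" and v
    by (simp add: holds_def[of M v] sat_bind[OF n] sat_eq_holds[OF \<phi>])
  ultimately show ?thesis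
    by blast
qed

section \<open>Elementary substructures\<close>

lemma elementary_holds:
  assumes elementary: "elementary_substruct L C C'" and \<phi>: "\<phi> \<in> fmls L V" and v: "v ` V \<subseteq> univ C"
  shows "holds C v \<phi> \<longleftrightarrow> holds C' v \<phi>"
proof -
  have "holds C (\<lambda>a. a) (rename v \<phi>) \<longleftrightarrow> holds C' (\<lambda>a. a) (rename v \<phi>)"
    using elementary rename_fmls[OF \<phi> v] by (auto simp: elementary_substruct_def)
  then show ?thesis
    by (simp add: holds_rename o_def)
qed

lemma elementary_witnesses:
  fixes C C' :: "('f, 'p, 'a) struct"
  assumes elementary: "elementary_substruct L C C'" and "finite K"
    and "\<phi> \<in> fmls L (K \<union> V)" "v ` V \<subseteq> univ C" "v ` K \<subseteq> univ C'" "holds C' v \<phi>"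
  shows "\<exists>w. w ` K \<subseteq> univ C \<and> (\<forall>x. x \<notin> K \<longrightarrow> w x = v x) \<and> holds C w \<phi>"
  using assms(2-)
proof (induction K arbitrary: \<phi> rule: finite_induct)
  case empty
  then show ?case
    using elementary_holds[OF elementary, of \<phi> V v] by (intro exI[of _ v]) simp
next
  case (insert k K)
  obtain \<psi> where \<psi>: "\<psi> \<in> fmls L (K \<union> V)"
    and holds_\<psi>: "\<forall>(M :: ('f, 'p, 'a) struct) v. holds M v \<psi> \<longleftrightarrow> (\<exists>d\<in>univ M. holds M (v(k := d)) \<phi>)"
    using ex_quantify_atom[of \<phi> L k "K \<union> V"] insert.prems(1) by auto
  have "holds C' (v(k := v k)) \<phi>" "v k \<in> univ C'"
    using insert.prems by simp_all
  then have "holds C' v \<psi>"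
    using holds_\<psi> by blast
  then obtain w where w: "w ` K \<subseteq> univ C" "\<forall>x. x \<notin> K \<longrightarrow> w x = v x" "holds C w \<psi>"
    using insert.IH[OF \<psi>] insert.prems by auto
  then obtain d where "d \<in> univ C" "holds C (w(k := d)) \<phi>"
    using holds_\<psi> by blast
  moreover have "(w(k := d)) ` insert k K \<subseteq> univ C" "\<forall>x. x \<notin> insert k K \<longrightarrow> (w(k := d)) x = v x"
    using w(1,2) \<open>d \<in> univ C\<close> by auto
  ultimately show ?case
    by blast
qed

lemma realized_elementary_extension:
  assumes elementary: "elementary_substruct L C C'" and q: "q \<subseteq> fmls L (I <+> univ C)"
    and "realized C I q"
  shows "realized C' I q"
proof -
  obtain c where c: "c \<in> I \<rightarrow> univ C" "\<forall>\<phi>\<in>q. holds C (case_sum c (\<lambda>a. a)) \<phi>"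
    using assms(3) by (auto simp: realized_def)
  then have "case_sum c (\<lambda>a. a) ` (I <+> univ C) \<subseteq> univ C"
    by auto
  then have "holds C' (case_sum c (\<lambda>a. a)) \<phi>" if "\<phi> \<in> q" for \<phi>
    using elementary_holds[OF elementary subsetD[OF q that]] c(2) that by blast
  moreover have "c \<in> I \<rightarrow> univ C'"
    using c(1) elementary by (auto simp: elementary_substruct_def)
  ultimately show ?thesis
    by (auto simp: realized_def)
qed

lemma realized_elementary_substruct:
  fixes C C' :: "('f, 'p, 'a) struct"
  assumes elementary: "elementary_substruct L C C'" and nonempty: "univ C \<noteq> {}"
    and q: "finite q" "q \<subseteq> fmls L (I <+> univ C)" and "realized C' I q"
  shows "realized C I q"
proof -
  obtain \<xi> where \<xi>: "\<xi> \<in> fmls L (I <+> univ C)"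
    and holds_\<xi>: "\<forall>(M :: ('f, 'p, 'a) struct) v. holds M v \<xi> \<longleftrightarrow> (\<forall>\<phi>\<in>q. holds M v \<phi>)"
    using ex_conjunction[OF q] by blast
  obtain c where c: "c \<in> I \<rightarrow> univ C'" "\<forall>\<phi>\<in>q. holds C' (case_sum c (\<lambda>a. a)) \<phi>"
    using assms(5) by (auto simp: realized_def)
  define K where "K = atoms \<xi> \<inter> range Inl"
  have K: "finite K" "K \<subseteq> Inl ` I" "\<xi> \<in> fmls L (K \<union> Inr ` univ C)"
    using \<xi> by (auto simp: K_def finite_atoms fmls_def)
  have "case_sum c (\<lambda>a. a) ` Inl ` I \<subseteq> univ C'"
    using c(1) by auto
  then have "case_sum c (\<lambda>a. a) ` K \<subseteq> univ C'"
    using image_mono[OF K(2)] by (rule subset_trans[rotated])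
  moreover have "case_sum c (\<lambda>a. a) ` Inr ` univ C \<subseteq> univ C"
    by auto
  moreover have "holds C' (case_sum c (\<lambda>a. a)) \<xi>"
    using c(2) holds_\<xi> by simp
  ultimately have "\<exists>w. w ` K \<subseteq> univ C \<and> (\<forall>x. x \<notin> K \<longrightarrow> w x = case_sum c (\<lambda>a. a) x) \<and> holds C w \<xi>"
    by (intro elementary_witnesses[OF elementary K(1,3)])
  then obtain w where w: "w ` K \<subseteq> univ C" "\<And>x. x \<notin> K \<Longrightarrow> w x = case_sum c (\<lambda>a. a) x" "holds C w \<xi>"
    by blast
  obtain d where d: "d \<in> univ C"
    using nonempty by blast
  let ?c = "\<lambda>i. if Inl i \<in> K then w (Inl i) else d"
  have "w x = case_sum ?c (\<lambda>a. a) x" if "x \<in> K \<union> Inr ` univ C" for x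
    using that K(2) w(2)[of x] by (cases "x \<in> K") auto
  then have "holds C (case_sum ?c (\<lambda>a. a)) \<xi>"
    using w(3) holds_cong[OF K(3), of w "case_sum ?c (\<lambda>a. a)"] by simp
  moreover have "?c \<in> I \<rightarrow> univ C"
    using subsetD[OF w(1)] d by auto
  ultimately show ?thesis
    using holds_\<xi> by (auto simp: realized_def)
qed

section \<open>Automorphisms\<close>

lemma Aut_bij: "\<sigma> \<in> Aut L M \<Longrightarrow> bij_betw \<sigma> (univ M) (univ M)"
  by (auto simp: Aut_def Bij_def)

lemma Aut_inj: "\<sigma> \<in> Aut L M \<Longrightarrow> inj_on \<sigma> (univ M)"
  by (rule bij_betw_imp_inj_on[OF Aut_bij])

lemma Aut_image: "\<sigma> \<in> Aut L M \<Longrightarrow> \<sigma> ` univ M = univ M"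
  by (rule bij_betw_imp_surj_on[OF Aut_bij])

lemma Aut_closed: "\<sigma> \<in> Aut L M \<Longrightarrow> a \<in> univ M \<Longrightarrow> \<sigma> a \<in> univ M"
  using Aut_image by blast

lemma map_tuples: "f \<in> univ M \<rightarrow> univ N \<Longrightarrow> xs \<in> tuples M n \<Longrightarrow> map f xs \<in> tuples N n"
  by (auto simp: tuples_def)

lemma AutI:
  assumes "\<sigma> \<in> Bij (univ M)"
    and "\<And>f xs. f \<in> fsyms L \<Longrightarrow> xs \<in> tuples M (farity L f) \<Longrightarrow> \<sigma> (fint M f xs) = fint M f (map \<sigma> xs)"
    and "\<And>P xs. P \<in> psyms L \<Longrightarrow> xs \<in> tuples M (parity L P) \<Longrightarrow> pint M P (map \<sigma> xs) \<longleftrightarrow> pint M P xs"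
  shows "\<sigma> \<in> Aut L M"
  using assms by (simp add: Aut_def)

lemma Aut_fint: "\<sigma> \<in> Aut L M \<Longrightarrow> f \<in> fsyms L \<Longrightarrow> xs \<in> tuples M (farity L f) \<Longrightarrow>
    \<sigma> (fint M f xs) = fint M f (map \<sigma> xs)"
  and Aut_pint: "\<sigma> \<in> Aut L M \<Longrightarrow> P \<in> psyms L \<Longrightarrow> xs \<in> tuples M (parity L P) \<Longrightarrow>
    pint M P (map \<sigma> xs) \<longleftrightarrow> pint M P xs"
  by (simp_all add: Aut_def)

lemma fint_closed: "is_struct L M \<Longrightarrow> f \<in> fsyms L \<Longrightarrow> xs \<in> tuples M (farity L f) \<Longrightarrow> fint M f xs \<in> univ M"
  by (simp add: is_struct_def)

lemma id_Aut:
  assumes M: "is_struct L M"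
  shows "(\<lambda>a\<in>univ M. a) \<in> Aut L M"
proof (rule AutI[OF id_Bij])
  have map: "map (\<lambda>a\<in>univ M. a) xs = xs" if "xs \<in> tuples M n" for xs n
    using that by (intro map_idI) (auto simp: tuples_def)
  then show "(\<lambda>a\<in>univ M. a) (fint M f xs) = fint M f (map (\<lambda>a\<in>univ M. a) xs)"
    if "f \<in> fsyms L" "xs \<in> tuples M (farity L f)" for f xs
    using fint_closed[OF M that] map[OF that(2)] by simp
  show "pint M P (map (\<lambda>a\<in>univ M. a) xs) \<longleftrightarrow> pint M P xs" if "xs \<in> tuples M (parity L P)" for P xs
    using map[OF that] by simp
qed

lemma compose_Aut:
  assumes M: "is_struct L M" and \<sigma>: "\<sigma> \<in> Aut L M" and \<tau>: "\<tau> \<in> Aut L M"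
  shows "compose (univ M) \<sigma> \<tau> \<in> Aut L M"
proof (rule AutI)
  show "compose (univ M) \<sigma> \<tau> \<in> Bij (univ M)"
    using \<sigma> \<tau> by (intro compose_Bij) (simp_all add: Aut_def)
  have map: "map (compose (univ M) \<sigma> \<tau>) xs = map \<sigma> (map \<tau> xs)" "map \<tau> xs \<in> tuples M n"
    if "xs \<in> tuples M n" for xs n
    using that map_tuples[of \<tau> M M] Aut_closed[OF \<tau>] by (auto simp: tuples_def compose_eq subset_iff)
  show "compose (univ M) \<sigma> \<tau> (fint M f xs) = fint M f (map (compose (univ M) \<sigma> \<tau>) xs)"
    if "f \<in> fsyms L" "xs \<in> tuples M (farity L f)" for f xs
    using map[OF that(2)] fint_closed[OF M that] Aut_fint[OF \<sigma> that(1)] Aut_fint[OF \<tau> that]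
    by (simp add: compose_eq del: map_map)
  show "pint M P (map (compose (univ M) \<sigma> \<tau>) xs) \<longleftrightarrow> pint M P xs"
    if "P \<in> psyms L" "xs \<in> tuples M (parity L P)" for P xs
    using map[OF that(2)] Aut_pint[OF \<sigma> that(1)] Aut_pint[OF \<tau> that] by (simp del: map_map)
qed

lemma inverse_Aut:
  assumes M: "is_struct L M" and \<sigma>: "\<sigma> \<in> Aut L M"
  obtains \<tau> where "\<tau> \<in> Aut L M" "\<And>a. a \<in> univ M \<Longrightarrow> \<tau> (\<sigma> a) = a" "\<And>a. a \<in> univ M \<Longrightarrow> \<sigma> (\<tau> a) = a"
proof
  let ?\<tau> = "\<lambda>a\<in>univ M. inv_into (univ M) \<sigma> a"
  have Bij: "?\<tau> \<in> Bij (univ M)"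
    using \<sigma> by (intro restrict_inv_into_Bij) (simp add: Aut_def)
  show left: "?\<tau> (\<sigma> a) = a" and right: "\<sigma> (?\<tau> a) = a" if "a \<in> univ M" for a
    using that Aut_closed[OF \<sigma>] Aut_inj[OF \<sigma>] Aut_image[OF \<sigma>] by (simp_all add: f_inv_into_f)
  have map: "map ?\<tau> xs \<in> tuples M n" "map \<sigma> (map ?\<tau> xs) = xs" if "xs \<in> tuples M n" for xs n
    using that map_tuples[OF Bij_imp_funcset[OF Bij] that] right
    by (auto simp: tuples_def intro!: map_idI)
  show "?\<tau> \<in> Aut L M"
  proof (rule AutI[OF Bij])
    fix f xs assume f: "f \<in> fsyms L" and xs: "xs \<in> tuples M (farity L f)"
    have "fint M f xs = \<sigma> (fint M f (map ?\<tau> xs))"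
      using Aut_fint[OF \<sigma> f map(1)[OF xs]] map(2)[OF xs] by simp
    then show "?\<tau> (fint M f xs) = fint M f (map ?\<tau> xs)"
      using left[OF fint_closed[OF M f map(1)[OF xs]]] by simp
  next
    fix P xs assume "P \<in> psyms L" and xs: "xs \<in> tuples M (parity L P)"
    then show "pint M P (map ?\<tau> xs) \<longleftrightarrow> pint M P xs"
      using Aut_pint[OF \<sigma> _ map(1)[OF xs]] map(2)[OF xs] by simp
  qed
qed

lemma teval_closed:
  "is_struct L M \<Longrightarrow> wf_tm L t \<Longrightarrow> v ` tatoms t \<subseteq> univ M \<Longrightarrow> range e \<subseteq> univ M \<Longrightarrow> teval M v e t \<in> univ M"
proof (induction t)
  case (Fn f ts)
  then have "teval M v e t \<in> univ M" if "t \<in> set ts" for t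
    using that by (intro Fn.IH) auto
  then have "map (teval M v e) ts \<in> tuples M (farity L f)"
    using Fn.prems by (auto simp: tuples_def)
  then show ?case
    using Fn.prems(2) fint_closed[OF Fn.prems(1)] by simp
qed auto

lemma teval_Aut:
  assumes M: "is_struct L M" and \<sigma>: "\<sigma> \<in> Aut L M"
  shows "wf_tm L t \<Longrightarrow> v ` tatoms t \<subseteq> univ M \<Longrightarrow> range e \<subseteq> univ M \<Longrightarrow>
    teval M (\<sigma> \<circ> v) (\<sigma> \<circ> e) t = \<sigma> (teval M v e t)"
proof (induction t)
  case (Fn f ts)
  have "map (teval M (\<sigma> \<circ> v) (\<sigma> \<circ> e)) ts = map (\<sigma> \<circ> teval M v e) ts"
    using Fn.prems by (intro map_cong refl) (subst Fn.IH, auto)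
  moreover have "map (teval M v e) ts \<in> tuples M (farity L f)"
    using Fn.prems teval_closed[OF M, of _ v e] by (auto simp: tuples_def image_subset_iff)
  ultimately show ?case
    using Aut_fint[OF \<sigma>] Fn.prems(1) by (simp only: teval.simps wf_tm.simps list.map_comp)
qed auto

lemma sat_Aut:
  assumes M: "is_struct L M" and \<sigma>: "\<sigma> \<in> Aut L M"
  shows "wf_fm L \<phi> \<Longrightarrow> v ` atoms \<phi> \<subseteq> univ M \<Longrightarrow> range e \<subseteq> univ M \<Longrightarrow>
    sat M (\<sigma> \<circ> v) (\<sigma> \<circ> e) \<phi> \<longleftrightarrow> sat M v e \<phi>"
proof (induction \<phi> arbitrary: e)
  case (Eq s t)
  then have "teval M v e s \<in> univ M" "teval M v e t \<in> univ M"
    using teval_closed[OF M, of s v e] teval_closed[OF M, of t v e] by (simp_all add: image_Un)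
  moreover have "teval M (\<sigma> \<circ> v) (\<sigma> \<circ> e) s = \<sigma> (teval M v e s)"
    "teval M (\<sigma> \<circ> v) (\<sigma> \<circ> e) t = \<sigma> (teval M v e t)"
    using Eq teval_Aut[OF M \<sigma>, of s v e] teval_Aut[OF M \<sigma>, of t v e] by (simp_all add: image_Un)
  ultimately show ?case
    by (simp only: sat.simps inj_on_eq_iff[OF Aut_inj[OF \<sigma>]])
next
  case (Rel P ts)
  have "map (teval M (\<sigma> \<circ> v) (\<sigma> \<circ> e)) ts = map (\<sigma> \<circ> teval M v e) ts"
    using Rel.prems by (intro map_cong refl) (subst teval_Aut[OF M \<sigma>], auto)
  moreover have "map (teval M v e) ts \<in> tuples M (parity L P)"
    using Rel.prems teval_closed[OF M, of _ v e] by (auto simp: tuples_def image_subset_iff)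
  ultimately show ?case
    using Aut_pint[OF \<sigma>] Rel.prems(1) by (simp only: sat.simps wf_fm.simps list.map_comp[symmetric])
next
  case (Ex n \<phi>)
  have "sat M (\<sigma> \<circ> v) ((\<sigma> \<circ> e)(n := \<sigma> d)) \<phi> \<longleftrightarrow> sat M v (e(n := d)) \<phi>" if "d \<in> univ M" for d
  proof -
    have eq: "(\<sigma> \<circ> e)(n := \<sigma> d) = \<sigma> \<circ> (e(n := d))"
      by auto
    have range: "range (e(n := d)) \<subseteq> univ M"
      using Ex.prems that by auto
    show ?thesis
      unfolding eq by (rule Ex.IH[OF _ _ range]) (use Ex.prems in auto)
  qed
  then have "(\<exists>d\<in>\<sigma> ` univ M. sat M (\<sigma> \<circ> v) ((\<sigma> \<circ> e)(n := d)) \<phi>) \<longleftrightarrow> (\<exists>d\<in>univ M. sat M v (e(n := d)) \<phi>)"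
    by simp
  then show ?case
    by (simp only: sat.simps Aut_image[OF \<sigma>])
qed (auto simp: image_Un)

lemma holds_Aut:
  assumes M: "is_struct L M" and \<sigma>: "\<sigma> \<in> Aut L M" and \<phi>: "\<phi> \<in> fmls L V" and v: "v ` V \<subseteq> univ M"
  shows "holds M (\<sigma> \<circ> v) \<phi> \<longleftrightarrow> holds M v \<phi>"
proof -
  obtain d where "d \<in> univ M"
    using M by (auto simp: is_struct_def)
  then have "sat M (\<sigma> \<circ> v) (\<sigma> \<circ> (\<lambda>_. d)) \<phi> \<longleftrightarrow> sat M v (\<lambda>_. d) \<phi>"
    using \<phi> v by (intro sat_Aut[OF M \<sigma>]) (auto simp: fmls_def)
  then show ?thesis
    by (simp only: sat_eq_holds[OF \<phi>])
qed

section \<open>Types\<close>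

lemma partial_type_iff:
  "partial_type L M I A p \<longleftrightarrow> p \<subseteq> fmls L (I <+> A) \<and> (\<forall>q. finite q \<and> q \<subseteq> p \<longrightarrow> realized M I q)"
  by (simp add: partial_type_def realized_def)

lemma realized_mono: "realized M I q \<Longrightarrow> p \<subseteq> q \<Longrightarrow> realized M I p"
  by (auto simp: realized_def)

lemma complete_type_Neg:
  assumes p: "complete_type L M I A p" and \<phi>: "\<phi> \<in> fmls L (I <+> A)"
  shows "Neg \<phi> \<in> p \<longleftrightarrow> \<phi> \<notin> p"
proof -
  have "\<not> realized M I {\<phi>, Neg \<phi>}"
    by (auto simp: realized_def)
  then have "\<not> {\<phi>, Neg \<phi>} \<subseteq> p"
    using p by (auto simp: complete_type_def partial_type_iff)
  then show ?thesis
    using p \<phi> by (auto simp: complete_type_def)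
qed

lemma complete_type_Conj:
  assumes p: "complete_type L M I A p" and \<phi>\<psi>: "\<phi> \<in> fmls L (I <+> A)" "\<psi> \<in> fmls L (I <+> A)"
  shows "Conj \<phi> \<psi> \<in> p \<longleftrightarrow> \<phi> \<in> p \<and> \<psi> \<in> p"
proof -
  have "\<not> realized M I {\<phi>, \<psi>, Neg (Conj \<phi> \<psi>)}" "\<not> realized M I {Conj \<phi> \<psi>, Neg \<phi>}"
    "\<not> realized M I {Conj \<phi> \<psi>, Neg \<psi>}"
    by (auto simp: realized_def)
  then have "\<not> {\<phi>, \<psi>, Neg (Conj \<phi> \<psi>)} \<subseteq> p" "\<not> {Conj \<phi> \<psi>, Neg \<phi>} \<subseteq> p" "\<not> {Conj \<phi> \<psi>, Neg \<psi>} \<subseteq> p"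
    using p by (auto simp: complete_type_def partial_type_iff)
  then show ?thesis
    using complete_type_Neg[OF p] \<phi>\<psi> by auto
qed

lemma complete_type_eqI:
  assumes p: "complete_type L M I A p" and q: "complete_type L M' I A q" and "p \<subseteq> q"
  shows "p = q"
proof
  show "q \<subseteq> p"
  proof
    fix \<phi> assume "\<phi> \<in> q"
    moreover from this have "\<phi> \<in> fmls L (I <+> A)"
      using q by (auto simp: complete_type_def partial_type_def)
    ultimately show "\<phi> \<in> p"
      using complete_type_Neg[OF p] complete_type_Neg[OF q] \<open>p \<subseteq> q\<close> by blast
  qed
qed fact

lemma maximal_partial_type_complete:
  assumes p: "partial_type L M I A p"
    and maximal: "\<And>q. partial_type L M I A q \<Longrightarrow> p \<subseteq> q \<Longrightarrow> q = p"
  shows "complete_type L M I A p"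
  unfolding complete_type_def
proof (intro conjI ballI p)
  fix \<phi> assume \<phi>: "\<phi> \<in> fmls L (I <+> A)"
  have unrealized: "\<exists>q. finite q \<and> q \<subseteq> p \<and> \<not> realized M I (insert \<psi> q)"
    if "\<psi> \<in> fmls L (I <+> A)" "\<psi> \<notin> p" for \<psi>
  proof -
    have "\<not> partial_type L M I A (insert \<psi> p)"
      using maximal[of "insert \<psi> p"] that(2) by blast
    moreover have "insert \<psi> p \<subseteq> fmls L (I <+> A)"
      using that(1) p by (simp add: partial_type_iff)
    ultimately obtain q where "finite q" "q \<subseteq> insert \<psi> p" "\<not> realized M I q"
      unfolding partial_type_iff by blast
    then show ?thesis
      using realized_mono[of M I "insert \<psi> (q - {\<psi>})" q] by (intro exI[of _ "q - {\<psi>}"]) auto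
  qed
  show "\<phi> \<in> p \<or> Neg \<phi> \<in> p"
  proof (rule ccontr)
    assume "\<not> (\<phi> \<in> p \<or> Neg \<phi> \<in> p)"
    then obtain q q' where q: "finite q" "q \<subseteq> p" "\<not> realized M I (insert \<phi> q)"
      and q': "finite q'" "q' \<subseteq> p" "\<not> realized M I (insert (Neg \<phi>) q')"
      using unrealized[of \<phi>] unrealized[of "Neg \<phi>"] \<phi> by auto
    have "realized M I (q \<union> q')"
      using p q(1,2) q'(1,2) by (simp add: partial_type_iff)
    then show False
      using q(3) q'(3) by (auto simp: realized_def)
  qed
qed

lemma partial_type_extend:
  assumes "partial_type L M I A p"
  obtains q where "complete_type L M I A q" "p \<subseteq> q"
proof -
  let ?\<A> = "{q. p \<subseteq> q \<and> partial_type L M I A q}"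
  have "\<exists>q\<in>?\<A>. \<forall>q'\<in>?\<A>. q \<subseteq> q' \<longrightarrow> q' = q"
  proof (rule subset_Zorn_nonempty)
    show "?\<A> \<noteq> {}"
      using assms by blast
    fix \<C> assume \<C>: "\<C> \<noteq> {}" "subset.chain ?\<A> \<C>"
    have "realized M I q" if q: "finite q" "q \<subseteq> \<Union>\<C>" for q
    proof -
      obtain B where "B \<in> \<C>" "q \<subseteq> B"
        using finite_subset_Union_chain[OF q \<C>] by blast
      then show ?thesis
        using \<C>(2) q(1) by (auto simp: subset.chain_def partial_type_iff)
    qed
    moreover obtain B where "B \<in> \<C>" "p \<subseteq> B"
      using \<C> by (auto simp: subset.chain_def)
    ultimately show "\<Union>\<C> \<in> ?\<A>"
      using \<C>(2) by (auto simp: subset.chain_def partial_type_iff)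
  qed
  then obtain q where q: "q \<in> ?\<A>" "\<forall>q'\<in>?\<A>. q \<subseteq> q' \<longrightarrow> q' = q"
    by (rule bexE)
  then have "complete_type L M I A q"
    by (intro maximal_partial_type_complete) auto
  then show thesis
    using that q(1) by simp
qed

section \<open>Type spaces\<close>

lemma type_space_complete: "p \<in> type_space L I \<pi> M \<Longrightarrow> complete_type L M I (univ M) p"
  by (simp add: type_space_def)

lemma type_space_fmls: "p \<in> type_space L I \<pi> M \<Longrightarrow> p \<subseteq> fmls L (I <+> univ M)"
  by (simp add: type_space_def complete_type_def partial_type_def)

lemma type_space_realized: "p \<in> type_space L I \<pi> M \<Longrightarrow> finite q \<Longrightarrow> q \<subseteq> p \<Longrightarrow> realized M I q"
  by (simp add: type_space_def complete_type_def partial_type_iff)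

lemma type_space_Neg:
  "p \<in> type_space L I \<pi> M \<Longrightarrow> \<phi> \<in> fmls L (I <+> univ M) \<Longrightarrow> Neg \<phi> \<in> p \<longleftrightarrow> \<phi> \<notin> p"
  by (rule complete_type_Neg[OF type_space_complete])

lemma type_space_eqI:
  "p \<in> type_space L I \<pi> M \<Longrightarrow> q \<in> type_space L I \<pi> M \<Longrightarrow> p \<subseteq> q \<Longrightarrow> p = q"
  by (rule complete_type_eqI[OF type_space_complete type_space_complete])

abbreviation stone_basic ::
  "('f, 'p) lang \<Rightarrow> 'i set \<Rightarrow> ('f, 'p, 'i + 'a) fm set \<Rightarrow> ('f, 'p, 'a) struct
     \<Rightarrow> ('f, 'p, 'i + 'a) fm \<Rightarrow> ('f, 'p, 'i + 'a) fm set set" where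
  "stone_basic L I \<pi> M \<phi> \<equiv> {p \<in> type_space L I \<pi> M. \<phi> \<in> p}"

lemma openin_stone_basic:
  "\<phi> \<in> fmls L (I <+> univ M) \<Longrightarrow> openin (stone_topology L I \<pi> M) (stone_basic L I \<pi> M \<phi>)"
  unfolding stone_topology_def by (rule topology_generated_by_Basis) blast

lemma closedin_stone_basic:
  assumes "\<phi> \<in> fmls L (I <+> univ M)"
  shows "closedin (stone_topology L I \<pi> M) (stone_basic L I \<pi> M \<phi>)"
proof -
  have "type_space L I \<pi> M - stone_basic L I \<pi> M \<phi> = stone_basic L I \<pi> M (Neg \<phi>)"
    using type_space_Neg[OF _ assms] by blast
  then show ?thesis
    using openin_stone_basic[of "Neg \<phi>" L I M \<pi>] assms
    by (auto simp: closedin_def topspace_stone_topology)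
qed

lemma stone_topology_base:
  assumes "openin (stone_topology L I \<pi> M) U" "p \<in> U"
  obtains \<phi> where "\<phi> \<in> fmls L (I <+> univ M)" "\<phi> \<in> p" "stone_basic L I \<pi> M \<phi> \<subseteq> U"
proof -
  have "p \<in> type_space L I \<pi> M"
    using openin_subset[OF assms(1)] assms(2) by (auto simp: topspace_stone_topology)
  then have p: "complete_type L M I (univ M) p"
    by (rule type_space_complete)
  have "generate_topology_on (stone_basic L I \<pi> M ` fmls L (I <+> univ M)) U"
    using assms(1) unfolding stone_topology_def by (rule openin_topology_generated_by)
  then have "\<exists>\<phi>\<in>fmls L (I <+> univ M). \<phi> \<in> p \<and> stone_basic L I \<pi> M \<phi> \<subseteq> U"
    using assms(2)
  proof (induction U rule: generate_topology_on.induct)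
    case (Int U V)
    then obtain \<phi> \<psi> where \<phi>: "\<phi> \<in> fmls L (I <+> univ M)" "\<phi> \<in> p" "stone_basic L I \<pi> M \<phi> \<subseteq> U"
      and \<psi>: "\<psi> \<in> fmls L (I <+> univ M)" "\<psi> \<in> p" "stone_basic L I \<pi> M \<psi> \<subseteq> V"
      by blast
    have "stone_basic L I \<pi> M (Conj \<phi> \<psi>) = stone_basic L I \<pi> M \<phi> \<inter> stone_basic L I \<pi> M \<psi>"
      using complete_type_Conj[OF type_space_complete \<phi>(1) \<psi>(1)] by blast
    then have "stone_basic L I \<pi> M (Conj \<phi> \<psi>) \<subseteq> U \<inter> V"
      using \<phi>(3) \<psi>(3) by blast
    then show ?case
      using complete_type_Conj[OF p \<phi>(1) \<psi>(1)] \<phi>(1,2) \<psi>(1,2) by (intro bexI[of _ "Conj \<phi> \<psi>"]) simp_all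
  qed blast+
  then show thesis
    using that by blast
qed

lemma continuous_map_stone_topology:
  assumes f: "f \<in> topspace X \<rightarrow> type_space L I \<pi> M"
    and basic: "\<And>\<phi>. \<phi> \<in> fmls L (I <+> univ M) \<Longrightarrow> openin X {x \<in> topspace X. \<phi> \<in> f x}"
  shows "continuous_map X (stone_topology L I \<pi> M) f"
  unfolding stone_topology_def
proof (rule continuous_on_generated_topo)
  fix U assume "U \<in> stone_basic L I \<pi> M ` fmls L (I <+> univ M)"
  then obtain \<phi> where \<phi>: "\<phi> \<in> fmls L (I <+> univ M)" "U = stone_basic L I \<pi> M \<phi>"
    by blast
  then have "f -` U \<inter> topspace X = {x \<in> topspace X. \<phi> \<in> f x}"
    using f by auto
  then show "openin X (f -` U \<inter> topspace X)"
    using basic[OF \<phi>(1)] by simp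
next
  show "f ` topspace X \<subseteq> \<Union> (stone_basic L I \<pi> M ` fmls L (I <+> univ M))"
    using f topspace_stone_topology[of L I \<pi> M] by (auto simp: stone_topology_def)
qed

lemma Hausdorff_space_stone_topology: "Hausdorff_space (stone_topology L I \<pi> M)"
  unfolding Hausdorff_space_def topspace_stone_topology
proof (intro allI impI)
  fix p q assume pq: "p \<in> type_space L I \<pi> M \<and> q \<in> type_space L I \<pi> M \<and> p \<noteq> q"
  then obtain \<phi> where \<phi>: "\<phi> \<in> p" "\<phi> \<notin> q"
    using type_space_eqI by blast
  then have fmls: "\<phi> \<in> fmls L (I <+> univ M)"
    using pq type_space_fmls by blast
  let ?U = "stone_basic L I \<pi> M \<phi>" and ?V = "stone_basic L I \<pi> M (Neg \<phi>)"
  have "openin (stone_topology L I \<pi> M) ?U" "openin (stone_topology L I \<pi> M) ?V"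
    using fmls by (simp_all add: openin_stone_basic)
  moreover have "p \<in> ?U" "q \<in> ?V" "disjnt ?U ?V"
    using pq \<phi> type_space_Neg[OF _ fmls] by (auto simp: disjnt_def)
  ultimately show "\<exists>U V. openin (stone_topology L I \<pi> M) U \<and> openin (stone_topology L I \<pi> M) V \<and>
      p \<in> U \<and> q \<in> V \<and> disjnt U V"
    by blast
qed

lemma partial_type_negations:
  assumes \<pi>: "\<pi> \<subseteq> fmls L (I <+> univ M)" and \<Phi>: "\<Phi> \<subseteq> fmls L (I <+> univ M)"
    and uncovered: "\<And>\<Theta>. finite \<Theta> \<Longrightarrow> \<Theta> \<subseteq> \<Phi> \<Longrightarrow> \<not> type_space L I \<pi> M \<subseteq> (\<Union>\<phi>\<in>\<Theta>. stone_basic L I \<pi> M \<phi>)"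
  shows "partial_type L M I (univ M) (\<pi> \<union> Neg ` \<Phi>)"
  unfolding partial_type_iff
proof (intro conjI allI impI)
  show "\<pi> \<union> Neg ` \<Phi> \<subseteq> fmls L (I <+> univ M)"
    using \<pi> \<Phi> by auto
  fix q assume q: "finite q \<and> q \<subseteq> \<pi> \<union> Neg ` \<Phi>"
  then have "finite (q - \<pi>)" "q - \<pi> \<subseteq> Neg ` \<Phi>"
    by auto
  then obtain \<Theta> where \<Theta>: "finite \<Theta>" "\<Theta> \<subseteq> \<Phi>" "q - \<pi> = Neg ` \<Theta>"
    using finite_subset_image[of "q - \<pi>" Neg \<Phi>] by metis
  obtain p where p: "p \<in> type_space L I \<pi> M" "\<forall>\<phi>\<in>\<Theta>. \<phi> \<notin> p"
    using uncovered[OF \<Theta>(1,2)] by blast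
  have "Neg \<phi> \<in> p" if "\<phi> \<in> \<Theta>" for \<phi>
    using type_space_Neg[OF p(1), of \<phi>] that p(2) \<Theta>(2) \<Phi> by blast
  then have "q - \<pi> \<subseteq> p"
    unfolding \<Theta>(3) by blast
  moreover have "\<pi> \<subseteq> p"
    using p(1) by (simp add: type_space_def)
  ultimately have "q \<subseteq> p"
    by blast
  then show "realized M I q"
    using type_space_realized[OF p(1)] q by blast
qed

lemma compact_space_stone_topology:
  assumes \<pi>: "\<pi> \<subseteq> fmls L (I <+> univ M)"
  shows "compact_space (stone_topology L I \<pi> M)"
  unfolding compact_space_alt topspace_stone_topology
proof (intro allI impI, rule ccontr)
  let ?S = "type_space L I \<pi> M"
  fix \<U> assume \<U>: "(\<forall>U\<in>\<U>. openin (stone_topology L I \<pi> M) U) \<and> ?S \<subseteq> \<Union>\<U>"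
  assume no_subcover: "\<not> (\<exists>\<F>. finite \<F> \<and> \<F> \<subseteq> \<U> \<and> ?S \<subseteq> \<Union>\<F>)"
  define \<Phi> where "\<Phi> = {\<phi> \<in> fmls L (I <+> univ M). \<exists>U\<in>\<U>. stone_basic L I \<pi> M \<phi> \<subseteq> U}"
  have "\<not> ?S \<subseteq> (\<Union>\<phi>\<in>\<Theta>. stone_basic L I \<pi> M \<phi>)" if \<Theta>: "finite \<Theta>" "\<Theta> \<subseteq> \<Phi>" for \<Theta>
  proof -
    have "\<forall>\<phi>\<in>\<Theta>. \<exists>U. U \<in> \<U> \<and> stone_basic L I \<pi> M \<phi> \<subseteq> U"
      using \<Theta>(2) by (auto simp: \<Phi>_def)
    then obtain f where f: "\<forall>\<phi>\<in>\<Theta>. f \<phi> \<in> \<U> \<and> stone_basic L I \<pi> M \<phi> \<subseteq> f \<phi>"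
      by (rule bchoice[THEN exE])
    then have "(\<Union>\<phi>\<in>\<Theta>. stone_basic L I \<pi> M \<phi>) \<subseteq> \<Union> (f ` \<Theta>)"
      by blast
    moreover have "\<not> ?S \<subseteq> \<Union> (f ` \<Theta>)"
      using no_subcover f \<Theta>(1) by blast
    ultimately show ?thesis
      by blast
  qed
  then have "partial_type L M I (univ M) (\<pi> \<union> Neg ` \<Phi>)"
    using \<pi> by (intro partial_type_negations) (auto simp: \<Phi>_def)
  then obtain p where p: "complete_type L M I (univ M) p" "\<pi> \<union> Neg ` \<Phi> \<subseteq> p"
    by (rule partial_type_extend)
  then obtain U where U: "U \<in> \<U>" "p \<in> U"
    using \<U> by (auto simp: type_space_def)
  have "openin (stone_topology L I \<pi> M) U"
    using \<U> U(1) by blast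
  then obtain \<phi> where \<phi>: "\<phi> \<in> fmls L (I <+> univ M)" "\<phi> \<in> p" "stone_basic L I \<pi> M \<phi> \<subseteq> U"
    using U(2) by (rule stone_topology_base)
  then have "\<phi> \<in> \<Phi>"
    using U(1) by (auto simp: \<Phi>_def)
  then have "Neg \<phi> \<in> p"
    using p(2) by blast
  then show False
    using complete_type_Neg[OF p(1) \<phi>(1)] \<phi>(2) by simp
qed

section \<open>The action on types\<close>

abbreviation param_rename :: "('a \<Rightarrow> 'b) \<Rightarrow> ('f, 'p, 'i + 'a) fm \<Rightarrow> ('f, 'p, 'i + 'b) fm" where
  "param_rename \<sigma> \<equiv> rename (map_sum (\<lambda>i. i) \<sigma>)"

abbreviation type_over ::
  "('f, 'p) lang \<Rightarrow> 'i set \<Rightarrow> 'a set \<Rightarrow> ('f, 'p, 'i + 'a) fm set \<Rightarrow> ('f, 'p, 'i + 'a) fm set" where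
  "type_over L I a p \<equiv> p \<inter> fmls L (I <+> a)"

lemma map_sum_image_Plus: "map_sum (\<lambda>i. i) \<sigma> ` (I <+> a) = I <+> \<sigma> ` a"
  by (force simp: image_iff)

lemma type_act_subset_fmls:
  "p \<subseteq> fmls L (I <+> a) \<Longrightarrow> \<sigma> ` a \<subseteq> b \<Longrightarrow> type_act \<sigma> p \<subseteq> fmls L (I <+> b)"
  unfolding type_act_def
  by (intro image_subsetI rename_fmls[of _ L "I <+> a"]) (auto simp: map_sum_image_Plus)

lemma type_act_cong:
  assumes "p \<subseteq> fmls L (I <+> a)" "\<And>x. x \<in> a \<Longrightarrow> \<sigma> x = \<tau> x"
  shows "type_act \<sigma> p = type_act \<tau> p"
  unfolding type_act_def
  using assms by (intro image_cong refl rename_cong[of _ L "I <+> a"]) auto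

lemma type_act_id:
  assumes "p \<subseteq> fmls L (I <+> a)" "\<And>x. x \<in> a \<Longrightarrow> \<sigma> x = x"
  shows "type_act \<sigma> p = p"
proof -
  have "param_rename \<sigma> \<phi> = \<phi>" if "\<phi> \<in> p" for \<phi>
    using assms that by (intro rename_idI[of _ L "I <+> a"]) auto
  then show ?thesis
    by (simp add: type_act_def)
qed

lemma type_act_compose:
  assumes "p \<subseteq> fmls L (I <+> a)"
  shows "type_act (compose a \<sigma> \<tau>) p = type_act \<sigma> (type_act \<tau> p)"
proof -
  have "type_act \<sigma> (type_act \<tau> p) = type_act (\<sigma> \<circ> \<tau>) p"
    unfolding type_act_def image_image fm.map_comp map_sum.comp by (simp add: o_def)
  also have "\<dots> = type_act (compose a \<sigma> \<tau>) p"
    using assms by (rule type_act_cong) (simp add: compose_eq)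
  finally show ?thesis ..
qed

lemma type_over_type_act:
  assumes p: "p \<subseteq> fmls L (I <+> U)" and \<sigma>: "inj_on \<sigma> U" and a: "a \<subseteq> U"
  shows "type_over L I (\<sigma> ` a) (type_act \<sigma> p) = type_act \<sigma> (type_over L I a p)"
proof -
  have inj: "inj_on (map_sum (\<lambda>i. i) \<sigma>) (I <+> U)"
    by (rule inj_onI) (auto dest: inj_onD[OF \<sigma>])
  have "param_rename \<sigma> \<phi> \<in> fmls L (I <+> \<sigma> ` a) \<longleftrightarrow> \<phi> \<in> fmls L (I <+> a)" if "\<phi> \<in> p" for \<phi>
    unfolding map_sum_image_Plus[symmetric]
    by (rule rename_mem_fmls_iff[OF _ inj]) (use p a that in blast)+
  then show ?thesis
    unfolding type_act_def by blast
qed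

lemma type_over_mono:
  assumes "type_over L I b p = type_over L I b q" "a \<subseteq> b"
  shows "type_over L I a p = type_over L I a q"
proof -
  have "fmls L (I <+> a) \<subseteq> fmls L (I <+> b)"
    using assms(2) by (intro fmls_mono) auto
  then show ?thesis
    using assms(1) by blast
qed

lemma realized_type_act:
  assumes M: "is_struct L M" and \<sigma>: "\<sigma> \<in> Aut L M" and q: "q \<subseteq> fmls L (I <+> univ M)"
    and "realized M I q"
  shows "realized M I (type_act \<sigma> q)"
proof -
  obtain c where c: "c \<in> I \<rightarrow> univ M" "\<forall>\<phi>\<in>q. holds M (case_sum c (\<lambda>a. a)) \<phi>"
    using assms(4) by (auto simp: realized_def)
  have "holds M (case_sum (\<sigma> \<circ> c) (\<lambda>a. a)) (param_rename \<sigma> \<phi>)" if "\<phi> \<in> q" for \<phi>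
  proof -
    have "case_sum (\<sigma> \<circ> c) (\<lambda>a. a) \<circ> map_sum (\<lambda>i. i) \<sigma> = \<sigma> \<circ> case_sum c (\<lambda>a. a)"
      by (auto simp: fun_eq_iff split: sum.splits)
    moreover have "case_sum c (\<lambda>a. a) ` (I <+> univ M) \<subseteq> univ M"
      using c(1) by auto
    ultimately show ?thesis
      using holds_Aut[OF M \<sigma> subsetD[OF q that]] c(2) that by (simp add: holds_rename)
  qed
  moreover have "\<sigma> \<circ> c \<in> I \<rightarrow> univ M"
    using c(1) Aut_closed[OF \<sigma>] by (auto simp: Pi_def)
  ultimately show ?thesis
    unfolding realized_def type_act_def by blast
qed

lemma param_rename_inverse:
  "\<phi> \<in> fmls L (I <+> U) \<Longrightarrow> (\<And>a. a \<in> U \<Longrightarrow> \<tau> (\<sigma> a) = a) \<Longrightarrow> param_rename \<tau> (param_rename \<sigma> \<phi>) = \<phi>"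
  unfolding fm.map_comp by (rule rename_idI) auto

lemma mem_type_act_iff:
  assumes \<phi>: "\<phi> \<in> fmls L (I <+> U)" and p: "p \<subseteq> fmls L (I <+> U)"
    and inverse: "\<And>a. a \<in> U \<Longrightarrow> \<tau> (\<sigma> a) = a" "\<And>a. a \<in> U \<Longrightarrow> \<sigma> (\<tau> a) = a"
  shows "\<phi> \<in> type_act \<sigma> p \<longleftrightarrow> param_rename \<tau> \<phi> \<in> p"
proof
  assume "\<phi> \<in> type_act \<sigma> p"
  then obtain \<psi> where "\<psi> \<in> p" "\<phi> = param_rename \<sigma> \<psi>"
    by (auto simp: type_act_def)
  moreover from this have "param_rename \<tau> (param_rename \<sigma> \<psi>) = \<psi>"
    using p by (intro param_rename_inverse inverse) auto
  ultimately show "param_rename \<tau> \<phi> \<in> p"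
    by simp
next
  assume "param_rename \<tau> \<phi> \<in> p"
  moreover have "\<phi> = param_rename \<sigma> (param_rename \<tau> \<phi>)"
    by (rule param_rename_inverse[OF \<phi>, symmetric]) (rule inverse(2))
  ultimately show "\<phi> \<in> type_act \<sigma> p"
    unfolding type_act_def by (rule rev_image_eqI)
qed

lemma type_act_inverse:
  assumes "p \<subseteq> fmls L (I <+> U)" "\<And>a. a \<in> U \<Longrightarrow> \<tau> (\<sigma> a) = a"
  shows "type_act \<tau> (type_act \<sigma> p) = p"
  using type_act_compose[OF assms(1), of \<tau> \<sigma>] type_act_id[OF assms(1), of "compose U \<tau> \<sigma>"] assms(2)
  by (simp add: compose_eq)

lemma compose_type_act_fixed:
  assumes x: "x \<in> A \<rightarrow>\<^sub>E type_space L I \<pi> M" and fixed: "\<And>a. a \<in> univ M \<Longrightarrow> \<sigma> a = a"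
  shows "compose A (type_act \<sigma>) x = x"
proof (rule extensionalityI[of _ A])
  show "x \<in> extensional A"
    using x by (simp add: PiE_def)
  show "compose A (type_act \<sigma>) x i = x i" if i: "i \<in> A" for i
    using type_act_id[OF type_space_fmls[OF PiE_mem[OF x i]] fixed] i by (simp add: compose_eq)
qed simp

lemma compose_type_act_compose:
  assumes x: "x \<in> A \<rightarrow>\<^sub>E type_space L I \<pi> M"
  shows "compose A (type_act (compose (univ M) \<sigma> \<tau>)) x =
    compose A (type_act \<sigma>) (compose A (type_act \<tau>) x)"
proof (rule extensionalityI[of _ A])
  show "compose A (type_act (compose (univ M) \<sigma> \<tau>)) x i =
      compose A (type_act \<sigma>) (compose A (type_act \<tau>) x) i" if i: "i \<in> A" for i
    using type_act_compose[OF type_space_fmls[OF PiE_mem[OF x i]], of \<sigma> \<tau>] i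
    by (simp add: compose_eq)
qed simp_all

lemma compose_type_act_inverse:
  assumes x: "x \<in> A \<rightarrow>\<^sub>E type_space L I \<pi> M" and inverse: "\<And>a. a \<in> univ M \<Longrightarrow> \<tau> (\<sigma> a) = a"
  shows "compose A (type_act \<tau>) (compose A (type_act \<sigma>) x) = x"
  unfolding compose_type_act_compose[OF x, symmetric]
  by (rule compose_type_act_fixed[OF x]) (simp add: compose_eq inverse)

section \<open>The flow of types\<close>

definition stone_flow ::
  "('f, 'p) lang \<Rightarrow> 'i set \<Rightarrow> ('f, 'p, 'i + 'a) fm set \<Rightarrow> ('f, 'p, 'a) struct
     \<Rightarrow> ('a \<Rightarrow> 'a, ('f, 'p, 'i + 'a) fm set) flow" where
  "stone_flow L I \<pi> M =
     \<lparr>flow_group = Aut L M, flow_space = stone_topology L I \<pi> M, flow_act = type_act\<rparr>"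

lemma stone_flow_simps [simp]:
  "flow_group (stone_flow L I \<pi> M) = Aut L M"
  "flow_space (stone_flow L I \<pi> M) = stone_topology L I \<pi> M"
  "flow_act (stone_flow L I \<pi> M) = type_act"
  by (simp_all add: stone_flow_def)

lemma flow_carrier_stone_flow [simp]: "flow_carrier (stone_flow L I \<pi> M) = type_space L I \<pi> M"
  by (simp only: flow_carrier_def stone_flow_simps topspace_stone_topology)

lemma type_flow_eq: "type_flow L I \<pi> M F = quotient_flow (stone_flow L I \<pi> M) F"
  by (simp add: type_flow_def quotient_flow_def)

lemma closed_invariant_equiv_iff:
  "closed_invariant_equiv L I \<pi> M F \<longleftrightarrow> flow_congruence (stone_flow L I \<pi> M) F"
  by (simp add: closed_invariant_equiv_def flow_congruence_def)

definition agree_over ::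
  "('f, 'p) lang \<Rightarrow> 'i set \<Rightarrow> 'j set \<Rightarrow> 'a set
     \<Rightarrow> ('j \<Rightarrow> ('f, 'p, 'i + 'a) fm set) \<Rightarrow> ('j \<Rightarrow> ('f, 'p, 'i + 'a) fm set) \<Rightarrow> bool" where
  "agree_over L I A a x y \<longleftrightarrow> (\<forall>i\<in>A. type_over L I a (x i) = type_over L I a (y i))"

lemma agree_over_sym: "agree_over L I A a x y \<Longrightarrow> agree_over L I A a y x"
  by (simp add: agree_over_def)

lemma agree_over_trans [trans]:
  "agree_over L I A a x y \<Longrightarrow> agree_over L I A a y z \<Longrightarrow> agree_over L I A a x z"
  by (simp add: agree_over_def)

lemma agree_over_mono: "agree_over L I A b x y \<Longrightarrow> a \<subseteq> b \<Longrightarrow> agree_over L I A a x y"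
  unfolding agree_over_def by (blast dest: type_over_mono)

lemma agree_over_memD:
  "agree_over L I A a x y \<Longrightarrow> i \<in> A \<Longrightarrow> \<phi> \<in> fmls L (I <+> a) \<Longrightarrow> \<phi> \<in> x i \<longleftrightarrow> \<phi> \<in> y i"
  by (auto simp: agree_over_def)

lemma agree_over_act:
  assumes x: "x \<in> A \<rightarrow>\<^sub>E type_space L I \<pi> M" and y: "y \<in> A \<rightarrow>\<^sub>E type_space L I \<pi>' N"
    and \<sigma>: "\<sigma> \<in> Aut L M" and \<rho>: "\<rho> \<in> Aut L N" and a: "a \<subseteq> univ M" "a \<subseteq> univ N"
    and eq: "\<And>c. c \<in> a \<Longrightarrow> \<sigma> c = \<rho> c" and agree: "agree_over L I A a x y"
  shows "agree_over L I A (\<sigma> ` a) (compose A (type_act \<sigma>) x) (compose A (type_act \<rho>) y)"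
  unfolding agree_over_def
proof
  fix i assume i: "i \<in> A"
  have image: "\<sigma> ` a = \<rho> ` a"
    using eq by simp
  have xi: "x i \<subseteq> fmls L (I <+> univ M)" and yi: "y i \<subseteq> fmls L (I <+> univ N)"
    using type_space_fmls PiE_mem[OF x i] PiE_mem[OF y i] by blast+
  have "type_over L I (\<sigma> ` a) (type_act \<sigma> (x i)) = type_act \<sigma> (type_over L I a (x i))"
    by (rule type_over_type_act[OF xi Aut_inj[OF \<sigma>] a(1)])
  also have "\<dots> = type_act \<sigma> (type_over L I a (y i))"
    using agree i by (simp add: agree_over_def)
  also have "\<dots> = type_act \<rho> (type_over L I a (y i))"
    by (rule type_act_cong[OF Int_lower2 eq])
  also have "\<dots> = type_over L I (\<sigma> ` a) (type_act \<rho> (y i))"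
    unfolding image by (rule type_over_type_act[OF yi Aut_inj[OF \<rho>] a(2), symmetric])
  finally show "type_over L I (\<sigma> ` a) (compose A (type_act \<sigma>) x i) =
      type_over L I (\<sigma> ` a) (compose A (type_act \<rho>) y i)"
    using i by (simp add: compose_eq)
qed

lemma agree_over_act_fixed:
  assumes x: "x \<in> A \<rightarrow>\<^sub>E type_space L I \<pi> M" and \<sigma>: "\<sigma> \<in> Aut L M"
    and a: "a \<subseteq> univ M" "\<And>c. c \<in> a \<Longrightarrow> \<sigma> c = c"
  shows "agree_over L I A a (compose A (type_act \<sigma>) x) x"
  unfolding agree_over_def
proof
  fix i assume i: "i \<in> A"
  have image: "\<sigma> ` a = a"
    using a(2) by simp
  have "type_over L I a (type_act \<sigma> (x i)) = type_act \<sigma> (type_over L I a (x i))"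
    using type_over_type_act[OF type_space_fmls[OF PiE_mem[OF x i]] Aut_inj[OF \<sigma>] a(1)]
    unfolding image .
  also have "\<dots> = type_over L I a (x i)"
    by (rule type_act_id[OF Int_lower2 a(2)])
  finally show "type_over L I a (compose A (type_act \<sigma>) x i) = type_over L I a (x i)"
    using i by (simp add: compose_eq)
qed

locale type_space_flow =
  fixes L :: "('f, 'p) lang" and I :: "'i set" and \<pi> :: "('f, 'p, 'i + 'a) fm set"
    and M :: "('f, 'p, 'a) struct"
  assumes struct: "is_struct L M" and \<pi>_fmls: "\<pi> \<subseteq> fmls L (I <+> {})"
begin

abbreviation "S \<equiv> type_space L I \<pi> M"
abbreviation "\<Phi> \<equiv> stone_flow L I \<pi> M"

lemma type_act_type_space:
  assumes \<sigma>: "\<sigma> \<in> Aut L M" and p: "p \<in> S"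
  shows "type_act \<sigma> p \<in> S"
proof -
  have "realized M I q" if q: "finite q" "q \<subseteq> type_act \<sigma> p" for q
  proof -
    obtain q0 where q0: "q0 \<subseteq> p" "finite q0" "q = type_act \<sigma> q0"
      using finite_subset_image[OF q[unfolded type_act_def]] by (auto simp: type_act_def)
    then have "realized M I q0" "q0 \<subseteq> fmls L (I <+> univ M)"
      using type_space_realized[OF p] type_space_fmls[OF p] by auto
    then show ?thesis
      unfolding q0(3) using realized_type_act[OF struct \<sigma>] by blast
  qed
  moreover have "type_act \<sigma> p \<subseteq> fmls L (I <+> univ M)"
    using type_act_subset_fmls[OF type_space_fmls[OF p]] Aut_image[OF \<sigma>] by blast
  moreover have "\<phi> \<in> type_act \<sigma> p \<or> Neg \<phi> \<in> type_act \<sigma> p" if \<phi>: "\<phi> \<in> fmls L (I <+> univ M)" for \<phi>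
  proof -
    obtain \<tau> where \<tau>: "\<tau> \<in> Aut L M" "\<And>a. a \<in> univ M \<Longrightarrow> \<tau> (\<sigma> a) = a" "\<And>a. a \<in> univ M \<Longrightarrow> \<sigma> (\<tau> a) = a"
      using inverse_Aut[OF struct \<sigma>] by blast
    have "param_rename \<tau> \<phi> \<in> fmls L (I <+> univ M)"
      using \<phi> Aut_closed[OF \<tau>(1)] by (intro rename_fmls[of _ L "I <+> univ M"]) auto
    then show ?thesis
      using mem_type_act_iff[OF _ type_space_fmls[OF p] \<tau>(2,3)] type_space_Neg[OF p] \<phi> by auto
  qed
  moreover have "\<pi> \<subseteq> type_act \<sigma> p"
  proof -
    have "type_act \<sigma> \<pi> = \<pi>"
      by (rule type_act_id[OF \<pi>_fmls]) simp
    moreover have "\<pi> \<subseteq> p"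
      using p by (simp add: type_space_def)
    ultimately show ?thesis
      by (metis image_mono type_act_def)
  qed
  ultimately show ?thesis
    by (simp add: type_space_def complete_type_def partial_type_iff)
qed

lemma continuous_map_type_act:
  assumes \<sigma>: "\<sigma> \<in> Aut L M"
  shows "continuous_map (stone_topology L I \<pi> M) (stone_topology L I \<pi> M) (type_act \<sigma>)"
proof (rule continuous_map_stone_topology)
  show "type_act \<sigma> \<in> topspace (stone_topology L I \<pi> M) \<rightarrow> S"
    using type_act_type_space[OF \<sigma>] by (simp add: topspace_stone_topology)
  fix \<phi> assume \<phi>: "\<phi> \<in> fmls L (I <+> univ M)"
  obtain \<tau> where \<tau>: "\<tau> \<in> Aut L M" "\<And>a. a \<in> univ M \<Longrightarrow> \<tau> (\<sigma> a) = a" "\<And>a. a \<in> univ M \<Longrightarrow> \<sigma> (\<tau> a) = a"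
    using inverse_Aut[OF struct \<sigma>] by blast
  have "{p \<in> S. \<phi> \<in> type_act \<sigma> p} = stone_basic L I \<pi> M (param_rename \<tau> \<phi>)"
    using mem_type_act_iff[OF \<phi> type_space_fmls \<tau>(2,3)] by blast
  moreover have "param_rename \<tau> \<phi> \<in> fmls L (I <+> univ M)"
    using \<phi> Aut_closed[OF \<tau>(1)] by (intro rename_fmls[of _ L "I <+> univ M"]) auto
  ultimately show "openin (stone_topology L I \<pi> M)
      {p \<in> topspace (stone_topology L I \<pi> M). \<phi> \<in> type_act \<sigma> p}"
    by (simp add: topspace_stone_topology openin_stone_basic)
qed

sublocale compact_flow \<Phi>
proof
  have "\<pi> \<subseteq> fmls L (I <+> univ M)"
    using \<pi>_fmls fmls_mono[of "I <+> {}" "I <+> univ M" L] by auto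
  then show "compact_space (flow_space \<Phi>)"
    by (simp add: compact_space_stone_topology)
  show "Hausdorff_space (flow_space \<Phi>)"
    by (simp add: Hausdorff_space_stone_topology)
  show "continuous_map (flow_space \<Phi>) (flow_space \<Phi>) (flow_act \<Phi> g)" if "g \<in> flow_group \<Phi>" for g
    using that by (simp add: continuous_map_type_act)
  show "\<exists>e\<in>flow_group \<Phi>. \<forall>y\<in>flow_carrier \<Phi>. flow_act \<Phi> e y = y"
    using id_Aut[OF struct] type_act_id[OF type_space_fmls, of _ L I \<pi> M "\<lambda>a\<in>univ M. a"]
    by (intro bexI[of _ "\<lambda>a\<in>univ M. a"]) simp_all
  show "\<exists>k\<in>flow_group \<Phi>. \<forall>y\<in>flow_carrier \<Phi>. flow_act \<Phi> k y = flow_act \<Phi> g (flow_act \<Phi> h y)"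
    if "g \<in> flow_group \<Phi>" "h \<in> flow_group \<Phi>" for g h
    using that compose_Aut[OF struct] type_act_compose[OF type_space_fmls] by fastforce
  show "\<exists>k\<in>flow_group \<Phi>. \<forall>y\<in>flow_carrier \<Phi>.
      flow_act \<Phi> k (flow_act \<Phi> g y) = y \<and> flow_act \<Phi> g (flow_act \<Phi> k y) = y"
    if "g \<in> flow_group \<Phi>" for g
  proof -
    obtain k where k: "k \<in> Aut L M" "\<And>a. a \<in> univ M \<Longrightarrow> k (g a) = a" "\<And>a. a \<in> univ M \<Longrightarrow> g (k a) = a"
      using inverse_Aut[OF struct] \<open>g \<in> flow_group \<Phi>\<close> by auto
    then have "type_act k (type_act g p) = p" "type_act g (type_act k p) = p" if "p \<in> S" for p
      using type_act_inverse[OF type_space_fmls[OF that], of k g]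
        type_act_inverse[OF type_space_fmls[OF that], of g k] by blast+
    then show ?thesis
      using k(1) by (intro bexI[of _ k]) simp_all
  qed
qed

lemma mem_of_mem_closure:
  assumes y: "y \<in> flow_power \<Phi> A closure_of Q" and i: "i \<in> A" and \<phi>: "\<phi> \<in> fmls L (I <+> univ M)"
    and Q: "\<And>w. w \<in> Q \<Longrightarrow> w \<in> A \<rightarrow>\<^sub>E S \<and> \<phi> \<in> w i"
  shows "\<phi> \<in> y i"
proof -
  have "closedin (flow_power \<Phi> A) {w \<in> topspace (flow_power \<Phi> A). w i \<in> stone_basic L I \<pi> M \<phi>}"
    using closedin_continuous_map_preimage[OF continuous_map_product_projection[OF i]
        closedin_stone_basic[OF \<phi>]] by simp
  moreover have "Q \<subseteq> {w \<in> topspace (flow_power \<Phi> A). w i \<in> stone_basic L I \<pi> M \<phi>}"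
    using Q i by (auto simp: topspace_stone_topology)
  ultimately show ?thesis
    using y closure_of_minimal by blast
qed

lemma type_tuple_eqI:
  assumes "x \<in> A \<rightarrow>\<^sub>E S" "y \<in> A \<rightarrow>\<^sub>E S" "\<And>i \<phi>. i \<in> A \<Longrightarrow> \<phi> \<in> x i \<Longrightarrow> \<phi> \<in> y i"
  shows "x = y"
  using assms by (intro PiE_ext[OF assms(1,2)] type_space_eqI) auto

definition agreeing :: "'j set \<Rightarrow> ('j \<Rightarrow> ('f, 'p, 'i + 'a) fm set) set \<Rightarrow> 'a set
    \<Rightarrow> ('j \<Rightarrow> ('f, 'p, 'i + 'a) fm set) set \<Rightarrow> ('j \<Rightarrow> ('f, 'p, 'i + 'a) fm set) set" where
  "agreeing A Z a U = {z \<in> Z. \<exists>w\<in>U. agree_over L I A a w z}"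

lemma agreeing_antimono: "a \<subseteq> b \<Longrightarrow> V \<subseteq> U \<Longrightarrow> agreeing A Z b V \<subseteq> agreeing A Z a U"
  unfolding agreeing_def by (blast intro: agree_over_mono)

lemma agreeing_nonempty:
  assumes "x \<in> flow_power \<Phi> A closure_of {w \<in> A \<rightarrow>\<^sub>E S. \<exists>z\<in>Z. agree_over L I A a w z}"
    and "openin (flow_power \<Phi> A) U" "x \<in> U"
  shows "agreeing A Z a U \<noteq> {}"
proof -
  have "\<exists>w\<in>{w \<in> A \<rightarrow>\<^sub>E S. \<exists>z\<in>Z. agree_over L I A a w z}. w \<in> U"
    using assms unfolding in_closure_of by blast
  then show ?thesis
    unfolding agreeing_def by blast
qed

lemma agreeing_cluster_point:
  assumes Z: "closedin (flow_power \<Phi> A) Z" and x: "x \<in> A \<rightarrow>\<^sub>E S"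
    and approximated: "\<And>a. finite a \<Longrightarrow> a \<subseteq> univ M \<Longrightarrow>
      x \<in> flow_power \<Phi> A closure_of {w \<in> A \<rightarrow>\<^sub>E S. \<exists>z\<in>Z. agree_over L I A a w z}"
  shows "\<exists>y\<in>Z. \<forall>a U. finite a \<and> a \<subseteq> univ M \<and> openin (flow_power \<Phi> A) U \<and> x \<in> U \<longrightarrow>
    y \<in> flow_power \<Phi> A closure_of agreeing A Z a U"
proof -
  let ?J = "{(a, U). finite a \<and> a \<subseteq> univ M \<and> openin (flow_power \<Phi> A) U \<and> x \<in> U}"
  let ?K = "\<lambda>(a, U). agreeing A Z a U"
  have top: "({}, A \<rightarrow>\<^sub>E S) \<in> ?J"
    using x openin_topspace[of "flow_power \<Phi> A"] by (simp add: topspace_stone_topology)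
  have "\<exists>y\<in>topspace (flow_power \<Phi> A). \<forall>j\<in>?J. y \<in> flow_power \<Phi> A closure_of ?K j"
  proof (rule compact_space_cluster_point[OF compact_power])
    show "?J \<noteq> {}"
      using top by blast
    show "?K j \<subseteq> topspace (flow_power \<Phi> A) \<and> ?K j \<noteq> {}" if j: "j \<in> ?J" for j
    proof -
      obtain a U where aU: "j = (a, U)" "finite a" "a \<subseteq> univ M" "openin (flow_power \<Phi> A) U" "x \<in> U"
        using j by blast
      have "agreeing A Z a U \<subseteq> Z"
        unfolding agreeing_def by (rule Collect_restrict)
      then show ?thesis
        using closedin_subset[OF Z] agreeing_nonempty[OF approximated[OF aU(2,3)] aU(4,5)] aU(1) by simp
    qed
    show "\<exists>k\<in>?J. ?K k \<subseteq> ?K i \<inter> ?K j" if ij: "i \<in> ?J" "j \<in> ?J" for i j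
    proof -
      have "(fst i \<union> fst j, snd i \<inter> snd j) \<in> ?J"
        using ij by (auto intro: openin_Int)
      moreover have "?K (fst i \<union> fst j, snd i \<inter> snd j) \<subseteq> ?K i \<inter> ?K j"
        by (simp add: case_prod_unfold agreeing_antimono)
      ultimately show ?thesis
        by (rule rev_bexI)
    qed
  qed
  then obtain y where y: "\<forall>j\<in>?J. y \<in> flow_power \<Phi> A closure_of ?K j"
    by blast
  have "?K ({}, A \<rightarrow>\<^sub>E S) \<subseteq> Z"
    by (auto simp: agreeing_def)
  then have "y \<in> Z"
    using closure_of_minimal[OF _ Z] bspec[OF y top] by blast
  moreover have "y \<in> flow_power \<Phi> A closure_of agreeing A Z a U"
    if "finite a \<and> a \<subseteq> univ M \<and> openin (flow_power \<Phi> A) U \<and> x \<in> U" for a U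
    using bspec[OF y, of "(a, U)"] that by simp
  ultimately show ?thesis
    by blast
qed

lemma mem_closed_if_approximated:
  assumes Z: "closedin (flow_power \<Phi> A) Z" and x: "x \<in> A \<rightarrow>\<^sub>E S"
    and approximated: "\<And>a. finite a \<Longrightarrow> a \<subseteq> univ M \<Longrightarrow>
      x \<in> flow_power \<Phi> A closure_of {w \<in> A \<rightarrow>\<^sub>E S. \<exists>z\<in>Z. agree_over L I A a w z}"
  shows "x \<in> Z"
proof -
  have ZS: "Z \<subseteq> A \<rightarrow>\<^sub>E S"
    using closedin_subset[OF Z] by (simp add: topspace_stone_topology)
  obtain y where y: "y \<in> Z" "\<forall>a U. finite a \<and> a \<subseteq> univ M \<and> openin (flow_power \<Phi> A) U \<and> x \<in> U \<longrightarrow>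
      y \<in> flow_power \<Phi> A closure_of agreeing A Z a U"
    using agreeing_cluster_point[OF Z x approximated] by (rule bexE)
  have "x = y"
  proof (rule type_tuple_eqI[OF x])
    show "y \<in> A \<rightarrow>\<^sub>E S"
      using y(1) ZS by blast
    fix i \<phi> assume i: "i \<in> A" and \<phi>x: "\<phi> \<in> x i"
    have xi: "x i \<in> S"
      using x i by auto
    then have \<phi>: "\<phi> \<in> fmls L (I <+> univ M)"
      using type_space_fmls \<phi>x by blast
    then obtain a where a: "finite a" "a \<subseteq> univ M" "\<phi> \<in> fmls L (I <+> a)"
      by (rule finite_parameters)
    let ?U = "{w \<in> topspace (flow_power \<Phi> A). w i \<in> stone_basic L I \<pi> M \<phi>}"
    have "openin (flow_power \<Phi> A) ?U"
      using openin_continuous_map_preimage[OF continuous_map_product_projection[OF i]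
          openin_stone_basic[OF \<phi>]] by simp
    moreover have "x \<in> ?U"
      using x xi \<phi>x by (simp add: topspace_stone_topology)
    ultimately have "y \<in> flow_power \<Phi> A closure_of agreeing A Z a ?U"
      using y(2) a(1,2) by blast
    then show "\<phi> \<in> y i"
    proof (rule mem_of_mem_closure[OF _ i \<phi>])
      fix z assume "z \<in> agreeing A Z a ?U"
      then obtain w where "z \<in> Z" "\<phi> \<in> w i" "agree_over L I A a w z"
        by (auto simp: agreeing_def)
      then show "z \<in> A \<rightarrow>\<^sub>E S \<and> \<phi> \<in> z i"
        using ZS agree_over_memD[OF _ i a(3)] by blast
    qed
  qed
  then show ?thesis
    using y(1) by simp
qed

lemma mem_closed_if_agree:
  assumes Z: "closedin (flow_power \<Phi> A) Z" and x: "x \<in> A \<rightarrow>\<^sub>E S"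
    and "\<And>a. finite a \<Longrightarrow> a \<subseteq> univ M \<Longrightarrow> \<exists>z\<in>Z. agree_over L I A a x z"
  shows "x \<in> Z"
proof (rule mem_closed_if_approximated[OF Z x])
  fix a assume "finite a" "a \<subseteq> univ M"
  then have "x \<in> {w \<in> A \<rightarrow>\<^sub>E S. \<exists>z\<in>Z. agree_over L I A a w z}"
    using assms(3) x by blast
  then show "x \<in> flow_power \<Phi> A closure_of {w \<in> A \<rightarrow>\<^sub>E S. \<exists>z\<in>Z. agree_over L I A a w z}"
    by (rule rev_subsetD) (auto intro!: closure_of_subset simp: topspace_stone_topology)
qed

end

section \<open>Saturation and homogeneity\<close>

lemma finite_ordLess_natLeq: "finite A \<Longrightarrow> |A| <o natLeq"
  by (simp add: finite_iff_ordLess_natLeq)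

lemma complete_type_of_tuple:
  assumes elementary: "elementary_substruct L C C'" and nonempty: "univ C \<noteq> {}"
    and A: "A \<subseteq> univ C" and f: "f \<in> I \<rightarrow> univ C'"
  shows "complete_type L C I A {\<phi> \<in> fmls L (I <+> A). holds C' (case_sum f (\<lambda>a. a)) \<phi>}"
    (is "complete_type L C I A ?p")
proof -
  have "fmls L (I <+> A) \<subseteq> fmls L (I <+> univ C)"
    using A by (intro fmls_mono) auto
  then have "?p \<subseteq> fmls L (I <+> univ C)"
    by auto
  moreover have "realized C' I ?p"
    unfolding realized_def using f by (intro bexI[of _ f]) simp_all
  ultimately have "realized C I q" if "finite q" "q \<subseteq> ?p" for q
    using realized_elementary_substruct[OF elementary nonempty that(1) subset_trans[OF that(2)]]
      realized_mono[OF _ that(2)] by blast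
  moreover have "\<phi> \<in> ?p \<or> Neg \<phi> \<in> ?p" if "\<phi> \<in> fmls L (I <+> A)" for \<phi>
    using that by (cases "holds C' (case_sum f (\<lambda>a. a)) \<phi>") simp_all
  ultimately show ?thesis
    unfolding complete_type_def partial_type_iff by blast
qed

lemma saturated_realizes_type_of_tuple:
  fixes n :: nat
  assumes elementary: "elementary_substruct L C C'" and nonempty: "univ C \<noteq> {}"
    and saturated: "saturated natLeq L C"
    and A: "finite A" "A \<subseteq> univ C" and f: "f \<in> {..<n} \<rightarrow> univ C'"
  shows "\<exists>d\<in>{..<n} \<rightarrow> univ C. \<forall>\<phi>\<in>fmls L ({..<n} <+> A).
    holds C' (case_sum f (\<lambda>a. a)) \<phi> \<longleftrightarrow> holds C (case_sum d (\<lambda>a. a)) \<phi>"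
proof -
  define p where "p = {\<phi> \<in> fmls L ({..<n} <+> A). holds C' (case_sum f (\<lambda>a. a)) \<phi>}"
  have "complete_type L C {..<n} A p"
    unfolding p_def by (rule complete_type_of_tuple[OF elementary nonempty A(2) f])
  then have "realized C {..<n} p"
    using saturated A finite_ordLess_natLeq unfolding saturated_def by blast
  then obtain d where d: "d \<in> {..<n} \<rightarrow> univ C" "\<forall>\<phi>\<in>p. holds C (case_sum d (\<lambda>a. a)) \<phi>"
    by (auto simp: realized_def)
  have "holds C' (case_sum f (\<lambda>a. a)) \<phi> \<longleftrightarrow> holds C (case_sum d (\<lambda>a. a)) \<phi>"
    if \<phi>: "\<phi> \<in> fmls L ({..<n} <+> A)" for \<phi>
  proof (cases "holds C' (case_sum f (\<lambda>a. a)) \<phi>")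
    case True
    then show ?thesis
      using \<phi> d(2) by (simp add: p_def)
  next
    case False
    then have "Neg \<phi> \<in> p"
      using \<phi> by (simp add: p_def)
    then show ?thesis
      using False d(2) by force
  qed
  then show ?thesis
    using d(1) by blast
qed

lemma saturated_ex_partial_elementary_map:
  assumes elementary: "elementary_substruct L C C'" and nonempty: "univ C \<noteq> {}"
    and saturated: "saturated natLeq L C" and b: "finite b" "b \<subseteq> univ C'"
  shows "\<exists>g. partial_elementary_map L C' b g \<and> g ` b \<subseteq> univ C \<and> (\<forall>a\<in>b \<inter> univ C. g a = a)"
proof -
  obtain f and n :: nat where f: "bij_betw f {..<n} b"
    using ex_bij_betw_nat_finite[OF b(1)] by (auto simp: atLeast0LessThan)
  define j where "j = inv_into {..<n} f"
  have j: "j a \<in> {..<n}" "f (j a) = a" if "a \<in> b" for a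
    using bij_betw_apply[OF bij_betw_inv_into[OF f]] bij_betw_inv_into_right[OF f] that
    by (auto simp: j_def)
  have "f \<in> {..<n} \<rightarrow> univ C'"
    using bij_betw_apply[OF f] b(2) by auto
  then obtain d where d: "d \<in> {..<n} \<rightarrow> univ C" and same: "\<And>\<phi>. \<phi> \<in> fmls L ({..<n} <+> (b \<inter> univ C)) \<Longrightarrow>
      holds C' (case_sum f (\<lambda>a. a)) \<phi> \<longleftrightarrow> holds C (case_sum d (\<lambda>a. a)) \<phi>"
    using saturated_realizes_type_of_tuple[OF elementary nonempty saturated, of "b \<inter> univ C" f n] b(1)
    by auto
  have d_in: "(d \<circ> j) ` b \<subseteq> univ C"
    using d j(1) by auto
  have "partial_elementary_map L C' b (d \<circ> j)"
    unfolding partial_elementary_map_def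
  proof (intro conjI ballI b(2))
    show "(d \<circ> j) ` b \<subseteq> univ C'"
      using d_in elementary by (auto simp: elementary_substruct_def)
    fix \<phi> assume \<phi>: "\<phi> \<in> fmls L b"
    have "rename (\<lambda>a. Inl (j a)) \<phi> \<in> fmls L ({..<n} <+> (b \<inter> univ C))"
      by (rule rename_fmls[OF \<phi>]) (use j(1) in auto)
    from same[OF this] have "holds C' (f \<circ> j) \<phi> \<longleftrightarrow> holds C (d \<circ> j) \<phi>"
      by (simp add: holds_rename o_def)
    moreover have "holds C' (\<lambda>a. a) \<phi> \<longleftrightarrow> holds C' (f \<circ> j) \<phi>"
      by (rule holds_cong[OF \<phi>]) (simp add: j(2))
    ultimately show "holds C' (\<lambda>a. a) \<phi> \<longleftrightarrow> holds C' (d \<circ> j) \<phi>"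
      using elementary_holds[OF elementary \<phi> d_in] by simp
  qed
  moreover have "(d \<circ> j) a = a" if a: "a \<in> b \<inter> univ C" for a
  proof -
    have "Eq (Atom (Inl (j a))) (Atom (Inr a)) \<in> fmls L ({..<n} <+> (b \<inter> univ C))"
      using a j(1) by (auto simp: fmls_def)
    from same[OF this] show ?thesis
      using a j(2) by (simp add: holds_def)
  qed
  ultimately show ?thesis
    using d_in by blast
qed

lemma ex_Aut_move_into_substruct:
  assumes elementary: "elementary_substruct L C C'" and nonempty: "univ C \<noteq> {}"
    and saturated: "saturated natLeq L C" and homogeneous: "strongly_homogeneous natLeq L C'"
    and b: "finite b" "b \<subseteq> univ C'"
  shows "\<exists>\<sigma>\<in>Aut L C'. \<sigma> ` b \<subseteq> univ C \<and> (\<forall>a\<in>b \<inter> univ C. \<sigma> a = a)"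
proof -
  obtain g where g: "partial_elementary_map L C' b g" "g ` b \<subseteq> univ C" "\<forall>a\<in>b \<inter> univ C. g a = a"
    using saturated_ex_partial_elementary_map[OF elementary nonempty saturated b] by blast
  then obtain \<sigma> where \<sigma>: "\<sigma> \<in> Aut L C'" "\<forall>a\<in>b. \<sigma> a = g a"
    using homogeneous finite_ordLess_natLeq[OF b(1)] unfolding strongly_homogeneous_def by blast
  have "\<sigma> ` b = g ` b"
    using \<sigma>(2) by simp
  then show ?thesis
    using g(2,3) \<sigma> by (intro bexI[OF _ \<sigma>(1)]) simp
qed

lemma ex_Aut_transfer:
  assumes M: "is_struct L M" and homogeneous: "strongly_homogeneous natLeq L N"
    and same: "\<And>\<phi> v. \<phi> \<in> fmls L a \<Longrightarrow> v ` a \<subseteq> univ M \<inter> univ N \<Longrightarrow> holds M v \<phi> \<longleftrightarrow> holds N v \<phi>"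
    and \<sigma>: "\<sigma> \<in> Aut L M" and a: "finite a" "a \<subseteq> univ M \<inter> univ N" "\<sigma> ` a \<subseteq> univ N"
  shows "\<exists>\<rho>\<in>Aut L N. \<forall>x\<in>a. \<rho> x = \<sigma> x"
proof -
  have "partial_elementary_map L N a \<sigma>"
    unfolding partial_elementary_map_def
  proof (intro conjI ballI a(3))
    show "a \<subseteq> univ N"
      using a(2) by blast
    fix \<phi> assume \<phi>: "\<phi> \<in> fmls L a"
    have "holds N (\<lambda>x. x) \<phi> \<longleftrightarrow> holds M (\<lambda>x. x) \<phi>"
      using same[OF \<phi>, of "\<lambda>x. x"] a(2) by simp
    also have "\<dots> \<longleftrightarrow> holds M \<sigma> \<phi>"
      using holds_Aut[OF M \<sigma> \<phi>, of "\<lambda>x. x"] a(2) by (simp add: o_def)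
    also have "\<dots> \<longleftrightarrow> holds N \<sigma> \<phi>"
      using same[OF \<phi>, of \<sigma>] a(2,3) Aut_image[OF \<sigma>] by blast
    finally show "holds N (\<lambda>x. x) \<phi> \<longleftrightarrow> holds N \<sigma> \<phi>" .
  qed
  then show ?thesis
    using homogeneous finite_ordLess_natLeq[OF a(1)] unfolding strongly_homogeneous_def by blast
qed

section \<open>Types over an elementary extension\<close>

locale elementary_type_extension =
  base: type_space_flow L I \<pi> C + ext: type_space_flow L I \<pi> C'
  for L :: "('f, 'p) lang" and I :: "'i set" and \<pi> and C C' :: "('f, 'p, 'a) struct" +
  assumes elementary: "elementary_substruct L C C'"
begin

abbreviation "r \<equiv> type_restrict L I C"

lemma univ_subset: "univ C \<subseteq> univ C'"
  using elementary by (simp add: elementary_substruct_def)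

lemma univ_nonempty: "univ C \<noteq> {}"
  using base.struct by (simp add: is_struct_def)

lemma fmls_subset: "fmls L (I <+> univ C) \<subseteq> fmls L (I <+> univ C')"
  using univ_subset by (intro fmls_mono) auto

lemma restrict_type_space:
  assumes p: "p \<in> ext.S"
  shows "r p \<in> base.S"
proof -
  have "realized C I q" if "finite q" "q \<subseteq> r p" for q
    using that type_space_realized[OF p that(1)]
    by (intro realized_elementary_substruct[OF elementary univ_nonempty]) (auto simp: type_restrict_def)
  moreover have "\<pi> \<subseteq> r p"
    using p base.\<pi>_fmls fmls_mono[of "I <+> {}" "I <+> univ C" L]
    by (auto simp: type_restrict_def type_space_def)
  moreover have "\<phi> \<in> r p \<or> Neg \<phi> \<in> r p" if "\<phi> \<in> fmls L (I <+> univ C)" for \<phi>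
    using type_space_Neg[OF p, of \<phi>] that fmls_subset by (auto simp: type_restrict_def)
  ultimately show ?thesis
    by (auto simp: type_space_def complete_type_def partial_type_iff type_restrict_def)
qed

lemma restrict_onto: "r ` ext.S = base.S"
proof (intro subset_antisym subsetI)
  fix p assume p: "p \<in> base.S"
  have "partial_type L C' I (univ C') p"
    using type_space_fmls[OF p] fmls_subset type_space_realized[OF p]
      realized_elementary_extension[OF elementary] unfolding partial_type_iff by (meson order_trans)
  then obtain p' where p': "complete_type L C' I (univ C') p'" "p \<subseteq> p'"
    by (rule partial_type_extend)
  then have p'S: "p' \<in> ext.S"
    using p by (auto simp: type_space_def)
  have "p \<subseteq> r p'"
    using p'(2) type_space_fmls[OF p] by (auto simp: type_restrict_def)
  then have "p = r p'"
    by (rule type_space_eqI[OF p restrict_type_space[OF p'S]])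
  then show "p \<in> r ` ext.S"
    using p'S by blast
qed (auto intro: restrict_type_space)

lemma continuous_map_restrict:
  "continuous_map (stone_topology L I \<pi> C') (stone_topology L I \<pi> C) r"
proof (rule continuous_map_stone_topology)
  show "r \<in> topspace (stone_topology L I \<pi> C') \<rightarrow> base.S"
    using restrict_type_space by (simp add: topspace_stone_topology)
  fix \<phi> assume \<phi>: "\<phi> \<in> fmls L (I <+> univ C)"
  then have "{p \<in> ext.S. \<phi> \<in> r p} = stone_basic L I \<pi> C' \<phi>"
    by (auto simp: type_restrict_def)
  then show "openin (stone_topology L I \<pi> C') {p \<in> topspace (stone_topology L I \<pi> C'). \<phi> \<in> r p}"
    using openin_stone_basic[of \<phi> L I C' \<pi>] \<phi> fmls_subset by (auto simp: topspace_stone_topology)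
qed

lemma compose_restrict_PiE: "x \<in> A \<rightarrow>\<^sub>E ext.S \<Longrightarrow> compose A r x \<in> A \<rightarrow>\<^sub>E base.S"
  by (rule compose_mem_PiE) (auto intro: restrict_type_space)

lemma agree_over_restrict:
  assumes "a \<subseteq> univ C"
  shows "agree_over L I A a (compose A r x) x"
proof -
  have "fmls L (I <+> a) \<subseteq> fmls L (I <+> univ C)"
    using assms by (intro fmls_mono) auto
  then show ?thesis
    by (auto simp: agree_over_def compose_eq type_restrict_def)
qed

end

locale homogeneous_type_extension = elementary_type_extension L I \<pi> C C'
  for L :: "('f, 'p) lang" and I :: "'i set" and \<pi> and C C' :: "('f, 'p, 'a) struct" +
  assumes saturated: "saturated natLeq L C"
    and homogeneous: "strongly_homogeneous natLeq L C"
    and homogeneous': "strongly_homogeneous natLeq L C'"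
begin

lemma ex_Aut_extend:
  assumes \<rho>: "\<rho> \<in> Aut L C" and a: "finite a" "a \<subseteq> univ C"
  shows "\<exists>\<sigma>\<in>Aut L C'. \<forall>x\<in>a. \<sigma> x = \<rho> x"
proof (rule ex_Aut_transfer[OF base.struct homogeneous' _ \<rho> a(1)])
  show "holds C v \<phi> \<longleftrightarrow> holds C' v \<phi>" if "\<phi> \<in> fmls L a" "v ` a \<subseteq> univ C \<inter> univ C'" for \<phi> v
    using elementary_holds[OF elementary that(1)] that(2) by simp
  show "a \<subseteq> univ C \<inter> univ C'" "\<rho> ` a \<subseteq> univ C'"
    using a(2) univ_subset Aut_image[OF \<rho>] by auto
qed

lemma ex_Aut_reflect:
  assumes \<sigma>: "\<sigma> \<in> Aut L C'" and a: "finite a" "a \<subseteq> univ C" "\<sigma> ` a \<subseteq> univ C"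
  shows "\<exists>\<rho>\<in>Aut L C. \<forall>x\<in>a. \<rho> x = \<sigma> x"
proof (rule ex_Aut_transfer[OF ext.struct homogeneous _ \<sigma> a(1) _ a(3)])
  show "holds C' v \<phi> \<longleftrightarrow> holds C v \<phi>" if "\<phi> \<in> fmls L a" "v ` a \<subseteq> univ C' \<inter> univ C" for \<phi> v
    using elementary_holds[OF elementary that(1)] that(2) by simp
  show "a \<subseteq> univ C' \<inter> univ C"
    using a(2) univ_subset by auto
qed

lemma ex_Aut_agree_over_restrict:
  assumes \<rho>: "\<rho> \<in> Aut L C" and x: "x \<in> A \<rightarrow>\<^sub>E ext.S" and b: "finite b" "b \<subseteq> univ C"
  shows "\<exists>\<sigma>\<in>Aut L C'. agree_over L I A (\<rho> ` b)
    (compose A (type_act \<rho>) (compose A r x)) (compose A (type_act \<sigma>) x)"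
proof -
  obtain \<sigma> where \<sigma>: "\<sigma> \<in> Aut L C'" "\<forall>c\<in>b. \<sigma> c = \<rho> c"
    using ex_Aut_extend[OF \<rho> b] by blast
  have "agree_over L I A (\<rho> ` b) (compose A (type_act \<rho>) (compose A r x)) (compose A (type_act \<sigma>) x)"
    using b(2) univ_subset \<sigma>(2)
    by (intro agree_over_act[OF compose_restrict_PiE[OF x] x \<rho> \<sigma>(1)] agree_over_restrict) auto
  then show ?thesis
    using \<sigma>(1) by blast
qed

lemma closed_invariant_image_restrict:
  assumes Z: "closed_invariant ext.\<Phi> A Z"
  shows "closed_invariant base.\<Phi> A (compose A r ` Z)"
  unfolding closed_invariant_def
proof (intro conjI ballI)
  have "closed_map (flow_power ext.\<Phi> A) (flow_power base.\<Phi> A) (compose A r)"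
    using continuous_map_compose_left[OF continuous_map_restrict] ext.compact_power[of A]
      base.Hausdorff_power[of A]
    by (intro continuous_imp_closed_map) simp_all
  then show closed: "closedin (flow_power base.\<Phi> A) (compose A r ` Z)"
    using closed_invariant_closedin[OF Z] unfolding closed_map_def by blast
  fix \<rho> y assume "\<rho> \<in> flow_group base.\<Phi>" and "y \<in> compose A r ` Z"
  then obtain x where \<rho>: "\<rho> \<in> Aut L C" and x: "x \<in> Z" "y = compose A r x"
    by auto
  have xS: "x \<in> A \<rightarrow>\<^sub>E ext.S"
    using subsetD[OF closed_invariant_subset[OF Z] x(1)] by simp
  have "compose A (type_act \<rho>) y \<in> compose A r ` Z"
  proof (rule base.mem_closed_if_agree[OF closed])
    show "compose A (type_act \<rho>) y \<in> A \<rightarrow>\<^sub>E base.S"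
      using base.compose_act_PiE[of \<rho> y A] \<rho> compose_restrict_PiE[OF xS] x(2) by simp
    fix a assume a: "finite a" "a \<subseteq> univ C"
    then obtain b where b: "b \<subseteq> univ C" "finite b" "a = \<rho> ` b"
      using finite_subset_image[of a \<rho> "univ C"] Aut_image[OF \<rho>] by auto
    obtain \<sigma> where \<sigma>: "\<sigma> \<in> Aut L C'"
      "agree_over L I A a (compose A (type_act \<rho>) y) (compose A (type_act \<sigma>) x)"
      using ex_Aut_agree_over_restrict[OF \<rho> xS b(2,1)] unfolding b(3) x(2) by blast
    note \<sigma>(2)
    also have "agree_over L I A a (compose A (type_act \<sigma>) x) (compose A r (compose A (type_act \<sigma>) x))"
      by (rule agree_over_sym[OF agree_over_restrict[OF a(2)]])
    finally show "\<exists>z\<in>compose A r ` Z. agree_over L I A a (compose A (type_act \<rho>) y) z"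
      using closed_invariant_act[OF Z _ x(1), of \<sigma>] \<sigma>(1) by auto
  qed
  then show "compose A (flow_act base.\<Phi> \<rho>) y \<in> compose A r ` Z"
    by simp
qed

lemma subset_if_image_restrict_subset:
  assumes Z: "closed_invariant ext.\<Phi> A Z" and W: "closed_invariant ext.\<Phi> A W"
    and subset: "compose A r ` Z \<subseteq> compose A r ` W"
  shows "Z \<subseteq> W"
proof
  have S: "Z \<subseteq> A \<rightarrow>\<^sub>E ext.S" "W \<subseteq> A \<rightarrow>\<^sub>E ext.S"
    using closed_invariant_subset[OF Z] closed_invariant_subset[OF W] by simp_all
  fix x assume x: "x \<in> Z"
  then have xS: "x \<in> A \<rightarrow>\<^sub>E ext.S"
    using S(1) by blast
  show "x \<in> W"
  proof (rule ext.mem_closed_if_agree[OF closed_invariant_closedin[OF W] xS])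
    fix b assume b: "finite b" "b \<subseteq> univ C'"
    obtain \<sigma> where \<sigma>: "\<sigma> \<in> Aut L C'" "\<sigma> ` b \<subseteq> univ C"
      using ex_Aut_move_into_substruct[OF elementary univ_nonempty saturated homogeneous' b]
      by (elim bexE conjE) (rule that)
    obtain \<tau> where \<tau>: "\<tau> \<in> Aut L C'" "\<And>a. a \<in> univ C' \<Longrightarrow> \<tau> (\<sigma> a) = a"
      by (rule inverse_Aut[OF ext.struct \<sigma>(1)]) (rule that)
    let ?\<sigma>x = "compose A (type_act \<sigma>) x"
    have \<sigma>x: "?\<sigma>x \<in> Z"
      using closed_invariant_act[OF Z _ x, of \<sigma>] \<sigma>(1) by simp
    then obtain w where w: "w \<in> W" "compose A r ?\<sigma>x = compose A r w"
      using subset by blast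
    have "agree_over L I A (\<sigma> ` b) ?\<sigma>x w"
      using agree_over_sym[OF agree_over_restrict[OF \<sigma>(2)]] agree_over_restrict[OF \<sigma>(2)] w(2)
        agree_over_trans by metis
    then have "agree_over L I A (\<tau> ` \<sigma> ` b) (compose A (type_act \<tau>) ?\<sigma>x) (compose A (type_act \<tau>) w)"
      using \<sigma>x w(1) S \<sigma>(2) univ_subset by (intro agree_over_act[OF _ _ \<tau>(1) \<tau>(1)]) auto
    moreover have "compose A (type_act \<tau>) ?\<sigma>x = x"
      by (rule compose_type_act_inverse[OF xS]) (rule \<tau>(2))
    moreover have "\<tau> ` \<sigma> ` b = b"
      using \<tau>(2) b(2) by force
    moreover have "compose A (type_act \<tau>) w \<in> W"
      using closed_invariant_act[OF W _ w(1), of \<tau>] \<tau>(1) by simp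
    ultimately show "\<exists>z\<in>W. agree_over L I A b x z"
      by metis
  qed
qed

text \<open>
  A cluster point of these sets, as \<open>b\<close> exhausts \<open>C'\<close>, is a lift of \<open>x\<close> all of whose conjugates
  restrict into every closed invariant set that contains \<open>x\<close>.
\<close>

definition conjugates :: "'j set \<Rightarrow> ('j \<Rightarrow> ('f, 'p, 'i + 'a) fm set) \<Rightarrow> 'a set
    \<Rightarrow> ('j \<Rightarrow> ('f, 'p, 'i + 'a) fm set) set" where
  "conjugates A x b = {y \<in> A \<rightarrow>\<^sub>E ext.S. \<exists>\<sigma>\<in>Aut L C'. \<sigma> ` b \<subseteq> univ C \<and> (\<forall>a\<in>b \<inter> univ C. \<sigma> a = a) \<and>
     agree_over L I A (\<sigma> ` b) (compose A (type_act \<sigma>) y) x}"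

lemma conjugates_subset: "conjugates A x b \<subseteq> A \<rightarrow>\<^sub>E ext.S"
  unfolding conjugates_def by (rule Collect_restrict)

lemma conjugatesE:
  assumes "y \<in> conjugates A x b"
  obtains \<sigma> where "y \<in> A \<rightarrow>\<^sub>E ext.S" "\<sigma> \<in> Aut L C'" "\<sigma> ` b \<subseteq> univ C" "\<forall>a\<in>b \<inter> univ C. \<sigma> a = a"
    "agree_over L I A (\<sigma> ` b) (compose A (type_act \<sigma>) y) x"
  using assms unfolding conjugates_def mem_Collect_eq by (elim conjE bexE) (rule that)

lemma conjugates_antimono:
  assumes "a \<subseteq> b"
  shows "conjugates A x b \<subseteq> conjugates A x a"
proof
  fix y assume "y \<in> conjugates A x b"
  then obtain \<sigma> where y: "y \<in> A \<rightarrow>\<^sub>E ext.S" and \<sigma>: "\<sigma> \<in> Aut L C'" "\<sigma> ` b \<subseteq> univ C" "\<forall>c\<in>b \<inter> univ C. \<sigma> c = c"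
    and agree: "agree_over L I A (\<sigma> ` b) (compose A (type_act \<sigma>) y) x"
    by (rule conjugatesE)
  have "\<sigma> ` a \<subseteq> univ C" "\<forall>c\<in>a \<inter> univ C. \<sigma> c = c"
    using \<sigma>(2,3) assms by blast+
  moreover have "agree_over L I A (\<sigma> ` a) (compose A (type_act \<sigma>) y) x"
    by (rule agree_over_mono[OF agree image_mono[OF assms]])
  ultimately show "y \<in> conjugates A x a"
    unfolding conjugates_def mem_Collect_eq by (intro conjI y bexI[OF _ \<sigma>(1)])
qed

lemma conjugates_nonempty:
  assumes x: "x \<in> A \<rightarrow>\<^sub>E base.S" and b: "finite b" "b \<subseteq> univ C'"
  shows "conjugates A x b \<noteq> {}"
proof -
  obtain \<sigma> where \<sigma>: "\<sigma> \<in> Aut L C'" "\<sigma> ` b \<subseteq> univ C" "\<forall>a\<in>b \<inter> univ C. \<sigma> a = a"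
    using ex_Aut_move_into_substruct[OF elementary univ_nonempty saturated homogeneous' b]
    by (elim bexE conjE) (rule that)
  obtain \<tau> where \<tau>: "\<tau> \<in> Aut L C'" "\<And>a. a \<in> univ C' \<Longrightarrow> \<sigma> (\<tau> a) = a"
    by (rule inverse_Aut[OF ext.struct \<sigma>(1)]) (rule that)
  have "x \<in> compose A r ` (A \<rightarrow>\<^sub>E ext.S)"
    unfolding compose_image_PiE[OF restrict_onto] by (rule x)
  then obtain x' where x': "x = compose A r x'" "x' \<in> A \<rightarrow>\<^sub>E ext.S"
    by (rule imageE)
  have y: "compose A (type_act \<tau>) x' \<in> A \<rightarrow>\<^sub>E ext.S"
    using ext.compose_act_PiE[of \<tau> x' A] \<tau>(1) x'(2) by simp
  have "compose A (type_act \<sigma>) (compose A (type_act \<tau>) x') = x'"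
    by (rule compose_type_act_inverse[OF x'(2)]) (rule \<tau>(2))
  then have agree: "agree_over L I A (\<sigma> ` b) (compose A (type_act \<sigma>) (compose A (type_act \<tau>) x')) x"
    unfolding x'(1) using agree_over_sym[OF agree_over_restrict[OF \<sigma>(2)]] by simp
  have "compose A (type_act \<tau>) x' \<in> conjugates A x b"
    unfolding conjugates_def mem_Collect_eq by (intro conjI y bexI[OF _ \<sigma>(1)] \<sigma>(2,3) agree)
  then show ?thesis
    by (metis empty_iff)
qed

lemma conjugates_agree_over:
  assumes y: "y \<in> conjugates A x a" and a: "a \<subseteq> univ C"
  shows "agree_over L I A a y x"
proof -
  obtain \<sigma> where yS: "y \<in> A \<rightarrow>\<^sub>E ext.S" and \<sigma>: "\<sigma> \<in> Aut L C'" "\<sigma> ` a \<subseteq> univ C" "\<forall>c\<in>a \<inter> univ C. \<sigma> c = c"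
    and agree: "agree_over L I A (\<sigma> ` a) (compose A (type_act \<sigma>) y) x"
    using y by (rule conjugatesE)
  have fixed: "\<sigma> c = c" if "c \<in> a" for c
    using that a \<sigma>(3) by blast
  have "agree_over L I A a y (compose A (type_act \<sigma>) y)"
    using a univ_subset by (intro agree_over_sym[OF agree_over_act_fixed[OF yS \<sigma>(1)]] fixed) simp_all
  also have "agree_over L I A a (compose A (type_act \<sigma>) y) x"
    using agree fixed by simp
  finally show ?thesis .
qed

lemma conjugates_act_agree_over:
  assumes Z: "closed_invariant base.\<Phi> A Z" and x: "x \<in> Z" and y: "y \<in> conjugates A x b"
    and b: "finite b" "b \<subseteq> univ C'" and \<tau>: "\<tau> \<in> Aut L C'" "\<tau> ` b \<subseteq> univ C"
  shows "\<exists>z\<in>Z. agree_over L I A (\<tau> ` b) (compose A (type_act \<tau>) y) z"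
proof -
  obtain \<sigma> where yS: "y \<in> A \<rightarrow>\<^sub>E ext.S" and \<sigma>: "\<sigma> \<in> Aut L C'" "\<sigma> ` b \<subseteq> univ C" "\<forall>c\<in>b \<inter> univ C. \<sigma> c = c"
    and agree: "agree_over L I A (\<sigma> ` b) (compose A (type_act \<sigma>) y) x"
    using y by (rule conjugatesE)
  obtain \<sigma>' where \<sigma>': "\<sigma>' \<in> Aut L C'" "\<And>a. a \<in> univ C' \<Longrightarrow> \<sigma>' (\<sigma> a) = a"
    by (rule inverse_Aut[OF ext.struct \<sigma>(1)]) (rule that)
  let ?\<theta> = "compose (univ C') \<tau> \<sigma>'"
  have \<theta>: "?\<theta> \<in> Aut L C'"
    by (rule compose_Aut[OF ext.struct \<tau>(1) \<sigma>'(1)])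
  have "?\<theta> (\<sigma> a) = \<tau> a" if "a \<in> b" for a
    using that b(2) \<sigma>'(2) Aut_closed[OF \<sigma>(1)] by (simp add: compose_eq subset_iff)
  then have image: "?\<theta> ` \<sigma> ` b = \<tau> ` b"
    by (simp add: image_image)
  have xS: "x \<in> A \<rightarrow>\<^sub>E base.S" and \<sigma>yS: "compose A (type_act \<sigma>) y \<in> A \<rightarrow>\<^sub>E ext.S"
    using closed_invariant_subset[OF Z] x ext.compose_act_PiE[of \<sigma> y A] \<sigma>(1) yS by auto
  have "finite (\<sigma> ` b)" "?\<theta> ` \<sigma> ` b \<subseteq> univ C"
    using b(1) \<tau>(2) image by simp_all
  from ex_Aut_reflect[OF \<theta> this(1) \<sigma>(2) this(2)]
  obtain \<rho> where \<rho>: "\<rho> \<in> Aut L C" "\<forall>a\<in>\<sigma> ` b. \<rho> a = ?\<theta> a"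
    by (rule bexE)
  have "agree_over L I A (?\<theta> ` \<sigma> ` b) (compose A (type_act ?\<theta>) (compose A (type_act \<sigma>) y))
      (compose A (type_act \<rho>) x)"
    using subset_trans[OF \<sigma>(2) univ_subset] \<sigma>(2) bspec[OF \<rho>(2), symmetric] agree
    by (rule agree_over_act[OF \<sigma>yS xS \<theta> \<rho>(1)])
  moreover have "compose A (type_act ?\<theta>) (compose A (type_act \<sigma>) y) = compose A (type_act \<tau>) y"
    unfolding compose_type_act_compose[OF \<sigma>yS]
    using compose_type_act_inverse[OF yS, of \<sigma>' \<sigma>] \<sigma>'(2) by simp
  moreover have "compose A (type_act \<rho>) x \<in> Z"
    using closed_invariant_act[OF Z _ x, of \<rho>] \<rho>(1) by simp
  ultimately show ?thesis
    using image by (intro bexI[of _ "compose A (type_act \<rho>) x"]) simp_all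
qed

lemma conjugates_cluster_point:
  assumes x: "x \<in> A \<rightarrow>\<^sub>E base.S"
  shows "\<exists>y\<in>A \<rightarrow>\<^sub>E ext.S. \<forall>b. finite b \<and> b \<subseteq> univ C' \<longrightarrow>
    y \<in> flow_power ext.\<Phi> A closure_of conjugates A x b"
proof -
  let ?J = "{b. finite b \<and> b \<subseteq> univ C'}"
  have "\<exists>y\<in>topspace (flow_power ext.\<Phi> A). \<forall>b\<in>?J. y \<in> flow_power ext.\<Phi> A closure_of conjugates A x b"
  proof (rule compact_space_cluster_point[OF ext.compact_power])
    show "?J \<noteq> {}"
      by blast
    show "conjugates A x b \<subseteq> topspace (flow_power ext.\<Phi> A) \<and> conjugates A x b \<noteq> {}" if "b \<in> ?J" for b
      using that conjugates_nonempty[OF x] conjugates_subset[of A x b]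
      by (simp add: topspace_stone_topology)
    show "\<exists>c\<in>?J. conjugates A x c \<subseteq> conjugates A x a \<inter> conjugates A x b"
      if "a \<in> ?J" "b \<in> ?J" for a b
      using that by (intro bexI[of _ "a \<union> b"] Int_greatest conjugates_antimono) simp_all
  qed
  then show ?thesis
    by (simp add: topspace_stone_topology)
qed

lemma restrict_conjugates_closure:
  assumes x: "x \<in> A \<rightarrow>\<^sub>E base.S" and y: "y \<in> A \<rightarrow>\<^sub>E ext.S"
    and closure: "\<And>b. finite b \<Longrightarrow> b \<subseteq> univ C' \<Longrightarrow> y \<in> flow_power ext.\<Phi> A closure_of conjugates A x b"
  shows "compose A r y = x"
proof (rule base.type_tuple_eqI[OF x compose_restrict_PiE[OF y], symmetric])
  fix i \<phi> assume i: "i \<in> A" and \<phi>x: "\<phi> \<in> x i"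
  have \<phi>: "\<phi> \<in> fmls L (I <+> univ C)"
    by (rule subsetD[OF type_space_fmls[OF PiE_mem[OF x i]] \<phi>x])
  then obtain a where a: "finite a" "a \<subseteq> univ C" "\<phi> \<in> fmls L (I <+> a)"
    by (rule finite_parameters)
  have "\<phi> \<in> y i"
  proof (rule ext.mem_of_mem_closure[OF closure[OF a(1) subset_trans[OF a(2) univ_subset]] i])
    show "\<phi> \<in> fmls L (I <+> univ C')"
      by (rule subsetD[OF fmls_subset \<phi>])
    show "w \<in> A \<rightarrow>\<^sub>E ext.S \<and> \<phi> \<in> w i" if "w \<in> conjugates A x a" for w
      using subsetD[OF conjugates_subset that] \<phi>x
        agree_over_memD[OF conjugates_agree_over[OF that a(2)] i a(3)] by simp
  qed
  then show "\<phi> \<in> compose A r y i"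
    using i \<phi> by (simp add: compose_eq type_restrict_def)
qed

definition lift_closed :: "'j set \<Rightarrow> ('j \<Rightarrow> ('f, 'p, 'i + 'a) fm set) set
    \<Rightarrow> ('j \<Rightarrow> ('f, 'p, 'i + 'a) fm set) set" where
  "lift_closed A Z = {y \<in> A \<rightarrow>\<^sub>E ext.S. \<forall>\<tau>\<in>Aut L C'. compose A r (compose A (type_act \<tau>) y) \<in> Z}"

lemma continuous_map_restrict_act:
  assumes "\<tau> \<in> Aut L C'"
  shows "continuous_map (flow_power ext.\<Phi> A) (flow_power base.\<Phi> A)
    (\<lambda>y. compose A r (compose A (type_act \<tau>) y))"
  using continuous_map_compose[OF continuous_map_compose_left[OF ext.continuous_map_type_act[OF assms]]
      continuous_map_compose_left[OF continuous_map_restrict], of A]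
  by (simp add: o_def)

lemma closed_invariant_lift_closed:
  assumes Z: "closed_invariant base.\<Phi> A Z"
  shows "closed_invariant ext.\<Phi> A (lift_closed A Z)"
  unfolding closed_invariant_def
proof (intro conjI ballI)
  have "Aut L C' \<noteq> {}"
    using id_Aut[OF ext.struct] by blast
  then have "lift_closed A Z = (\<Inter>\<tau>\<in>Aut L C'. {y \<in> topspace (flow_power ext.\<Phi> A).
      compose A r (compose A (type_act \<tau>) y) \<in> Z})"
    unfolding lift_closed_def topspace_product_topology stone_flow_simps topspace_stone_topology by blast
  moreover have "closedin (flow_power ext.\<Phi> A) (\<Inter>\<tau>\<in>Aut L C'. {y \<in> topspace (flow_power ext.\<Phi> A).
      compose A r (compose A (type_act \<tau>) y) \<in> Z})"
    using \<open>Aut L C' \<noteq> {}\<close> closed_invariant_closedin[OF Z]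
    by (intro closedin_INT closedin_continuous_map_preimage[OF continuous_map_restrict_act])
  ultimately show "closedin (flow_power ext.\<Phi> A) (lift_closed A Z)"
    by simp
  fix \<sigma> y assume "\<sigma> \<in> flow_group ext.\<Phi>" and y: "y \<in> lift_closed A Z"
  then have \<sigma>: "\<sigma> \<in> Aut L C'" and yS: "y \<in> A \<rightarrow>\<^sub>E ext.S"
    by (simp_all add: lift_closed_def)
  have "compose A r (compose A (type_act \<tau>) (compose A (type_act \<sigma>) y)) \<in> Z" if \<tau>: "\<tau> \<in> Aut L C'" for \<tau>
    using y compose_Aut[OF ext.struct \<tau> \<sigma>]
    unfolding lift_closed_def mem_Collect_eq compose_type_act_compose[OF yS, symmetric] by blast
  then show "compose A (flow_act ext.\<Phi> \<sigma>) y \<in> lift_closed A Z"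
    using ext.compose_act_PiE[of \<sigma> y A] \<sigma> yS by (simp add: lift_closed_def)
qed

lemma conjugates_closure_lift_closed:
  assumes Z: "closed_invariant base.\<Phi> A Z" and x: "x \<in> Z" and y: "y \<in> A \<rightarrow>\<^sub>E ext.S"
    and closure: "\<And>b. finite b \<Longrightarrow> b \<subseteq> univ C' \<Longrightarrow> y \<in> flow_power ext.\<Phi> A closure_of conjugates A x b"
  shows "y \<in> lift_closed A Z"
  unfolding lift_closed_def mem_Collect_eq
proof (intro conjI y ballI)
  fix \<tau> assume \<tau>: "\<tau> \<in> Aut L C'"
  let ?f = "\<lambda>y. compose A r (compose A (type_act \<tau>) y)"
  have f_PiE: "?f w \<in> A \<rightarrow>\<^sub>E base.S" if "w \<in> A \<rightarrow>\<^sub>E ext.S" for w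
    using ext.compose_act_PiE[of \<tau> w A] \<tau> that by (intro compose_restrict_PiE) simp
  show "?f y \<in> Z"
  proof (rule base.mem_closed_if_approximated[OF closed_invariant_closedin[OF Z] f_PiE[OF y]])
    fix a assume a: "finite a" "a \<subseteq> univ C"
    then have "a \<subseteq> \<tau> ` univ C'"
      using univ_subset Aut_image[OF \<tau>] by simp
    then obtain b where b: "b \<subseteq> univ C'" "finite b" "a = \<tau> ` b"
      using finite_subset_image[OF a(1)] by metis
    have "\<exists>z\<in>Z. agree_over L I A a (?f w) z" if w: "w \<in> conjugates A x b" for w
      using conjugates_act_agree_over[OF Z x w b(2,1) \<tau>] a(2)
        agree_over_trans[OF agree_over_restrict[OF a(2)]]
      unfolding b(3) by blast
    then have "?f ` conjugates A x b \<subseteq> {v \<in> A \<rightarrow>\<^sub>E base.S. \<exists>z\<in>Z. agree_over L I A a v z}"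
      using f_PiE subsetD[OF conjugates_subset, of _ A x b] by (intro image_subsetI) simp
    moreover have "?f y \<in> flow_power base.\<Phi> A closure_of ?f ` conjugates A x b"
      using continuous_map_image_closure_subset[OF continuous_map_restrict_act[OF \<tau>]] closure[OF b(2,1)]
      by (rule subsetD[OF _ imageI])
    ultimately show "?f y \<in> flow_power base.\<Phi> A closure_of {v \<in> A \<rightarrow>\<^sub>E base.S. \<exists>z\<in>Z. agree_over L I A a v z}"
      by (rule subsetD[OF closure_of_mono])
  qed
qed

lemma image_restrict_lift_closed:
  assumes Z: "closed_invariant base.\<Phi> A Z"
  shows "compose A r ` lift_closed A Z = Z"
proof
  show "compose A r ` lift_closed A Z \<subseteq> Z"
  proof (rule image_subsetI)
    fix y assume y: "y \<in> lift_closed A Z"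
    then have "y \<in> A \<rightarrow>\<^sub>E ext.S" "compose A r (compose A (type_act (\<lambda>a\<in>univ C'. a)) y) \<in> Z"
      using id_Aut[OF ext.struct] by (simp_all add: lift_closed_def)
    then show "compose A r y \<in> Z"
      by (simp add: compose_type_act_fixed)
  qed
  show "Z \<subseteq> compose A r ` lift_closed A Z"
  proof
    fix x assume x: "x \<in> Z"
    have xS: "x \<in> A \<rightarrow>\<^sub>E base.S"
      using x closed_invariant_subset[OF Z] by auto
    obtain y where yS: "y \<in> A \<rightarrow>\<^sub>E ext.S" and "\<forall>b. finite b \<and> b \<subseteq> univ C' \<longrightarrow>
        y \<in> flow_power ext.\<Phi> A closure_of conjugates A x b"
      using conjugates_cluster_point[OF xS] by (rule bexE)
    then have y: "y \<in> flow_power ext.\<Phi> A closure_of conjugates A x b"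
      if "finite b" "b \<subseteq> univ C'" for b
      using that by simp
    show "x \<in> compose A r ` lift_closed A Z"
      using restrict_conjugates_closure[OF xS yS y, symmetric] conjugates_closure_lift_closed[OF Z x yS y]
      by (rule image_eqI)
  qed
qed

theorem closed_invariant_iso_restrict: "closed_invariant_iso ext.\<Phi> base.\<Phi> r A"
  unfolding closed_invariant_iso_def
proof (intro conjI allI impI)
  have "Z \<in> (`) (compose A r) ` Collect (closed_invariant ext.\<Phi> A)" if "closed_invariant base.\<Phi> A Z" for Z
    using image_restrict_lift_closed[OF that, symmetric] closed_invariant_lift_closed[OF that]
    by (intro image_eqI CollectI)
  then show "(`) (compose A r) ` Collect (closed_invariant ext.\<Phi> A) = Collect (closed_invariant base.\<Phi> A)"
    using closed_invariant_image_restrict by (intro subset_antisym subsetI) auto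
qed (elim conjE, rule subset_if_image_restrict_subset)

end

theorem theorem3p2:
  fixes L :: "('f, 'p) lang"
    and T :: "('f, 'p, unit) fm set"
    and I :: "'i set"
    and \<pi> :: "('f, 'p, 'i + 'a) fm set"
    and C C' :: "('f, 'p, 'a) struct"
    and F F' :: "('f, 'p, 'i + 'a) fm set rel"
    and \<M> \<M>' :: "(('f, 'p, 'i + 'a) fm set set \<Rightarrow> ('f, 'p, 'i + 'a) fm set set) set"
    and u u' :: "('f, 'p, 'i + 'a) fm set set \<Rightarrow> ('f, 'p, 'i + 'a) fm set set"
  defines "\<Phi> \<equiv> type_flow L I \<pi> C F"
    and "\<Phi>' \<equiv> type_flow L I \<pi> C' F'"
  assumes "complete_theory L T"
    and "is_model L T C" and "is_model L T C'"
    and "elementary_substruct L C C'"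
    and "partial_type L C I {} \<pi>"
    and "saturated natLeq L C" and "strongly_homogeneous natLeq L C"
    and "saturated natLeq L C'" and "strongly_homogeneous natLeq L C'"
    and "closed_invariant_equiv L I \<pi> C F"
    and "closed_invariant_equiv L I \<pi> C' F'"
    and "{(type_restrict L I C a, type_restrict L I C b) | a b. (a, b) \<in> F'} = F"
    and "minimal_left_ideal \<Phi> \<M>" and "u \<in> \<M>" and "ellis_mult \<Phi> u u = u"
    and "minimal_left_ideal \<Phi>' \<M>'" and "u' \<in> \<M>'" and "ellis_mult \<Phi>' u' u' = u'"
  shows "\<exists>h. h \<in> iso (ellis_group \<Phi>' \<M>' u') (ellis_group \<Phi> \<M> u) \<and>
     homeomorphic_map (tau_topology \<Phi>' \<M>' u') (tau_topology \<Phi> \<M> u) h"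
proof -
  interpret homogeneous_type_extension L I \<pi> C C'
    using assms by unfold_locales (auto simp: is_model_def partial_type_def)
  have congruence: "flow_congruence base.\<Phi> F" "flow_congruence ext.\<Phi> F'"
    using assms by (simp_all add: closed_invariant_equiv_iff)
  have flow: "compact_flow \<Phi>" "compact_flow \<Phi>'"
    unfolding \<Phi>_def \<Phi>'_def type_flow_eq
    by (intro base.compact_flow_quotient ext.compact_flow_quotient congruence)+
  have compatible: "{(r a, r b) |a b. (a, b) \<in> F'} = F"
    by fact
  let ?r = "\<lambda>c. F `` (r ` c)"
  have iso: "closed_invariant_iso \<Phi>' \<Phi> ?r A" for A :: "'j set"
    unfolding \<Phi>_def \<Phi>'_def type_flow_eq using restrict_onto compatible
    by (intro closed_invariant_iso_quotient congruence base.compact_flow_axioms ext.compact_flow_axioms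
        closed_invariant_iso_restrict) simp_all
  interpret corresponding_ellis_ideals \<Phi> \<M> u \<Phi>' \<M>' u' ?r
    using assms by (intro corresponding_ellis_ideals.intro corresponding_ellis_ideals_axioms.intro
        ellis_ideal.intro ellis_ideal_axioms.intro flow iso)
  show ?thesis
    by (rule ellis_groups_isomorphic)
qed

end
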